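(* For $\vec{x}=(a,b,c,d,e,f,g)^T\in V$, $$S(e-a-b)\,A(1-a,e-a,f-a,g-a)\,A(b,1+b-e,1+b-f,1+b-g)\,K_{p_0}(\vec{x})$$ $$+\,S(b-a)\,A(1+a-e,1+b-e,g-c,g-d)\,A(a,b,f-c,f-d)\,K_{n_4}(\vec{x})-B_5(\vec{x})\,K_{p_1}(\vec{x})=0.$$
   Context: $V=\{(a,b,c,d,e,f,g)^T\in\mathbb{C}^7: e+f+g-a-b-c-d=1\}$. ${}_4F_3\left[\begin{smallmatrix}a,b,c,d\\ e,f,g\end{smallmatrix};1\right]=\sum_{n\ge0}\frac{(a)_n(b)_n(c)_n(d)_n}{n!(e)_n(f)_n(g)_n}$, with $(a)_n$ the rising factorial. For $(a,b,c,d,e,f,g)^T\in V$, $$K(a;b,c,d;e,f,g)=\frac{{}_4F_3\left[\begin{smallmatrix}a,b,c,d\\ e,f,g\end{smallmatrix};1\right]}{\sin\pi a\,\Gamma(a)\Gamma(1+a-e)\Gamma(1+a-f)\Gamma(1+a-g)\Gamma(e)\Gamma(f)\Gamma(g)}+\frac{{}_4F_3\left[\begin{smallmatrix}a,1+a-e,1+a-f,1+a-g\\ 1+a-b,1+a-c,1+a-d\end{smallmatrix};1\right]}{\sin\pi a\,\Gamma(a)\Gamma(b)\Gamma(c)\Gamma(d)\Gamma(1+a-b)\Gamma(1+a-c)\Gamma(1+a-d)}.$$ Notation: $S(a_1,\dots,a_n)=\sin\pi a_1\cdots\sin\pi a_n$; $A(x,y,z,w)=\frac{1}{\Gamma(x)\Gamma(y)\Gamma(z)\Gamma(w)}$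 (with $1/\Gamma=0$ at nonpositive integers). The relation is asserted for those $\vec{x}\in V$ at which the $K$ functions occurring are defined (no lower parameter of an occurring series is a nonpositive integer, no sine in an occurring denominator vanishes). Here $K_{p_0}(\vec{x})=K(a;b,c,d;e,f,g)$, $K_{p_1}(\vec{x})=K(b;c,d,a;e,f,g)$, $K_{n_4}(\vec{x})=K(e-a;e-b,e-c,e-d;1+e-f,1+e-g,e)$, and $B_5(\vec{x})=\pi^{-4}S(b,e-b)\,[S(b-a,c-a,d-a)+S(e-2a,f-a,g-a)]$. *)

theory Defs
  imports "HOL-Analysis.Analysis"
begin

type_synonym complex7 =
  "complex \<times> complex \<times> complex \<times> complex \<times> complex \<times> complex \<times> complex"

definition V :: "complex7 set" where
  "V = {(a, b, c, d, e, f, g). e + f + g - a - b - c - d = 1}"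

(* Both series in K have excess (sum of the lower parameters minus sum of the upper ones)
   equal to 1 on V, so they converge absolutely whenever no lower parameter is a
   nonpositive integer. *)
definition F43 :: "complex \<Rightarrow> complex \<Rightarrow> complex \<Rightarrow> complex \<Rightarrow> complex \<Rightarrow> complex \<Rightarrow> complex \<Rightarrow> complex" where
  "F43 a b c d e f g =
     (\<Sum>n. pochhammer a n * pochhammer b n * pochhammer c n * pochhammer d n /
          (fact n * pochhammer e n * pochhammer f n * pochhammer g n))"

definition S :: "complex list \<Rightarrow> complex" where
  "S xs = (\<Prod>x\<leftarrow>xs. sin (of_real pi * x))"

(* rGamma is the entire function 1/Gamma, with value 0 at the nonpositive integers. *)
definition A :: "complex \<Rightarrow> complex \<Rightarrow> complex \<Rightarrow> complex \<Rightarrow> complex" where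
  "A x y z w = rGamma x * rGamma y * rGamma z * rGamma w"

definition K :: "complex \<Rightarrow> complex \<Rightarrow> complex \<Rightarrow> complex \<Rightarrow> complex \<Rightarrow> complex \<Rightarrow> complex \<Rightarrow> complex" where
  "K a b c d e f g =
     F43 a b c d e f g / sin (of_real pi * a)
       * (rGamma a * rGamma (1 + a - e) * rGamma (1 + a - f) * rGamma (1 + a - g)
          * rGamma e * rGamma f * rGamma g)
   + F43 a (1 + a - e) (1 + a - f) (1 + a - g) (1 + a - b) (1 + a - c) (1 + a - d)
       / sin (of_real pi * a)
       * (rGamma a * rGamma b * rGamma c * rGamma d
          * rGamma (1 + a - b) * rGamma (1 + a - c) * rGamma (1 + a - d))"

definition K_defined :: "complex \<Rightarrow> complex \<Rightarrow> complex \<Rightarrow> complex \<Rightarrow> complex \<Rightarrow> complex \<Rightarrow> complex \<Rightarrow> bool" where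
  "K_defined a b c d e f g \<longleftrightarrow>
     e \<notin> \<int>\<^sub>\<le>\<^sub>0 \<and> f \<notin> \<int>\<^sub>\<le>\<^sub>0 \<and> g \<notin> \<int>\<^sub>\<le>\<^sub>0 \<and>
     1 + a - b \<notin> \<int>\<^sub>\<le>\<^sub>0 \<and> 1 + a - c \<notin> \<int>\<^sub>\<le>\<^sub>0 \<and> 1 + a - d \<notin> \<int>\<^sub>\<le>\<^sub>0 \<and>
     sin (of_real pi * a) \<noteq> 0"

fun K_p0 :: "complex7 \<Rightarrow> complex" where
  "K_p0 (a, b, c, d, e, f, g) = K a b c d e f g"

fun K_p1 :: "complex7 \<Rightarrow> complex" where
  "K_p1 (a, b, c, d, e, f, g) = K b c d a e f g"

fun K_n4 :: "complex7 \<Rightarrow> complex" where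
  "K_n4 (a, b, c, d, e, f, g) =
     K (e - a) (e - b) (e - c) (e - d) (1 + e - f) (1 + e - g) e"

fun B5 :: "complex7 \<Rightarrow> complex" where
  "B5 (a, b, c, d, e, f, g) =
     S [b, e - b] * (S [b - a, c - a, d - a] + S [e - 2 * a, f - a, g - a]) / of_real pi ^ 4"

end

theory Submission
  imports Defs "HOL-Complex_Analysis.Complex_Analysis"
begin

text \<open>
  Let \<open>N\<close> range over the numerators \<^emph>\<open>Lnum\<close> of the very-well-poised combinations \<open>F - F'\<close> of two
  Saalschuetzian series. Gauss's theorem turns \<open>N\<close> into a double series of positive terms for suitable real parameters,
  and interchanging the two summations gives a two-term relation for \<open>N\<close>. Two applications of it link the
  family of series at \<open>(a, b, c, d; e, f, g)\<close> with the dual family at \<open>(e - a, e - b, e - c, e - d; 1 + e - f, 1 + e - g, e)\<close>.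

  The series of one family are the values, up to Gamma factors, of a single bilateral series
  \<open>E(s) = \<Sum>n. \<Prod>k. rGamma (1 - a\<^sub>k - s - n) * rGamma (e\<^sub>k + s + n)\<close>. It is entire, 1-periodic and
  \<open>o(exp (4 * pi * \<bar>Im s\<bar>))\<close>, hence a trigonometric polynomial of degree one, so any four of its values are linearly
  dependent. The four-term relations express every \<open>K\<close> through two of the \<open>N\<close>. Since the duality maps the two
  \<open>N\<close> of one family to those of the other, the proposition becomes a trigonometric identity for each of the two coefficients.

  All identities are first proved on a small box of real parameters. After regularization both sides are
  entire on the hyperplane \<open>V\<close>, so the identities extend by analytic continuation along complex lines.
\<close>

section \<open>Saalschuetzian series as entire functions\<close>

text \<open>One series of \<open>N\<close> alone admits no such double series. The contiguous
  relations of the inner sums carry a boundary term \<open>Gamma \<gamma>\<close>, the same for the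
  series and for its companion shifted by \<open>1 - e\<close>; only the difference satisfies a
  homogeneous recurrence, whose solution is the nonterminating form of Saalschuetz's theorem.

  Growth is controlled without Stirling's formula: for a Gamma quotient of excess 2, multiplication
  by s^2 leaves a function that changes by a factor 1 + O(1/|s|^2) under s -> s + 1. The same
  estimate gives convergence of all series. Dividing the bilateral series by four sines cancels the
  exponential growth and leaves |Im s|^(-1/2).

  The four points chosen are 0, -f, -g and -a. The values at 0 and -a are the two series of
  \<open>K\<close>; the value at 0 paired with that at -f, or with that at -g, gives the two
  \<open>N\<close>.

  The box serves two purposes: positivity permits the interchange of sums, and no Gamma factor or
  sine used as a divisor vanishes there. The box for the final relation is chosen inside a region
  that the duality maps to itself.\<close>

lemma prod_one_plus_approx:
  fixes x :: "nat \<Rightarrow> 'a::real_normed_field"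
  assumes "\<And>k. k < n \<Longrightarrow> norm (x k) \<le> \<delta>" and "\<delta> \<le> 1"
  shows "norm ((\<Prod>k<n. 1 + x k) - 1 - (\<Sum>k<n. x k)) \<le> 4 ^ n * \<delta>\<^sup>2"
  using assms(1)
proof (induction n)
  case (Suc n)
  have d0: "0 \<le> \<delta>" using Suc.prems[of n] norm_ge_zero order_trans by blast
  define p s where "p = (\<Prod>k<n. 1 + x k) - 1 - (\<Sum>k<n. x k)" and "s = (\<Sum>k<n. x k)"
  have p: "norm p \<le> 4 ^ n * \<delta>\<^sup>2" unfolding p_def by (rule Suc.IH) (use Suc.prems in auto)
  have s: "norm s \<le> real n * \<delta>"
    unfolding s_def by (rule sum_norm_bound[THEN order_trans]) (use Suc.prems in auto)
  have x: "norm (x n) \<le> \<delta>" using Suc.prems by auto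
  \<comment> \<open>The old error grows by a factor of norm at most 2, and the cross term
    \<open>x n * s\<close> is at most n times \<delta> squared; the base 4 leaves room for
    both.\<close>
  have "(\<Prod>k<Suc n. 1 + x k) - 1 - (\<Sum>k<Suc n. x k) = p * (1 + x n) + x n * s"
    by (simp add: p_def s_def algebra_simps)
  also have "norm \<dots> \<le> norm p * norm (1 + x n) + norm (x n) * norm s"
    by (metis norm_mult norm_triangle_ineq)
  also have "\<dots> \<le> (4 ^ n * \<delta>\<^sup>2) * 2 + \<delta> * (real n * \<delta>)"
  proof (intro add_mono mult_mono p x s)
    show "norm (1 + x n) \<le> 2"
      using norm_triangle_ineq[of 1 "x n"] x assms(2) by simp
  qed (use d0 in auto)
  also have "\<dots> = (2 * 4 ^ n + real n) * \<delta>\<^sup>2" by (simp add: power2_eq_square algebra_simps)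
  also have "\<dots> \<le> 4 ^ Suc n * \<delta>\<^sup>2"
  proof (intro mult_right_mono)
    have "real n < 2 ^ n" by (rule of_nat_less_two_power)
    also have "(2::real) ^ n \<le> 4 ^ n" by (intro power_mono) auto
    also have "\<dots> \<le> 2 * 4 ^ n" by simp
    finally show "2 * 4 ^ n + real n \<le> 4 ^ Suc n" by simp
  qed auto
  finally show ?case .
qed auto

text \<open>Up to second order in 1/s the quotient is 1 + (sum of \<alpha> - sum of \<beta>)/s.
  Equal sums remove the linear term, uniformly for parameters bounded by \<open>M\<close>.\<close>

lemma prod_ratio_approx:
  fixes M :: real and n :: nat
  assumes "M \<ge> 0"
  obtains R C where "R \<ge> 1" and "C > 0"
    and "\<And>s \<alpha> \<beta>. norm (s::complex) \<ge> R \<Longrightarrow> (\<forall>k<n. norm (\<alpha> k) \<le> M \<and> norm (\<beta> k) \<le> M) \<Longrightarrow>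
      (\<Sum>k<n. \<alpha> k) = (\<Sum>k<n. \<beta> k) \<Longrightarrow>
      (\<forall>k<n. \<beta> k + s \<noteq> 0) \<and> norm ((\<Prod>k<n. \<alpha> k + s) / (\<Prod>k<n. \<beta> k + s) - 1) \<le> C / (norm s)\<^sup>2"
proof -
  show thesis
  \<comment> \<open>\<open>R >= 2 * M\<close> keeps each \<open>1 + \<beta> k / s\<close> of norm at
    least 1/2. The constant is 2 * 4^n from the two expansions times 2^n from the lower bound on
    \<open>Q\<close>; the summand 1 keeps it positive when \<open>M = 0\<close>.\<close>
  proof (rule that[of "max 1 (2 * M)" "2 * 8 ^ n * (M\<^sup>2 + 1)"], goal_cases)
    case 1
    show ?case by simp
  next
    case 2
    have "M\<^sup>2 + 1 > 0" by (simp add: add_nonneg_pos)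
    thus ?case by simp
  next
    case (3 s \<alpha> \<beta>)
    note R = 3(1) and M = 3(2) and sum = 3(3)
    have s0: "s \<noteq> 0" "norm s > 0" using R by auto
    define \<delta> where "\<delta> = M / norm s"
    have \<delta>: "\<delta> \<le> 1/2" using R s0 by (simp add: \<delta>_def field_simps)
    have x: "norm (\<alpha> k / s) \<le> \<delta>" "norm (\<beta> k / s) \<le> \<delta>" if "k < n" for k
      using M that s0 by (auto simp: \<delta>_def norm_divide divide_right_mono)
    have y: "norm (1 + \<beta> k / s) \<ge> 1/2" if "k < n" for k
      using norm_triangle_ineq2[of 1 "- (\<beta> k / s)"] x(2)[OF that] \<delta> by simp
    have nz: "\<beta> k + s \<noteq> 0" if "k < n" for k
    proof
      assume "\<beta> k + s = 0"
      hence "1 + \<beta> k / s = 0" using s0 by (simp add: field_simps)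
      thus False using y[OF that] by simp
    qed
    have *: "(\<Prod>k<n. \<gamma> k + s) = s ^ n * (\<Prod>k<n. 1 + \<gamma> k / s)" for \<gamma> :: "nat \<Rightarrow> complex"
    proof -
      have "(\<Prod>k<n. \<gamma> k + s) = (\<Prod>k<n. s * (1 + \<gamma> k / s))"
        using s0 by (intro prod.cong) (auto simp: field_simps)
      thus ?thesis by (simp add: prod.distrib)
    qed
    define P Q where "P = (\<Prod>k<n. 1 + \<alpha> k / s)" and "Q = (\<Prod>k<n. 1 + \<beta> k / s)"
    have Q: "norm Q \<ge> (1/2) ^ n"
    proof -
      have "(\<Prod>k<n. 1/2::real) \<le> (\<Prod>k<n. norm (1 + \<beta> k / s))"
        by (rule prod_mono) (use y in auto)
      thus ?thesis by (simp add: Q_def prod_norm)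
    qed
    moreover have "(1/2::real) ^ n > 0" by simp
    ultimately have Q0: "Q \<noteq> 0" by fastforce
    have "(\<Sum>k<n. \<alpha> k / s) = (\<Sum>k<n. \<beta> k / s)"
      using sum by (simp flip: sum_divide_distrib)
    hence "P - Q = (P - 1 - (\<Sum>k<n. \<alpha> k / s)) - (Q - 1 - (\<Sum>k<n. \<beta> k / s))" by simp
    also have "norm \<dots> \<le> 4 ^ n * \<delta>\<^sup>2 + 4 ^ n * \<delta>\<^sup>2"
      unfolding P_def Q_def
      by (rule norm_triangle_le_diff, intro add_mono prod_one_plus_approx) (use x \<delta> in auto)
    finally have PQ: "norm (P - Q) \<le> 2 * 4 ^ n * \<delta>\<^sup>2" by (simp add: mult_ac)
    have "(\<Prod>k<n. \<alpha> k + s) / (\<Prod>k<n. \<beta> k + s) - 1 = (s ^ n * P) / (s ^ n * Q) - 1"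
      by (simp only: * P_def Q_def)
    also have "\<dots> = (P - Q) / Q" using s0 Q0 by (simp add: field_simps)
    also have "norm \<dots> \<le> (2 * 4 ^ n * \<delta>\<^sup>2) / (1/2) ^ n"
      unfolding norm_divide by (rule frac_le) (use PQ Q in auto)
    also have "\<dots> = 2 * 8 ^ n * \<delta>\<^sup>2"
      by (simp add: power_one_over field_simps flip: power_mult_distrib)
    also have "\<dots> \<le> 2 * 8 ^ n * (M\<^sup>2 + 1) / (norm s)\<^sup>2"
      using s0 by (simp add: \<delta>_def power_divide field_simps)
    finally show ?case using nz by blast
  qed
qed

text \<open>The excess 2 is balanced by padding to six factors, with two extra \<open>s + 1\<close>
  above and two extra \<open>s\<close> below. The resulting factor is the ratio of consecutive
  values of s^2, so it measures s^2 times the term.\<close>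

lemma saalschuetz_ratio_approx:
  fixes M :: real
  assumes "M \<ge> 0"
  obtains R C where "R \<ge> 1" and "C > 0"
    and "\<And>s \<alpha> \<beta>. norm (s::complex) \<ge> R \<Longrightarrow> (\<forall>k<4. norm (\<alpha> k) \<le> M \<and> norm (\<beta> k) \<le> M) \<Longrightarrow>
      (\<Sum>k<4. \<beta> k) = (\<Sum>k<4. \<alpha> k) + 2 \<Longrightarrow>
      (\<forall>k<(4::nat). \<beta> k + s \<noteq> 0) \<and>
      norm ((\<Prod>k<4. \<alpha> k + s) / (\<Prod>k<4. \<beta> k + s) * ((s + 1) / s)\<^sup>2 - 1) \<le> C / (norm s)\<^sup>2"
proof -
  have "max 1 M \<ge> 0" by simp
  then obtain R C where R: "R \<ge> 1" "C > 0"
    and *: "\<And>s \<alpha> \<beta>. norm (s::complex) \<ge> R \<Longrightarrow> (\<forall>k<6. norm (\<alpha> k) \<le> max 1 M \<and> norm (\<beta> k) \<le> max 1 M) \<Longrightarrow>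
      (\<Sum>k<6. \<alpha> k) = (\<Sum>k<6. \<beta> k) \<Longrightarrow>
      (\<forall>k<(6::nat). \<beta> k + s \<noteq> 0) \<and> norm ((\<Prod>k<6. \<alpha> k + s) / (\<Prod>k<6. \<beta> k + s) - 1) \<le> C / (norm s)\<^sup>2"
    by (rule prod_ratio_approx[where n = 6]) (rule that)
  show ?thesis
  proof (rule that[OF R], goal_cases)
    case (1 s \<alpha> \<beta>)
    note s = 1(1) and M = 1(2) and sum = 1(3)
    define \<alpha>' \<beta>' where "\<alpha>' = (\<lambda>k. if k < 4 then \<alpha> k else 1)" and "\<beta>' = (\<lambda>k. if k < (4::nat) then \<beta> k else 0)"
    have 6: "{..<6} = insert 4 (insert 5 {..<4::nat})" by auto
    have "(\<forall>k<6. \<beta>' k + s \<noteq> 0) \<and>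
       norm ((\<Prod>k<6. \<alpha>' k + s) / (\<Prod>k<6. \<beta>' k + s) - 1) \<le> C / (norm s)\<^sup>2"
    proof (rule *[OF s])
      show "\<forall>k<6. norm (\<alpha>' k) \<le> max 1 M \<and> norm (\<beta>' k) \<le> max 1 M"
        using M by (auto simp: \<alpha>'_def \<beta>'_def le_max_iff_disj)
      show "(\<Sum>k<6. \<alpha>' k) = (\<Sum>k<6. \<beta>' k)"
        using sum by (simp add: 6 \<alpha>'_def \<beta>'_def)
    qed
    moreover have "(\<Prod>k<6. \<alpha>' k + s) = (1 + s)\<^sup>2 * (\<Prod>k<4. \<alpha> k + s)"
      by (simp add: 6 \<alpha>'_def power2_eq_square)
    moreover have "(\<Prod>k<6. \<beta>' k + s) = s\<^sup>2 * (\<Prod>k<4. \<beta> k + s)"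
      by (simp add: 6 \<beta>'_def power2_eq_square)
    moreover have "\<beta> k + s \<noteq> 0" if "k < 4" "\<forall>k<6. \<beta>' k + s \<noteq> 0" for k
      using that(2)[rule_format, of k] that(1) by (auto simp: \<beta>'_def)
    ultimately show ?case
      by (auto simp: power_divide mult_ac add.commute)
  qed
qed

text \<open>From index \<open>N\<close> on, n^2 times the term grows by at most the factor
  exp(C/n^2) per step, and these factors have a bounded product. The recurrence is stated without
  division because a factor \<open>\<beta> k z + of_nat n\<close> may vanish for small n.\<close>

lemma saalschuetz_term_bound:
  fixes t :: "nat \<Rightarrow> 'x \<Rightarrow> complex" and \<alpha> \<beta> :: "nat \<Rightarrow> 'x \<Rightarrow> complex"
  assumes M: "\<And>k z. k < 4 \<Longrightarrow> z \<in> X \<Longrightarrow> norm (\<alpha> k z) \<le> M \<and> norm (\<beta> k z) \<le> M"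
    and sum: "\<And>z. z \<in> X \<Longrightarrow> (\<Sum>k<4. \<beta> k z) = (\<Sum>k<4. \<alpha> k z) + 2"
    and step: "\<And>n z. z \<in> X \<Longrightarrow> t (Suc n) z * (\<Prod>k<4. \<beta> k z + of_nat n) = t n z * (\<Prod>k<4. \<alpha> k z + of_nat n)"
    and bdd: "\<And>n. \<exists>B. \<forall>z\<in>X. norm (t n z) \<le> B"
  shows "\<exists>B N. \<forall>n\<ge>N. \<forall>z\<in>X. norm (t n z) \<le> B / (real n)\<^sup>2"
proof -
  have "max 0 M \<ge> 0" by simp
  then obtain R C where R: "R \<ge> 1" "C > 0"
    and *: "\<And>s \<alpha> \<beta>. norm (s::complex) \<ge> R \<Longrightarrow> (\<forall>k<4. norm (\<alpha> k) \<le> max 0 M \<and> norm (\<beta> k) \<le> max 0 M) \<Longrightarrow>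
      (\<Sum>k<4. \<beta> k) = (\<Sum>k<4. \<alpha> k) + 2 \<Longrightarrow>
      (\<forall>k<(4::nat). \<beta> k + s \<noteq> 0) \<and>
      norm ((\<Prod>k<4. \<alpha> k + s) / (\<Prod>k<4. \<beta> k + s) * ((s + 1) / s)\<^sup>2 - 1) \<le> C / (norm s)\<^sup>2"
    by (rule saalschuetz_ratio_approx) (rule that)
  define N where "N = nat \<lceil>R\<rceil>"
  have N: "real n \<ge> R" "n \<ge> 1" if "n \<ge> N" for n
    using that R by (auto simp: N_def)
  obtain B where B: "\<And>z. z \<in> X \<Longrightarrow> norm (t N z) \<le> B" using bdd by metis
  define T where "T = (\<Sum>n. 1 / (real n)\<^sup>2)"
  have summ: "summable (\<lambda>n. 1 / (real n)\<^sup>2)"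
    using inverse_power_summable[of 2, where 'a = real] by (simp add: field_simps)
  have step2: "norm (t (Suc n) z) * (real (Suc n))\<^sup>2 \<le> norm (t n z) * (real n)\<^sup>2 * exp (C / (real n)\<^sup>2)"
    if n: "n \<ge> N" and z: "z \<in> X" for n z
  proof -
    let ?s = "of_nat n :: complex"
    let ?q = "(\<Prod>k<4. \<alpha> k z + ?s) / (\<Prod>k<4. \<beta> k z + ?s)"
    have q: "\<forall>k<4. \<beta> k z + ?s \<noteq> 0" "norm (?q * ((?s + 1) / ?s)\<^sup>2 - 1) \<le> C / (norm ?s)\<^sup>2"
      using *[of ?s "\<lambda>k. \<alpha> k z" "\<lambda>k. \<beta> k z"] N[OF n] M[OF _ z] sum[OF z] by (auto simp: le_max_iff_disj)
    have "norm (?q * ((?s + 1) / ?s)\<^sup>2) \<le> 1 + C / (real n)\<^sup>2"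
      using norm_triangle_ineq2[of "?q * ((?s + 1) / ?s)\<^sup>2" 1] q(2) by simp
    also have "\<dots> \<le> exp (C / (real n)\<^sup>2)" by (rule exp_ge_add_one_self)
    finally have q3: "norm (?q * ((?s + 1) / ?s)\<^sup>2) \<le> exp (C / (real n)\<^sup>2)" .
    have "t (Suc n) z = t n z * ?q"
      using step[OF z, of n] q(1) by (simp add: field_simps)
    hence "t (Suc n) z * (?s + 1)\<^sup>2 = t n z * ?s\<^sup>2 * (?q * ((?s + 1) / ?s)\<^sup>2)"
      using N(2)[OF n] by (simp add: power_divide)
    hence "norm (t (Suc n) z * (?s + 1)\<^sup>2) = norm (t n z * ?s\<^sup>2) * norm (?q * ((?s + 1) / ?s)\<^sup>2)"
      by (simp only: norm_mult)
    also have "\<dots> \<le> norm (t n z * ?s\<^sup>2) * exp (C / (real n)\<^sup>2)"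
      by (intro mult_left_mono q3) auto
    also have "norm (t (Suc n) z * (?s + 1)\<^sup>2) = norm (t (Suc n) z) * (real (Suc n))\<^sup>2"
      by (metis norm_mult norm_power norm_of_nat of_nat_Suc add.commute)
    finally show ?thesis by (simp add: norm_mult norm_power)
  qed
  have ind: "norm (t n z) * (real n)\<^sup>2 \<le> B * (real N)\<^sup>2 * exp (C * (\<Sum>k<n. 1 / (real k)\<^sup>2))"
    if "n \<ge> N" and z: "z \<in> X" for n z
    using that(1)
  proof (induction n rule: dec_induct)
    case base
    have "norm (t N z) * (real N)\<^sup>2 \<le> B * (real N)\<^sup>2 * 1" using B[OF z] by (simp add: mult_right_mono)
    also have "\<dots> \<le> B * (real N)\<^sup>2 * exp (C * (\<Sum>k<N. 1 / (real k)\<^sup>2))"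
      using R order_trans[OF norm_ge_zero B[OF z]]
      by (intro mult_left_mono) (auto intro!: mult_nonneg_nonneg sum_nonneg)
    finally show ?case .
  next
    case (step n)
    have "norm (t (Suc n) z) * (real (Suc n))\<^sup>2 \<le> norm (t n z) * (real n)\<^sup>2 * exp (C / (real n)\<^sup>2)"
      using step2[OF step.hyps(1) z] .
    also have "\<dots> \<le> B * (real N)\<^sup>2 * exp (C * (\<Sum>k<n. 1 / (real k)\<^sup>2)) * exp (C / (real n)\<^sup>2)"
      by (intro mult_right_mono step.IH) auto
    also have "\<dots> = B * (real N)\<^sup>2 * exp (C * (\<Sum>k<Suc n. 1 / (real k)\<^sup>2))"
      by (simp add: exp_add distrib_left)
    finally show ?case .
  qed
  show ?thesis
  proof (intro exI allI impI ballI)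
    fix n z assume n: "n \<ge> N" and z: "z \<in> X"
    have "norm (t n z) * (real n)\<^sup>2 \<le> B * (real N)\<^sup>2 * exp (C * (\<Sum>k<n. 1 / (real k)\<^sup>2))"
      by (rule ind) fact+
    also have "\<dots> \<le> B * (real N)\<^sup>2 * exp (C * T)"
    proof -
      have "(\<Sum>k<n. 1 / (real k)\<^sup>2) \<le> T"
        unfolding T_def by (rule sum_le_suminf[OF summ]) auto
      thus ?thesis
        using R order_trans[OF norm_ge_zero B[OF z]]
        by (intro mult_left_mono) (auto intro!: mult_nonneg_nonneg)
    qed
    finally show "norm (t n z) \<le> (B * (real N)\<^sup>2 * exp (C * T)) / (real n)\<^sup>2"
      using N(2)[OF n] by (simp add: field_simps)
  qed
qed

text \<open>On every unit disc the parameters are bounded, so the terms are uniformly O(1/n^2) and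
  the Weierstrass M-test gives locally uniform convergence.\<close>

lemma saalschuetz_series_holomorphic:
  fixes t :: "nat \<Rightarrow> complex \<Rightarrow> complex" and \<alpha> \<beta> :: "nat \<Rightarrow> complex \<Rightarrow> complex"
  assumes cont: "\<And>k. k < 4 \<Longrightarrow> continuous_on UNIV (\<alpha> k) \<and> continuous_on UNIV (\<beta> k)"
    and sum: "\<And>z. (\<Sum>k<4. \<beta> k z) = (\<Sum>k<4. \<alpha> k z) + 2"
    and step: "\<And>n z. t (Suc n) z * (\<Prod>k<4. \<beta> k z + of_nat n) = t n z * (\<Prod>k<4. \<alpha> k z + of_nat n)"
    and hol: "\<And>n. t n holomorphic_on UNIV"
  shows "summable (\<lambda>n. norm (t n z))" "(\<lambda>z. \<Sum>n. t n z) holomorphic_on UNIV"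
proof -
  have bnd: "\<exists>B N. \<forall>n\<ge>N. \<forall>z\<in>cball w 1. norm (t n z) \<le> B / (real n)\<^sup>2" for w
  proof -
    have "bounded (\<alpha> k ` cball w 1 \<union> \<beta> k ` cball w 1)" if "k < 4" for k
      using cont[OF that] by (intro bounded_Un[THEN iffD2] conjI compact_imp_bounded
        compact_continuous_image) (auto intro: continuous_on_subset)
    hence "\<forall>k\<in>{..<4}. \<exists>M. \<forall>x\<in>\<alpha> k ` cball w 1 \<union> \<beta> k ` cball w 1. norm x \<le> M"
      by (auto simp: bounded_iff)
    then obtain M where M: "\<And>k. k < 4 \<Longrightarrow> \<forall>x\<in>\<alpha> k ` cball w 1 \<union> \<beta> k ` cball w 1. norm x \<le> M k"
      by (metis lessThan_iff)
    show ?thesis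
    proof (rule saalschuetz_term_bound)
      fix k z assume k: "k < (4::nat)" and z: "z \<in> cball w (1::real)"
      have "M k \<le> (\<Sum>k<4. max 0 (M k))"
        using k by (intro order_trans[OF _ member_le_sum[of k]]) auto
      thus "norm (\<alpha> k z) \<le> (\<Sum>k<4. max 0 (M k)) \<and> norm (\<beta> k z) \<le> (\<Sum>k<4. max 0 (M k))"
        using M[OF k] z by (blast intro: order_trans)
    next
      fix n
      have "bounded (t n ` cball w 1)"
        by (intro compact_imp_bounded compact_continuous_image holomorphic_on_imp_continuous_on
          holomorphic_on_subset[OF hol]) auto
      thus "\<exists>B. \<forall>z\<in>cball w 1. norm (t n z) \<le> B" by (auto simp: bounded_iff)
    qed (use sum step in auto)
  qed
  have summ: "summable (\<lambda>n. B / (real n)\<^sup>2)" for B :: real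
    using summable_mult[OF inverse_power_summable[of 2, where 'a = real], of B] by (simp add: field_simps)
  show "summable (\<lambda>n. norm (t n z))"
  proof -
    obtain B N where "\<forall>n\<ge>N. \<forall>w\<in>cball z 1. norm (t n w) \<le> B / (real n)\<^sup>2" using bnd by blast
    thus ?thesis by (intro summable_comparison_test[OF _ summ[of B]] exI[of _ N]) auto
  qed
  show "(\<lambda>z. \<Sum>n. t n z) holomorphic_on UNIV"
  proof (rule holomorphic_uniform_sequence)
    show "(\<lambda>z. \<Sum>n<m. t n z) holomorphic_on UNIV" for m
      by (intro holomorphic_on_sum hol)
    fix w :: complex
    obtain B N where B: "\<forall>n\<ge>N. \<forall>z\<in>cball w 1. norm (t n z) \<le> B / (real n)\<^sup>2" using bnd by blast
    have "uniform_limit (cball w 1) (\<lambda>m z. \<Sum>n<m. t n z) (\<lambda>z. \<Sum>n. t n z) sequentially"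
      by (rule Weierstrass_m_test_ev[OF _ summ[of B]])
        (use B in \<open>auto simp: eventually_sequentially\<close>)
    thus "\<exists>d>0. cball w d \<subseteq> UNIV \<and> uniform_limit (cball w d) (\<lambda>m z. \<Sum>n<m. t n z) (\<lambda>z. \<Sum>n. t n z) sequentially"
      by (intro exI[of _ 1]) auto
  qed auto
qed

lemma prod_lessThan_4: "(\<Prod>k<4. f k) = f 0 * f 1 * f 2 * f (3::nat)"
  and sum_lessThan_4: "(\<Sum>k<4. g k) = g 0 + g 1 + g 2 + g (3::nat)"
  by (simp_all add: eval_nat_numeral)

lemma less_4_cases:
  assumes "P 0" "P 1" "P 2" "P (3::nat)" "k < 4"
  shows "P k"
proof -
  have "k = 0 \<or> k = 1 \<or> k = 2 \<or> k = 3" using assms(5) by auto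
  thus ?thesis using assms(1-4) by auto
qed

section \<open>Regularized Saalschuetzian series\<close>

text \<open>Reciprocal Gamma factors replace the lower Pochhammer symbols, which removes all poles;
  n! enters as a further lower parameter 1, so all four are treated alike.\<close>

definition Freg_term :: "complex \<Rightarrow> complex \<Rightarrow> complex \<Rightarrow> complex \<Rightarrow> complex \<Rightarrow> complex \<Rightarrow> complex \<Rightarrow> nat \<Rightarrow> complex" where
  "Freg_term a b c d e f g n = pochhammer a n * pochhammer b n * pochhammer c n * pochhammer d n
     * (rGamma (1 + of_nat n) * rGamma (e + of_nat n) * rGamma (f + of_nat n) * rGamma (g + of_nat n))"

definition Freg :: "complex \<Rightarrow> complex \<Rightarrow> complex \<Rightarrow> complex \<Rightarrow> complex \<Rightarrow> complex \<Rightarrow> complex \<Rightarrow> complex" where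
  "Freg a b c d e f g = (\<Sum>n. Freg_term a b c d e f g n)"

lemma Freg_term_Suc:
  "Freg_term a b c d e f g (Suc n) * ((1 + of_nat n) * (e + of_nat n) * (f + of_nat n) * (g + of_nat n))
   = Freg_term a b c d e f g n * ((a + of_nat n) * (b + of_nat n) * (c + of_nat n) * (d + of_nat n))"
proof -
  have *: "rGamma (x + of_nat n) = (x + of_nat n) * rGamma (x + of_nat (Suc n))" for x :: complex
    using rGamma_plus1[of "x + of_nat n"] by (simp add: add_ac)
  show ?thesis
    unfolding Freg_term_def pochhammer_Suc *[of 1] *[of e] *[of f] *[of g] by (simp only: mult_ac)
qed

lemma pochhammer_holomorphic [holomorphic_intros]:
  "f holomorphic_on X \<Longrightarrow> (\<lambda>z. pochhammer (f z) n) holomorphic_on X"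
  unfolding pochhammer_prod by (intro holomorphic_intros)

text \<open>The parameters are functions of one variable because the continuation later runs along
  complex lines. Counting the lower parameter 1, the balance condition is the excess 2 of the
  general lemma.\<close>

lemma
  assumes "a holomorphic_on UNIV" "b holomorphic_on UNIV" "c holomorphic_on UNIV" "d holomorphic_on UNIV"
    "e holomorphic_on UNIV" "f holomorphic_on UNIV" "g holomorphic_on UNIV"
    and sum: "\<And>z. e z + f z + g z = a z + b z + c z + d z + 1"
  shows summable_Freg_aux: "summable (\<lambda>n. norm (Freg_term (a z) (b z) (c z) (d z) (e z) (f z) (g z) n))"
    and holomorphic_Freg: "(\<lambda>z. Freg (a z) (b z) (c z) (d z) (e z) (f z) (g z)) holomorphic_on UNIV"
proof -
  define \<alpha> \<beta> where "\<alpha> = (\<lambda>k. [a, b, c, d] ! k)" and "\<beta> = (\<lambda>k. [\<lambda>_. 1, e, f, g] ! k)"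
  define t where "t = (\<lambda>n z. Freg_term (a z) (b z) (c z) (d z) (e z) (f z) (g z) n)"
  have 1: "continuous_on UNIV (\<alpha> k) \<and> continuous_on UNIV (\<beta> k)" if "k < 4" for k
    by (rule less_4_cases[OF _ _ _ _ that])
      (simp_all add: \<alpha>_def \<beta>_def assms(1-7)[THEN holomorphic_on_imp_continuous_on])
  have 2: "(\<Sum>k<4. \<beta> k z) = (\<Sum>k<4. \<alpha> k z) + 2" for z
    using sum[of z] by (simp add: sum_lessThan_4 \<alpha>_def \<beta>_def algebra_simps)
  have 3: "t (Suc n) z * (\<Prod>k<4. \<beta> k z + of_nat n) = t n z * (\<Prod>k<4. \<alpha> k z + of_nat n)" for n z
    using Freg_term_Suc[of "a z" "b z" "c z" "d z" "e z" "f z" "g z" n]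
    by (simp add: prod_lessThan_4 \<alpha>_def \<beta>_def t_def)
  have 4: "t n holomorphic_on UNIV" for n
    unfolding t_def Freg_term_def by (intro holomorphic_intros assms)
  show "summable (\<lambda>n. norm (Freg_term (a z) (b z) (c z) (d z) (e z) (f z) (g z) n))"
    using saalschuetz_series_holomorphic(1)[OF 1 2 3 4, of z] by (simp add: t_def)
  show "(\<lambda>z. Freg (a z) (b z) (c z) (d z) (e z) (f z) (g z)) holomorphic_on UNIV"
    using saalschuetz_series_holomorphic(2)[OF 1 2 3 4] by (simp add: t_def Freg_def)
qed

lemma summable_Freg:
  assumes "e + f + g = a + b + c + d + 1"
  shows "summable (\<lambda>n. norm (Freg_term a b c d e f g n))"
  by (rule summable_Freg_aux) (use assms in auto)

lemma Freg_conv_F43: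
  assumes "e + f + g = a + b + c + d + 1" "e \<notin> \<int>\<^sub>\<le>\<^sub>0" "f \<notin> \<int>\<^sub>\<le>\<^sub>0" "g \<notin> \<int>\<^sub>\<le>\<^sub>0"
  shows "Freg a b c d e f g = F43 a b c d e f g * (rGamma e * rGamma f * rGamma g)"
proof -
  have nz: "pochhammer x n \<noteq> 0" if "x \<notin> \<int>\<^sub>\<le>\<^sub>0" for x :: complex and n
    using that by (auto simp: pochhammer_eq_0_iff)
  have *: "rGamma (x + of_nat n) = rGamma x / pochhammer x n" if "x \<notin> \<int>\<^sub>\<le>\<^sub>0" for x :: complex and n
    using pochhammer_rGamma[of x n] nz[OF that] by (simp add: field_simps)
  have **: "rGamma (1 + of_nat n :: complex) = 1 / fact n" for n
    using *[of 1 n] by (simp add: pochhammer_fact[symmetric])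
  have 1: "Freg_term a b c d e f g = (\<lambda>n. pochhammer a n * pochhammer b n * pochhammer c n * pochhammer d n /
          (fact n * pochhammer e n * pochhammer f n * pochhammer g n) * (rGamma e * rGamma f * rGamma g))"
    by (rule ext) (simp add: Freg_term_def *[OF assms(2)] *[OF assms(3)] *[OF assms(4)] **)
  have r: "rGamma e * rGamma f * rGamma g \<noteq> 0" using assms by (simp add: rGamma_eq_zero_iff)
  have "summable (Freg_term a b c d e f g)"
    by (rule summable_norm_cancel[OF summable_Freg[OF assms(1)]])
  hence "summable (\<lambda>n. pochhammer a n * pochhammer b n * pochhammer c n * pochhammer d n /
          (fact n * pochhammer e n * pochhammer f n * pochhammer g n))"
    unfolding 1 by (subst (asm) mult.commute) (rule summable_mult_D[OF _ r])
  thus ?thesis unfolding Freg_def 1 F43_def by (rule suminf_mult2[symmetric])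
qed

section \<open>Identity principle from a real box\<close>

text \<open>Joint holomorphy is avoided by using two lines. The one from \<open>p\<close> towards a
  real point starts inside the box, which gives vanishing at all real points; the one through Re w
  with direction Im w meets only real points for real z and reaches w at z = \<i>.\<close>

lemma zero_if_zero_on_real_box:
  fixes \<Phi> :: "(nat \<Rightarrow> complex) \<Rightarrow> complex" and p :: "nat \<Rightarrow> real"
  assumes line: "\<And>u v. (\<lambda>z. \<Phi> (\<lambda>i. u i + z * v i)) holomorphic_on UNIV"
    and "\<epsilon> > 0" and box: "\<And>x. (\<forall>i<n. \<bar>x i - p i\<bar> < \<epsilon>) \<Longrightarrow> \<Phi> (\<lambda>i. of_real (x i)) = 0"
  shows "\<Phi> w = 0"
proof -
  have real: "\<Phi> (\<lambda>i. of_real (x i)) = 0" for x :: "nat \<Rightarrow> real"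
  proof -
    \<comment> \<open>\<open>m\<close> exceeds every displacement, so \<open>p + r * (x - p)\<close>
      remains in the box for 0 < r < \<epsilon> / m.\<close>
    define m where "m = (\<Sum>i<n. \<bar>x i - p i\<bar>) + 1"
    have m: "\<bar>x i - p i\<bar> < m" if "i < n" for i
      unfolding m_def using member_le_sum[of i "{..<n}" "\<lambda>i. \<bar>x i - p i\<bar>"] that by auto
    have m0: "m > 0" unfolding m_def by (intro add_nonneg_pos sum_nonneg) auto
    have lim: "0 islimpt (complex_of_real ` {0<..<\<epsilon> / m})"
    proof (subst islimpt_approachable, intro allI impI)
      fix \<delta> :: real assume "\<delta> > 0"
      define r where "r = min (\<epsilon> / m) \<delta> / 2"
      have "min y \<delta> / 2 > 0 \<and> min y \<delta> / 2 < y \<and> min y \<delta> / 2 < \<delta>" if "y > 0" for y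
        using that \<open>\<delta> > 0\<close> by (auto simp: min_def)
      from this[of "\<epsilon> / m"] have "r > 0" "r < \<epsilon> / m" "r < \<delta>"
        using \<open>\<epsilon> > 0\<close> m0 by (auto simp: r_def)
      thus "\<exists>x'\<in>complex_of_real ` {0<..<\<epsilon> / m}. x' \<noteq> 0 \<and> dist x' 0 < \<delta>"
        by (intro bexI[of _ "complex_of_real r"]) auto
    qed
    have "\<Phi> (\<lambda>i. of_real (p i) + 1 * of_real (x i - p i)) = 0"
    proof (rule analytic_continuation[OF line _ _ _ _ lim])
      fix z assume "z \<in> complex_of_real ` {0<..<\<epsilon> / m}"
      then obtain r where r: "z = of_real r" "r > 0" "r < \<epsilon> / m" by auto
      have "\<Phi> (\<lambda>i. of_real (p i + r * (x i - p i))) = 0"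
      proof (intro box allI impI)
        fix i assume "i < n"
        have "r * \<bar>x i - p i\<bar> \<le> r * m" using m[OF \<open>i < n\<close>] r by (intro mult_left_mono) auto
        also have "\<dots> < \<epsilon>" using r m0 by (simp add: field_simps)
        finally show "\<bar>p i + r * (x i - p i) - p i\<bar> < \<epsilon>" using r by (simp add: abs_mult)
      qed
      thus "\<Phi> (\<lambda>i. of_real (p i) + z * of_real (x i - p i)) = 0" by (simp add: r)
    qed auto
    thus ?thesis by simp
  qed
  have lim: "0 islimpt (range complex_of_real)"
  proof (subst islimpt_approachable, intro allI impI)
    fix \<delta> :: real assume "\<delta> > 0"
    thus "\<exists>x'\<in>range complex_of_real. x' \<noteq> 0 \<and> dist x' 0 < \<delta>"
      by (intro bexI[of _ "complex_of_real (\<delta> / 2)"] rangeI) auto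
  qed
  have "\<Phi> (\<lambda>i. of_real (Re (w i)) + \<i> * of_real (Im (w i))) = 0"
  proof (rule analytic_continuation[OF line _ _ _ _ lim])
    fix z assume "z \<in> range complex_of_real"
    then obtain r where r: "z = of_real r" by auto
    show "\<Phi> (\<lambda>i. of_real (Re (w i)) + z * of_real (Im (w i))) = 0"
      using real[of "\<lambda>i. Re (w i) + r * Im (w i)"] by (simp add: r)
  qed auto
  thus ?thesis by (simp flip: complex_eq)
qed

section \<open>Hypergeometric sums with real parameters\<close>

text \<open>This is the limit of \<open>rGamma_series\<close> multiplied by \<open>Gamma z\<close>;
  that series contains the Pochhammer symbol of length n + 1, whence the shift
  \<open>Suc n\<close>.\<close>

lemma Gamma_asymptotics:
  fixes z :: "'a::Gamma"
  assumes "z \<notin> \<int>\<^sub>\<le>\<^sub>0"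
  shows "(\<lambda>n. Gamma (z + of_nat (Suc n)) / (fact n * exp (z * of_real (ln (real n))))) \<longlonglongrightarrow> 1"
proof -
  have "rGamma z \<noteq> 0" using assms by (simp add: rGamma_eq_zero_iff)
  moreover have "(\<lambda>n. Gamma z * rGamma_series z n) \<longlonglongrightarrow> Gamma z * rGamma z" by (intro tendsto_intros)
  moreover have "Gamma z * rGamma_series z n = Gamma (z + of_nat (Suc n)) / (fact n * exp (z * of_real (ln (real n))))" for n
    using assms by (simp add: rGamma_series_def pochhammer_Gamma Gamma_eq_zero_iff)
  ultimately show ?thesis by (simp add: Gamma_def)
qed

text \<open>With equally many Gamma factors above and below, the factorials cancel and only a power
  of n is left.\<close>

lemma Gamma_quotient_asymptotics:
  fixes z w :: "nat \<Rightarrow> 'a::Gamma"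
  assumes "\<And>i. i < k \<Longrightarrow> z i \<notin> \<int>\<^sub>\<le>\<^sub>0" "\<And>i. i < k \<Longrightarrow> w i \<notin> \<int>\<^sub>\<le>\<^sub>0"
  shows "(\<lambda>n. (\<Prod>i<k. Gamma (z i + of_nat (Suc n))) / (\<Prod>i<k. Gamma (w i + of_nat (Suc n)))
     * exp (((\<Sum>i<k. w i) - (\<Sum>i<k. z i)) * of_real (ln (real n)))) \<longlonglongrightarrow> 1"
proof -
  define h where "h = (\<lambda>(z::'a) n. Gamma (z + of_nat (Suc n)) / (fact n * exp (z * of_real (ln (real n)))))"
  have "(\<lambda>n. (\<Prod>i<k. h (z i) n) / (\<Prod>i<k. h (w i) n)) \<longlonglongrightarrow> (\<Prod>i<k. 1) / (\<Prod>i<k. 1)"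
    unfolding h_def by (intro tendsto_divide tendsto_prod Gamma_asymptotics) (use assms in auto)
  moreover have "(\<Prod>i<k. h (z i) n) / (\<Prod>i<k. h (w i) n) =
      (\<Prod>i<k. Gamma (z i + of_nat (Suc n))) / (\<Prod>i<k. Gamma (w i + of_nat (Suc n)))
     * exp (((\<Sum>i<k. w i) - (\<Sum>i<k. z i)) * of_real (ln (real n)))" for n
    by (simp add: h_def prod_dividef prod.distrib exp_diff exp_sum left_diff_distrib sum_distrib_right)
  ultimately show ?thesis by simp
qed

lemma Gamma_quotient_asymptotics_real:
  fixes z w :: "nat \<Rightarrow> real"
  assumes "\<And>i. i < k \<Longrightarrow> z i > 0" "\<And>i. i < k \<Longrightarrow> w i > 0"
  shows "(\<lambda>n. (\<Prod>i<k. Gamma (z i + real n)) / (\<Prod>i<k. Gamma (w i + real n))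
     * real n powr ((\<Sum>i<k. w i) - (\<Sum>i<k. z i))) \<longlonglongrightarrow> 1" (is "?f \<longlonglongrightarrow> _")
proof -
  define p where "p = (\<Sum>i<k. w i) - (\<Sum>i<k. z i)"
  \<comment> \<open>Correction factor for replacing the power of n by the power of n + 1, so that
    the limit along \<open>Suc n\<close> can be shifted back to n.\<close>
  have "(\<lambda>n. (real (Suc n) / real n) powr p) \<longlonglongrightarrow> 1 powr p"
    by (intro tendsto_powr tendsto_const) (use LIMSEQ_Suc_n_over_n in auto)
  moreover have "(\<lambda>n. (\<Prod>i<k. Gamma (z i + real (Suc n))) / (\<Prod>i<k. Gamma (w i + real (Suc n)))
     * exp (p * ln (real n))) \<longlonglongrightarrow> 1"
    using Gamma_quotient_asymptotics[of k z w] assms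
    by (force simp: p_def)
  ultimately have "(\<lambda>n. (\<Prod>i<k. Gamma (z i + real (Suc n))) / (\<Prod>i<k. Gamma (w i + real (Suc n)))
     * exp (p * ln (real n)) * (real (Suc n) / real n) powr p) \<longlonglongrightarrow> 1 * 1 powr p"
    by (intro tendsto_mult)
  moreover have "eventually (\<lambda>n. (\<Prod>i<k. Gamma (z i + real (Suc n))) / (\<Prod>i<k. Gamma (w i + real (Suc n)))
     * exp (p * ln (real n)) * (real (Suc n) / real n) powr p = ?f (Suc n)) sequentially"
    using eventually_gt_at_top[of 0]
    by eventually_elim (simp add: p_def[symmetric] powr_divide, simp add: powr_def)
  ultimately have "(\<lambda>n. ?f (Suc n)) \<longlonglongrightarrow> 1"
    using Lim_transform_eventually by (fastforce simp: p_def)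
  thus ?thesis by (rule LIMSEQ_imp_Suc)
qed

lemma Gamma_quotient_2_asymptotics:
  fixes z w z' w' :: real
  assumes "z > 0" "z' > 0" "w > 0" "w' > 0"
  shows "(\<lambda>n. Gamma (z + real n) * Gamma (z' + real n) / (Gamma (w + real n) * Gamma (w' + real n))
     * real n powr (w + w' - z - z')) \<longlonglongrightarrow> 1"
proof -
  have "(\<lambda>n. (\<Prod>i<2. Gamma ([z, z'] ! i + real n)) / (\<Prod>i<2. Gamma ([w, w'] ! i + real n))
     * real n powr ((\<Sum>i<2. [w, w'] ! i) - (\<Sum>i<2. [z, z'] ! i))) \<longlonglongrightarrow> 1"
    by (rule Gamma_quotient_asymptotics_real) (use assms in \<open>auto simp: less_2_cases_iff\<close>)
  thus ?thesis by (simp add: eval_nat_numeral algebra_simps)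
qed

lemma summable_if_asymptotic_powr:
  fixes f :: "nat \<Rightarrow> real"
  assumes lim: "(\<lambda>n. f n * real n powr p) \<longlonglongrightarrow> c" and p: "p > 1"
  shows "summable f"
proof -
  obtain B where B: "\<And>n. \<bar>f n * real n powr p\<bar> \<le> B"
    using convergent_imp_Bseq[of "\<lambda>n. f n * real n powr p"] lim unfolding Bseq_def convergent_def by auto
  show ?thesis
  proof (rule summable_comparison_test)
    show "summable (\<lambda>n. B * real n powr (-p))"
      using p by (intro summable_mult) (simp add: summable_real_powr_iff)
    show "\<exists>N. \<forall>n\<ge>N. norm (f n) \<le> B * real n powr (-p)"
    proof (intro exI[of _ 1] allI impI)
      fix n :: nat assume "n \<ge> 1"
      hence "real n powr p > 0" by simp
      thus "norm (f n) \<le> B * real n powr (-p)"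
        using B[of n] by (simp add: abs_mult powr_minus field_simps)
    qed
  qed
qed

section \<open>Gauss's theorem for real parameters\<close>

definition hyp2_term :: "real \<Rightarrow> real \<Rightarrow> real \<Rightarrow> nat \<Rightarrow> real" where
  "hyp2_term a b c n = pochhammer a n * pochhammer b n / (fact n * pochhammer c n)"

lemma pochhammer_Gamma_real: "x > 0 \<Longrightarrow> pochhammer x n = Gamma (x + real n) / Gamma (x::real)"
  by (rule pochhammer_Gamma) auto

lemma hyp2_term_Gamma:
  assumes "a > 0" "b > 0" "c > 0"
  shows "hyp2_term a b c n = Gamma c / (Gamma a * Gamma b) *
    (Gamma (a + real n) * Gamma (b + real n) / (Gamma (1 + real n) * Gamma (c + real n)))"
  using assms by (simp add: hyp2_term_def pochhammer_Gamma_real Gamma_fact)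

lemma hyp2_term_asymptotics:
  assumes "a > 0" "b > 0" "c > 0"
  shows "(\<lambda>n. hyp2_term a b c n * real n powr (1 + c - a - b)) \<longlonglongrightarrow> Gamma c / (Gamma a * Gamma b)"
  using tendsto_mult[OF tendsto_const[of "Gamma c / (Gamma a * Gamma b)"] Gamma_quotient_2_asymptotics[of a b 1 c]] assms
  by (simp add: hyp2_term_Gamma mult.assoc)

lemma summable_hyp2:
  assumes "a > 0" "b > 0" "c > a + b"
  shows "summable (hyp2_term a b c)"
  by (rule summable_if_asymptotic_powr[OF hyp2_term_asymptotics]) (use assms in auto)

text \<open>The combination of summands is the forward difference of the certificate
  \<open>G n\<close>, which is of order n^(a+b-c) and therefore tends to 0; \<open>G 0 = 0\<close>
  by its factor n.\<close>

lemma hyp2_contiguous: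
  assumes "a > 0" "b > 0" "c > a + b"
  shows "(c - a) * (c - b) * suminf (hyp2_term a b (c + 1)) = c * (c - a - b) * suminf (hyp2_term a b c)"
proof -
  define G where "G = (\<lambda>n. c * real n * hyp2_term a b c n)"
  have "c > 0" using assms by linarith
  have cn: "c + real n > 0" "pochhammer c n > 0" for n using \<open>c > 0\<close> by (auto intro: pochhammer_pos add_pos_nonneg)
  have T1: "hyp2_term a b (c + 1) n = hyp2_term a b c n * (c / (c + real n))" for n
  proof -
    have "pochhammer c n * (c + real n) = c * pochhammer (c + 1) n"
      by (metis pochhammer_rec pochhammer_rec' mult.commute)
    hence "pochhammer (c + 1) n = pochhammer c n * (c + real n) / c" using \<open>c > 0\<close> by (simp add: field_simps)
    thus ?thesis using cn[of n] \<open>c > 0\<close> by (simp add: hyp2_term_def)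
  qed
  have T2: "hyp2_term a b c (Suc n) = hyp2_term a b c n * ((a + real n) * (b + real n) / ((1 + real n) * (c + real n)))" for n
    by (simp only: hyp2_term_def pochhammer_Suc fact_Suc of_nat_Suc times_divide_times_eq mult_ac add_ac)
  have diff: "(c - a) * (c - b) * hyp2_term a b (c + 1) n - c * (c - a - b) * hyp2_term a b c n = G (Suc n) - G n" for n
  proof -
    have "(1 + real n) \<noteq> 0" by simp
    hence "(G (Suc n) - G n) * (c + real n) = c * hyp2_term a b c n * ((a + real n) * (b + real n) - real n * (c + real n))"
      using cn[of n] by (simp add: G_def T2 divide_simps) (simp add: algebra_simps)
    also have "\<dots> = ((c - a) * (c - b) * hyp2_term a b (c + 1) n - c * (c - a - b) * hyp2_term a b c n) * (c + real n)"
      using cn[of n] by (simp only: T1) (simp add: field_simps)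
    finally show ?thesis using cn[of n] by simp
  qed
  have "(\<lambda>n. c * (hyp2_term a b c n * real n powr (1 + c - a - b)) * real n powr (a + b - c)) \<longlonglongrightarrow> c * (Gamma c / (Gamma a * Gamma b)) * 0"
    by (intro tendsto_intros hyp2_term_asymptotics tendsto_neg_powr filterlim_real_sequentially)
      (use assms \<open>c > 0\<close> in auto)
  moreover have "c * (hyp2_term a b c n * real n powr (1 + c - a - b)) * real n powr (a + b - c) = G n" for n
    by (cases "n = 0") (simp_all add: G_def flip: powr_add)
  ultimately have "G \<longlonglongrightarrow> 0" by simp
  hence "(\<lambda>n. G (Suc n) - G n) sums (0 - G 0)" by (rule telescope_sums)
  moreover have "(\<lambda>n. (c - a) * (c - b) * hyp2_term a b (c + 1) n - c * (c - a - b) * hyp2_term a b c n) sums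
     ((c - a) * (c - b) * suminf (hyp2_term a b (c + 1)) - c * (c - a - b) * suminf (hyp2_term a b c))"
    by (intro sums_diff sums_mult summable_sums summable_hyp2) (use assms in auto)
  ultimately have "(c - a) * (c - b) * suminf (hyp2_term a b (c + 1)) - c * (c - a - b) * suminf (hyp2_term a b c) = 0 - G 0"
    unfolding diff by (rule sums_unique2[symmetric])
  thus ?thesis by (simp add: G_def)
qed

text \<open>The term n = 0 equals 1. All others carry 1/(c + N): they are at most
  \<open>c / (c + real N)\<close> times the corresponding terms for N = 0.\<close>

lemma hyp2_tendsto_1:
  assumes "a > 0" "b > 0" "c > a + b"
  shows "(\<lambda>N. suminf (hyp2_term a b (c + real N))) \<longlonglongrightarrow> 1"
proof -
  have c: "c > 0" using assms by linarith
  have nonneg: "hyp2_term a b (c + real N) n \<ge> 0" for n N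
    using assms c by (auto simp: hyp2_term_def intro!: divide_nonneg_nonneg mult_nonneg_nonneg pochhammer_nonneg)
  have summ: "summable (hyp2_term a b (c + real N))" for N
    by (rule summable_hyp2) (use assms in auto)
  define B where "B = (\<Sum>n. hyp2_term a b c (Suc n))"
  have le: "hyp2_term a b (c + real N) (Suc n) \<le> c / (c + real N) * hyp2_term a b c (Suc n)" for n N
  proof -
    define y where "y = pochhammer a (Suc n) * pochhammer b (Suc n) / fact (Suc n)"
    have y: "y \<ge> 0"
      unfolding y_def using assms by (intro divide_nonneg_nonneg mult_nonneg_nonneg pochhammer_nonneg) auto
    have p: "pochhammer (c + 1) n > 0" using c by (intro pochhammer_pos) auto
    have pp: "pochhammer (c + 1) n \<le> pochhammer (c + real N + 1) n"
      unfolding pochhammer_prod using c by (intro prod_mono) auto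
    have "hyp2_term a b (c + real N) (Suc n) = y / ((c + real N) * pochhammer (c + real N + 1) n)"
      by (simp only: hyp2_term_def y_def divide_divide_eq_left pochhammer_rec[of "c + real N"])
    also have "\<dots> \<le> y / ((c + real N) * pochhammer (c + 1) n)"
      using c p pp y by (intro divide_left_mono mult_left_mono mult_pos_pos) auto
    also have "\<dots> = c / (c + real N) * (y / (c * pochhammer (c + 1) n))"
      using c by simp
    also have "y / (c * pochhammer (c + 1) n) = hyp2_term a b c (Suc n)"
      by (simp only: hyp2_term_def y_def divide_divide_eq_left pochhammer_rec[of c])
    finally show ?thesis .
  qed
  have bound: "1 \<le> suminf (hyp2_term a b (c + real N)) \<and> suminf (hyp2_term a b (c + real N)) \<le> 1 + c / (c + real N) * B" for N
  proof -
    have eq: "suminf (hyp2_term a b (c + real N)) = (\<Sum>n. hyp2_term a b (c + real N) (Suc n)) + 1"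
      using suminf_split_head[OF summ[of N]] by (simp add: hyp2_term_def)
    have s: "summable (\<lambda>n. hyp2_term a b (c + real N) (Suc n))" for N
      using summ by (subst summable_Suc_iff)
    have "(\<Sum>n. hyp2_term a b (c + real N) (Suc n)) \<le> (\<Sum>n. c / (c + real N) * hyp2_term a b c (Suc n))"
      using s[of 0] by (intro suminf_le le s summable_mult) simp
    also have "\<dots> = c / (c + real N) * B"
      unfolding B_def using s[of 0] by (intro suminf_mult) simp
    finally show ?thesis using eq suminf_nonneg[OF s[of N]] nonneg by auto
  qed
  have "filterlim (\<lambda>N. c + real N) at_top sequentially"
    by (rule filterlim_tendsto_add_at_top[OF tendsto_const filterlim_real_sequentially])
  hence "(\<lambda>N. c / (c + real N)) \<longlonglongrightarrow> 0"
    by (rule real_tendsto_divide_at_top[OF tendsto_const])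
  hence "(\<lambda>N. 1 + c / (c + real N) * B) \<longlonglongrightarrow> 1 + 0 * B"
    by (intro tendsto_add tendsto_mult tendsto_const)
  hence lim: "(\<lambda>N. 1 + c / (c + real N) * B) \<longlonglongrightarrow> 1" by simp
  show ?thesis
  proof (rule tendsto_sandwich[OF _ _ tendsto_const lim])
    show "\<forall>\<^sub>F N in sequentially. 1 \<le> suminf (hyp2_term a b (c + real N))"
      "\<forall>\<^sub>F N in sequentially. suminf (hyp2_term a b (c + real N)) \<le> 1 + c / (c + real N) * B"
      using bound by (auto intro: always_eventually)
  qed
qed

text \<open>Gauss's summation theorem: the quotient of both sides is invariant under \<open>c \<mapsto> c + 1\<close>, and it
  tends to 1 along \<open>c + N\<close>.\<close>

theorem Gauss_hypergeometric:
  assumes "a > 0" "b > 0" "c > a + b"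
  shows "hyp2_term a b c sums (Gamma c * Gamma (c - a - b) / (Gamma (c - a) * Gamma (c - b)))"
proof -
  define q where "q = (\<lambda>c. suminf (hyp2_term a b c) * (Gamma (c - a) * Gamma (c - b) / (Gamma c * Gamma (c - a - b))))"
  have step: "q (x + 1) = q x" if "x > a + b" for x
  proof -
    have pos: "x > 0" "x - a > 0" "x - b > 0" "x - a - b > 0" using that assms by linarith+
    have P: "Gamma (y + 1) = y * Gamma y" if "y > 0" for y :: real using that by (intro Gamma_plus1) auto
    have "q (x + 1) = suminf (hyp2_term a b (x + 1)) * (Gamma ((x - a) + 1) * Gamma ((x - b) + 1) / (Gamma (x + 1) * Gamma ((x - a - b) + 1)))"
      by (simp add: q_def algebra_simps)
    also have "\<dots> = ((x - a) * (x - b) * suminf (hyp2_term a b (x + 1))) / (x * (x - a - b)) * (Gamma (x - a) * Gamma (x - b) / (Gamma x * Gamma (x - a - b)))"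
      using pos by (simp only: P) (simp add: mult_ac)
    also have "\<dots> = q x"
      using pos by (simp add: hyp2_contiguous[OF assms(1,2) that] q_def)
    finally show ?thesis .
  qed
  have const: "q (c + real N) = q c" for N
    by (induction N) (use step[of "c + real _"] assms(3) in \<open>auto simp: add_ac\<close>)
  have pos: "c > 0" "c - a > 0" "c - b > 0" "c - a - b > 0" using assms by linarith+
  have "(\<lambda>N. Gamma (c - a + real N) * Gamma (c - b + real N) / (Gamma (c + real N) * Gamma (c - a - b + real N)) * real N powr 0) \<longlonglongrightarrow> 1"
    using Gamma_quotient_2_asymptotics[of "c - a" "c - b" c "c - a - b"] pos by simp
  moreover have "\<forall>\<^sub>F N in sequentially. real N powr 0 = 1"
    using eventually_gt_at_top[of 0] by eventually_elim simp
  ultimately have "(\<lambda>N. Gamma (c - a + real N) * Gamma (c - b + real N) / (Gamma (c + real N) * Gamma (c - a - b + real N))) \<longlonglongrightarrow> 1"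
    by (rule Lim_transform_eventually[OF _ eventually_mono]) auto
  from tendsto_mult[OF hyp2_tendsto_1[OF assms] this]
  have "(\<lambda>N. q (c + real N)) \<longlonglongrightarrow> 1" by (simp add: q_def algebra_simps)
  hence "q c = 1" by (simp add: const LIMSEQ_const_iff)
  hence "suminf (hyp2_term a b c) = Gamma c * Gamma (c - a - b) / (Gamma (c - a) * Gamma (c - b))"
    using pos[THEN Gamma_real_pos] unfolding q_def by (simp add: field_simps)
  thus ?thesis using summable_sums[OF summable_hyp2[OF assms]] by simp
qed

lemma summable_mult_Beta:
  fixes u :: "nat \<Rightarrow> real"
  assumes "summable u" "\<And>n. u n \<ge> 0" "x > 0" "y > 0" "\<sigma> \<ge> 0"
  shows "summable (\<lambda>n. u n * Beta x (y + \<sigma> + real n))"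
proof (rule summable_comparison_test)
  have mono: "Beta x (y + \<sigma> + real n) \<le> Beta x (y + \<sigma>)" for n
    using assms by (intro Beta_real_mono) auto
  have "Beta x (y + \<sigma> + real n) \<ge> 0" for n
    using assms by (auto simp: Beta_def intro!: divide_nonneg_nonneg mult_nonneg_nonneg Gamma_real_nonneg)
  thus "\<exists>N. \<forall>n\<ge>N. norm (u n * Beta x (y + \<sigma> + real n)) \<le> u n * Beta x (y + \<sigma>)"
    using mono assms by (auto simp: abs_mult intro!: mult_left_mono)
  show "summable (\<lambda>n. u n * Beta x (y + \<sigma>))" by (rule summable_mult2) fact
qed

lemma Gamma_reflection_real: "Gamma x * Gamma (1 - x) = pi / sin (pi * x)" for x :: real
proof -
  have "complex_of_real (Gamma x * Gamma (1 - x)) = Gamma (of_real x) * Gamma (1 - of_real x)"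
    by (simp flip: Gamma_complex_of_real)
  also have "\<dots> = complex_of_real (pi / sin (pi * x))"
    by (simp add: Gamma_reflection_complex flip: sin_of_real)
  finally show ?thesis by (simp only: of_real_eq_iff)
qed

lemma Gamma_real_nonzero: "x > 0 \<Longrightarrow> Gamma x \<noteq> (0::real)"
  using Gamma_real_pos[of x] by linarith

lemma Gamma_Suc_real: "x > 0 \<Longrightarrow> Gamma (x + 1) = x * Gamma (x::real)"
  by (rule Gamma_plus1) auto

text \<open>A quotient of Pochhammer symbols at \<open>x\<close> and \<open>x + y\<close> is a
  quotient of Beta values. This converts between a Gauss series with lower parameter
  \<open>x + y\<close> and a series with fixed lower parameter \<open>x\<close> and a Beta
  kernel.\<close>

lemma Beta_hyp2_term:
  assumes "a > 0" "b > 0" "x > 0" "y > 0"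
  shows "Beta x y * hyp2_term a b (x + y) k = hyp2_term a b x k * Beta (x + real k) y"
  using assms by (simp add: hyp2_term_Gamma Beta_def Gamma_real_nonzero add_pos_nonneg add_ac mult_ac)

section \<open>Nonterminating form of Saalschuetz's theorem\<close>

text \<open>The condition \<open>a + b < e < 1\<close> gives both sums \<open>u (n)\<close> and
  \<open>u (1 - e + n)\<close> the positive excess \<open>e - a - b\<close> and makes every Gamma
  argument in their Gauss evaluations positive.\<close>

locale hyp3 =
  fixes a b e :: real
  assumes a: "a > 0" and b: "b > 0" and e: "e < 1" "a + b < e"
begin

definition "\<gamma> = 1 + a + b - e"
definition "u s = Gamma (a + s) * Gamma (b + s) / (Gamma (1 + s) * Gamma (e + s))" for s :: real
definition "kap = Gamma a * Gamma b * Gamma (1 + a - e) * Gamma (1 + b - e) * sin (pi * e) / (pi * Gamma \<gamma>)"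

lemma \<gamma>: "0 < \<gamma>" "\<gamma> < 1" "0 < 1 - e" "e > 0"
  using a b e by (auto simp: \<gamma>_def)

lemma u_pos: "s \<ge> 0 \<Longrightarrow> u s > 0"
  using a b \<gamma> by (auto simp: u_def intro!: divide_pos_pos mult_pos_pos Gamma_real_pos add_pos_nonneg)

lemma u_sums_1: "(\<lambda>n. u (real n)) sums (Gamma a * Gamma b * Gamma (e - a - b) / (Gamma (e - a) * Gamma (e - b)))"
proof -
  have "(\<lambda>n. Gamma a * Gamma b / Gamma e * hyp2_term a b e n) sums
     (Gamma a * Gamma b / Gamma e * (Gamma e * Gamma (e - a - b) / (Gamma (e - a) * Gamma (e - b))))"
    by (intro sums_mult Gauss_hypergeometric) (use a b e in auto)
  moreover have "Gamma a * Gamma b / Gamma e * hyp2_term a b e n = u (real n)" for n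
    using a b \<gamma> by (simp add: hyp2_term_Gamma u_def Gamma_real_nonzero)
  ultimately show ?thesis using \<gamma> by (simp add: Gamma_real_nonzero mult_ac)
qed

lemma u_sums_2: "(\<lambda>n. u (1 - e + real n)) sums (Gamma (1 + a - e) * Gamma (1 + b - e) * Gamma (e - a - b) / (Gamma (1 - a) * Gamma (1 - b)))"
proof -
  let ?a = "1 + a - e" and ?b = "1 + b - e" and ?c = "2 - e"
  have "(\<lambda>n. Gamma ?a * Gamma ?b / Gamma ?c * hyp2_term ?a ?b ?c n) sums
     (Gamma ?a * Gamma ?b / Gamma ?c * (Gamma ?c * Gamma (?c - ?a - ?b) / (Gamma (?c - ?a) * Gamma (?c - ?b))))"
    by (intro sums_mult Gauss_hypergeometric) (use a b e in auto)
  moreover have "Gamma ?a * Gamma ?b / Gamma ?c * hyp2_term ?a ?b ?c n = u (1 - e + real n)" for n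
    using a b e by (simp add: hyp2_term_Gamma u_def Gamma_real_nonzero) (simp add: algebra_simps)
  moreover have "Gamma ?c > 0" using e by simp
  ultimately show ?thesis by (simp add: algebra_simps)
qed

text \<open>After reflection both Gauss sums share their Gamma factors. The sines combine by
  sin(e-a) sin(e-b) - sin a sin b = sin e sin(e-a-b), arguments times pi, and the last sine
  cancels.\<close>

lemma u_sums_diff: "(\<Sum>n. u (real n)) - (\<Sum>n. u (1 - e + real n)) = kap"
proof -
  define sa sb sea seb sab where "sa = sin (pi * a)" and "sb = sin (pi * b)" and "sea = sin (pi * (e - a))"
    and "seb = sin (pi * (e - b))" and "sab = sin (pi * (e - a - b))"
  have pos: "sin (pi * t) > 0" if "0 < t" "t < 1" for t :: real
    using that by (intro sin_gt_zero) auto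
  have s0: "sa > 0" "sb > 0" "sea > 0" "seb > 0" "sab > 0"
    unfolding sa_def sb_def sea_def seb_def sab_def using a b e by (auto intro!: pos)
  have r: "Gamma (1 - a) = pi / (sa * Gamma a)" "Gamma (1 - b) = pi / (sb * Gamma b)"
    "Gamma (e - a) = pi / (sea * Gamma (1 + a - e))" "Gamma (e - b) = pi / (seb * Gamma (1 + b - e))"
    "Gamma (e - a - b) = pi / (sab * Gamma \<gamma>)"
    using Gamma_reflection_real[of a] Gamma_reflection_real[of b] Gamma_reflection_real[of "e - a"]
      Gamma_reflection_real[of "e - b"] Gamma_reflection_real[of "e - a - b"] s0 a b e \<gamma>
    by (simp_all add: sa_def sb_def sea_def seb_def sab_def \<gamma>_def field_simps Gamma_real_pos[THEN less_imp_neq[THEN not_sym]])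
  have trig: "sea * seb - sa * sb = sin (pi * e) * sab"
  proof -
    have p: "pi * (e - a) = pi * e - pi * a" "pi * (e - b) = pi * e - pi * b" "pi * (e - a - b) = pi * e - (pi * a + pi * b)"
      by (simp_all add: algebra_simps)
    have c: "(cos (pi * e))\<^sup>2 = 1 - (sin (pi * e))\<^sup>2" by (simp add: cos_squared_eq)
    show ?thesis unfolding sea_def seb_def sa_def sb_def sab_def p sin_diff sin_add cos_add
      using c by algebra
  qed
  have g0: "Gamma a > 0" "Gamma b > 0" "Gamma (1 + a - e) > 0" "Gamma (1 + b - e) > 0" "Gamma \<gamma> > 0"
    using a b e \<gamma> by auto
  have "(\<Sum>n. u (real n)) - (\<Sum>n. u (1 - e + real n)) =
     Gamma a * Gamma b * Gamma (1 + a - e) * Gamma (1 + b - e) / (pi * Gamma \<gamma> * sab) * (sea * seb - sa * sb)"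
    unfolding sums_unique[OF u_sums_1, symmetric] sums_unique[OF u_sums_2, symmetric] r
    using s0 g0 by (simp add: field_simps)
  also have "\<dots> = kap" unfolding trig kap_def using s0 by simp
  finally show ?thesis .
qed

text \<open>Up to Gamma factors the first sum is the 3F2 with upper parameters a, b, d and lower
  parameters e, \<open>\<gamma> + d\<close>; the choice of \<open>\<gamma>\<close> makes it
  balanced. The second sum is its companion at the exponent \<open>1 - e\<close>.\<close>

definition "I d = (\<Sum>n. u (real n) * Beta \<gamma> (d + real n)) - (\<Sum>n. u (1 - e + real n) * Beta \<gamma> (d + (1 - e) + real n))"

lemma summable_u_Beta:
  assumes "d > 0" "x > 0"
  shows "summable (\<lambda>n. u (real n) * Beta x (d + real n))"
    and "summable (\<lambda>n. u (1 - e + real n) * Beta x (d + (1 - e) + real n))"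
  using summable_mult_Beta[OF sums_summable[OF u_sums_1], of x d 0]
    summable_mult_Beta[OF sums_summable[OF u_sums_2], of x d "1 - e"] assms u_pos[THEN less_imp_le] \<gamma>
  by simp_all

lemma u_Beta_telescope:
  assumes "d > 0" and \<sigma>: "\<sigma> = 0 \<or> \<sigma> = 1 - e"
  shows "(\<lambda>n. (d + 1 + b - e) * (d + 1 + a - e) * (u (\<sigma> + real n) * Beta \<gamma> (d + 1 + \<sigma> + real n))
     - d * (d + 1 - e) * (u (\<sigma> + real n) * Beta \<gamma> (d + \<sigma> + real n))) sums Gamma \<gamma>"
proof -
  let ?zs = "[a + \<sigma>, b + \<sigma>, d + \<sigma>]"
  let ?ws = "[1 + \<sigma>, e + \<sigma>, \<gamma> + d + \<sigma>]"
  define G where "G = (\<lambda>n. let s = \<sigma> + real n in s * (e - 1 + s) * (u s * Beta \<gamma> (d + s)))"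
  have \<sigma>0: "\<sigma> \<ge> 0" using \<sigma> \<gamma> by auto
  \<comment> \<open>Passes from a polynomial identity, with the denominator \<open>W\<close>
    cleared, to the identity between summands; \<open>W\<close> will be
    \<open>\<gamma> + d + s\<close>.\<close>
  have divided: "c1 * (U * (C * y / W)) - c0 * (U * C) = p / W * (U * C) - q * (U * C)"
    if "c1 * y - c0 * W = p - q * W" "W > 0" for c1 y c0 W p q U C :: real
  proof -
    have "c1 * y / W - c0 = p / W - q" using that by (simp add: field_simps)
    hence *: "(c1 * y / W - c0) * (U * C) = (p / W - q) * (U * C)" by simp
    have "c1 * (U * (C * y / W)) - c0 * (U * C) = (c1 * y / W - c0) * (U * C)" by (simp add: algebra_simps)
    also note *
    also have "(p / W - q) * (U * C) = p / W * (U * C) - q * (U * C)" by (simp add: algebra_simps)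
    finally show ?thesis .
  qed
  have diff: "(d + 1 + b - e) * (d + 1 + a - e) * (u (\<sigma> + real n) * Beta \<gamma> (d + 1 + \<sigma> + real n))
     - d * (d + 1 - e) * (u (\<sigma> + real n) * Beta \<gamma> (d + \<sigma> + real n)) = G (Suc n) - G n" for n
  proof -
    define s where "s = \<sigma> + real n"
    have s0: "s \<ge> 0" using \<sigma>0 by (simp add: s_def)
    define B where "B = Beta \<gamma> (d + s)"
    have B1: "Beta \<gamma> (d + 1 + s) = B * (d + s) / (\<gamma> + d + s)"
    proof -
      have "(\<gamma> + (d + s)) * Beta \<gamma> (d + s + 1) = (d + s) * B"
        unfolding B_def by (rule Beta_plus1_right) (use assms(1) s0 in \<open>auto simp: nonpos_Ints_def\<close>)
      thus ?thesis using s0 assms(1) \<gamma> by (simp add: field_simps)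
    qed
    have u1: "u (s + 1) = u s * ((a + s) * (b + s) / ((1 + s) * (e + s)))"
      using Gamma_Suc_real[of "a + s"] Gamma_Suc_real[of "b + s"] Gamma_Suc_real[of "1 + s"]
        Gamma_Suc_real[of "e + s"] s0 a b \<gamma> by (simp add: u_def add_ac mult_ac)
    have n0: "\<gamma> + d + s > 0" "1 + s > 0" "e + s > 0" using s0 assms(1) \<gamma> by auto
    have "G (Suc n) = (s + 1) * (e + s) * (u (s + 1) * Beta \<gamma> (d + 1 + s))"
      by (simp add: G_def s_def Let_def algebra_simps)
    also have "\<dots> = ((1 + s) * (e + s)) * (((a + s) * (b + s)) / ((1 + s) * (e + s))) * (u s * (B * (d + s) / (\<gamma> + d + s)))"
      unfolding u1 B1 by (simp only: mult_ac add_ac)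
    also have "((1 + s) * (e + s)) * (((a + s) * (b + s)) / ((1 + s) * (e + s))) = (a + s) * (b + s)"
      using n0 by simp
    also have "(a + s) * (b + s) * (u s * (B * (d + s) / (\<gamma> + d + s))) = (a + s) * (b + s) * (d + s) / (\<gamma> + d + s) * (u s * B)"
      by simp
    finally have G1: "G (Suc n) = (a + s) * (b + s) * (d + s) / (\<gamma> + d + s) * (u s * B)" .
    have "(d + 1 + b - e) * (d + 1 + a - e) * (d + s) - d * (d + 1 - e) * (\<gamma> + d + s)
        = (a + s) * (b + s) * (d + s) - s * (e - 1 + s) * (\<gamma> + d + s)"
      unfolding \<gamma>_def by algebra
    from divided[OF this n0(1)]
    have "(d + 1 + b - e) * (d + 1 + a - e) * (u s * (B * (d + s) / (\<gamma> + d + s))) - d * (d + 1 - e) * (u s * B)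
        = (a + s) * (b + s) * (d + s) / (\<gamma> + d + s) * (u s * B) - s * (e - 1 + s) * (u s * B)" .
    hence "(d + 1 + b - e) * (d + 1 + a - e) * (u s * Beta \<gamma> (d + 1 + s)) - d * (d + 1 - e) * (u s * Beta \<gamma> (d + s))
        = G (Suc n) - G n"
      unfolding B1 G1 B_def by (simp add: G_def s_def Let_def)
    thus ?thesis by (simp add: s_def add_ac)
  qed
  let ?f = "\<lambda>n. Gamma \<gamma> * ((\<Prod>i<3. Gamma (?zs ! i + real n)) / (\<Prod>i<3. Gamma (?ws ! i + real n))
     * real n powr ((\<Sum>i<3. ?ws ! i) - (\<Sum>i<3. ?zs ! i)))
     * ((\<sigma> / real n + 1) * ((e - 1 + \<sigma>) / real n + 1))"
  have "?f \<longlonglongrightarrow> Gamma \<gamma> * 1 * ((0 + 1) * (0 + 1))"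
  proof (intro tendsto_mult tendsto_const tendsto_add Gamma_quotient_asymptotics_real
      real_tendsto_divide_at_top[OF tendsto_const filterlim_real_sequentially])
    fix i :: nat assume "i < 3"
    hence "i = 0 \<or> i = 1 \<or> i = 2" by auto
    thus "?zs ! i > 0" "?ws ! i > 0"
      using a b assms(1) \<gamma> \<sigma>0 by auto
  qed
  moreover have "\<forall>\<^sub>F n in sequentially. ?f n = G n"
    using eventually_gt_at_top[of 0]
  proof eventually_elim
    case (elim n)
    have "(\<Sum>i<3. ?ws ! i) - (\<Sum>i<3. ?zs ! i) = 2"
      by (simp add: eval_nat_numeral \<gamma>_def)
    hence p: "real n powr ((\<Sum>i<3. ?ws ! i) - (\<Sum>i<3. ?zs ! i)) = real n * real n"
      using elim by (simp add: powr_numeral power2_eq_square)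
    have q: "(\<sigma> / real n + 1) * ((e - 1 + \<sigma>) / real n + 1) * (real n * real n) = (\<sigma> + real n) * (e - 1 + (\<sigma> + real n))"
      using elim by (simp add: field_simps)
    have P: "(\<Prod>i<3. Gamma (?zs ! i + real n)) / (\<Prod>i<3. Gamma (?ws ! i + real n))
       = u (\<sigma> + real n) * (Gamma (d + (\<sigma> + real n)) / Gamma (\<gamma> + (d + (\<sigma> + real n))))" (is "_ = ?P")
      by (simp add: eval_nat_numeral u_def add_ac mult_ac)
    have "Gamma \<gamma> * (?P * (real n * real n)) * ((\<sigma> / real n + 1) * ((e - 1 + \<sigma>) / real n + 1)) =
       ((\<sigma> / real n + 1) * ((e - 1 + \<sigma>) / real n + 1) * (real n * real n)) * (Gamma \<gamma> * ?P)"
      by (simp only: mult_ac)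
    also have "\<dots> = G n" unfolding q G_def Let_def Beta_def by simp
    finally show ?case unfolding p P .
  qed
  ultimately have "G \<longlonglongrightarrow> Gamma \<gamma>"
    by (auto dest: Lim_transform_eventually)
  hence "(\<lambda>n. G (Suc n) - G n) sums (Gamma \<gamma> - G 0)" by (rule telescope_sums)
  moreover have "G 0 = 0" using \<sigma> by (auto simp: G_def Let_def)
  ultimately show ?thesis unfolding diff by simp
qed

text \<open>Each of the two series satisfies an inhomogeneous recurrence in \<open>d\<close> with
  right-hand side \<open>Gamma \<gamma>\<close>, which cancels in the difference.\<close>

lemma I_contiguous:
  assumes "d > 0"
  shows "(d + 1 + b - e) * (d + 1 + a - e) * I (d + 1) = d * (d + 1 - e) * I d"
proof -
  let ?c = "(d + 1 + b - e) * (d + 1 + a - e)" and ?c' = "d * (d + 1 - e)"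
  define p q p' q' where "p = (\<Sum>n. u (real n) * Beta \<gamma> (d + 1 + real n))"
    and "q = (\<Sum>n. u (1 - e + real n) * Beta \<gamma> (d + 1 + (1 - e) + real n))"
    and "p' = (\<Sum>n. u (real n) * Beta \<gamma> (d + real n))"
    and "q' = (\<Sum>n. u (1 - e + real n) * Beta \<gamma> (d + (1 - e) + real n))"
  have "(\<lambda>n. ?c * (u (real n) * Beta \<gamma> (d + 1 + real n)) - ?c' * (u (real n) * Beta \<gamma> (d + real n))) sums (?c * p - ?c' * p')"
    unfolding p_def p'_def by (intro sums_diff sums_mult summable_sums summable_u_Beta) (use assms \<gamma> in auto)
  from sums_unique2[OF this] have 1: "?c * p - ?c' * p' = Gamma \<gamma>" using u_Beta_telescope[of d 0] assms by simp
  have "(\<lambda>n. ?c * (u (1 - e + real n) * Beta \<gamma> (d + 1 + (1 - e) + real n)) - ?c' * (u (1 - e + real n) * Beta \<gamma> (d + (1 - e) + real n))) sums (?c * q - ?c' * q')"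
    unfolding q_def q'_def by (intro sums_diff sums_mult summable_sums summable_u_Beta) (use assms \<gamma> in auto)
  from sums_unique2[OF this] have 2: "?c * q - ?c' * q' = Gamma \<gamma>" using u_Beta_telescope[of d "1 - e"] assms by simp
  show ?thesis using 1 2 by (simp add: I_def p_def q_def p'_def q'_def right_diff_distrib)
qed


text \<open>Tannery's theorem: the quotient of Beta values lies between 0 and 1 and tends to 1 for
  each n, so \<open>u (\<sigma> + n)\<close> is a dominating sequence.\<close>

lemma u_Beta_limit:
  assumes "d > 0" and \<sigma>: "\<sigma> = 0 \<or> \<sigma> = 1 - e"
  shows "(\<lambda>N. (\<Sum>n. u (\<sigma> + real n) * Beta \<gamma> (d + real N + \<sigma> + real n)) / Beta \<gamma> (d + real N)) \<longlonglongrightarrow> (\<Sum>n. u (\<sigma> + real n))"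
proof -
  have \<sigma>0: "\<sigma> \<ge> 0" using \<sigma> \<gamma> by auto
  have summ: "summable (\<lambda>n. u (\<sigma> + real n))"
    using \<sigma> sums_summable[OF u_sums_1] sums_summable[OF u_sums_2] by auto
  have pos: "Beta \<gamma> y > 0" if "y > 0" for y
    using that \<gamma> by (auto simp: Beta_def intro!: divide_pos_pos mult_pos_pos Gamma_real_pos add_pos_pos)
  define h where "h = (\<lambda>n N. u (\<sigma> + real n) * (Beta \<gamma> (d + real N + \<sigma> + real n) / Beta \<gamma> (d + real N)))"
  have "(\<lambda>N. \<Sum>n. h n N) \<longlonglongrightarrow> (\<Sum>n. u (\<sigma> + real n))"
  proof (rule tannerys_theorem[THEN conjunct2, THEN conjunct2])
    fix n
    let ?s = "\<sigma> + real n"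
    let ?f = "\<lambda>N. Gamma (d + ?s + real N) * Gamma (\<gamma> + d + real N) / (Gamma (\<gamma> + d + ?s + real N) * Gamma (d + real N))
       * real N powr ((\<gamma> + d + ?s) + d - (d + ?s) - (\<gamma> + d))"
    have "?f \<longlonglongrightarrow> 1"
      by (rule Gamma_quotient_2_asymptotics) (use assms \<gamma> \<sigma>0 in auto)
    moreover have "\<forall>\<^sub>F N in sequentially. ?f N = Beta \<gamma> (d + real N + \<sigma> + real n) / Beta \<gamma> (d + real N)"
      using eventually_gt_at_top[of 0]
    proof eventually_elim
      case (elim N)
      have "Gamma \<gamma> > 0" using \<gamma> by simp
      thus ?case using elim by (simp add: Beta_def add_ac)
    qed
    ultimately have "(\<lambda>N. Beta \<gamma> (d + real N + \<sigma> + real n) / Beta \<gamma> (d + real N)) \<longlonglongrightarrow> 1"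
      by (rule Lim_transform_eventually)
    from tendsto_mult[OF tendsto_const this]
    show "h n \<longlonglongrightarrow> u (\<sigma> + real n)" by (simp add: h_def)
  next
    have "norm (h n N) \<le> u (\<sigma> + real n)" for n N
    proof -
      have "Beta \<gamma> (d + real N + \<sigma> + real n) \<le> Beta \<gamma> (d + real N)"
        using assms(1) \<sigma>0 \<gamma> by (intro Beta_real_mono) auto
      moreover define r where "r = Beta \<gamma> (d + real N + \<sigma> + real n) / Beta \<gamma> (d + real N)"
      ultimately have "0 \<le> r \<and> r \<le> 1"
        using pos[of "d + real N"] pos[of "d + real N + \<sigma> + real n"] assms(1) \<sigma>0 by auto
      moreover have "h n N = u (\<sigma> + real n) * r" by (simp add: h_def r_def)
      ultimately show ?thesis using u_pos[of "\<sigma> + real n"] \<sigma>0 by (simp add: abs_mult mult_left_le)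
    qed
    thus "\<forall>\<^sub>F (n, N) in sequentially \<times>\<^sub>F sequentially. norm (h n N) \<le> u (\<sigma> + real n)"
      by (intro always_eventually) auto
  qed (use summ in auto)
  moreover have "(\<Sum>n. h n N) = (\<Sum>n. u (\<sigma> + real n) * Beta \<gamma> (d + real N + \<sigma> + real n)) / Beta \<gamma> (d + real N)" for N
  proof -
    have "summable (\<lambda>n. u (\<sigma> + real n) * Beta \<gamma> (d + real N + \<sigma> + real n))"
      using summable_u_Beta[of "d + real N" \<gamma>] \<sigma> assms(1) \<gamma> by auto
    from suminf_divide[OF this] show ?thesis by (simp add: h_def)
  qed
  ultimately show ?thesis by simp
qed

text \<open>The quotient of both sides is invariant under \<open>d \<mapsto> d + 1\<close>, and
  along \<open>d + N\<close> it is found from the limits \<open>u_Beta_limit\<close>, where only the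
  constant \<open>kap\<close> of the two Gauss sums survives.\<close>

lemma nonterminating_Saalschuetz:
  assumes "d > 0"
  shows "I d = kap * Gamma \<gamma> * (Gamma d * Gamma (d + 1 - e) / (Gamma (d + 1 + b - e) * Gamma (d + 1 + a - e)))"
proof -
  define X where "X = (\<lambda>d. Gamma d * Gamma (d + 1 - e) / (Gamma (d + 1 + b - e) * Gamma (d + 1 + a - e)))"
  have X0: "X x > 0" if "x > 0" for x
    unfolding X_def using that a b e by (intro divide_pos_pos mult_pos_pos Gamma_real_pos) auto
  have step: "I (x + 1) / X (x + 1) = I x / X x" if x: "x > 0" for x
  proof -
    have p: "x + 1 + b - e > 0" "x + 1 + a - e > 0" "x + 1 - e > 0" using x a b e by auto
    have G: "Gamma (x + 1) = x * Gamma x" "Gamma (x + 1 + 1 - e) = (x + 1 - e) * Gamma (x + 1 - e)"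
      "Gamma (x + 1 + 1 + b - e) = (x + 1 + b - e) * Gamma (x + 1 + b - e)"
      "Gamma (x + 1 + 1 + a - e) = (x + 1 + a - e) * Gamma (x + 1 + a - e)"
      using Gamma_Suc_real[of x] Gamma_Suc_real[of "x + 1 - e"] Gamma_Suc_real[of "x + 1 + b - e"] Gamma_Suc_real[of "x + 1 + a - e"] p x
      by (simp_all add: algebra_simps)
    have "X (x + 1) = X x * (x * (x + 1 - e) / ((x + 1 + b - e) * (x + 1 + a - e)))"
      unfolding X_def G by (simp add: mult_ac)
    moreover have "I (x + 1) = x * (x + 1 - e) * I x / ((x + 1 + b - e) * (x + 1 + a - e))"
    proof -
      have "(x + 1 + b - e) * (x + 1 + a - e) \<noteq> 0" using p by simp
      thus ?thesis using I_contiguous[OF x] by (metis nonzero_eq_divide_eq mult.commute)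
    qed
    ultimately show ?thesis using p x X0[OF x] by simp
  qed
  have const: "I (d + real N) / X (d + real N) = I d / X d" for N
  proof (induction N)
    case (Suc N)
    thus ?case using step[of "d + real N"] assms by (simp add: add_ac)
  qed auto
  have "(\<lambda>N. (\<Sum>n. u (0 + real n) * Beta \<gamma> (d + real N + 0 + real n)) / Beta \<gamma> (d + real N)
     - (\<Sum>n. u (1 - e + real n) * Beta \<gamma> (d + real N + (1 - e) + real n)) / Beta \<gamma> (d + real N))
     \<longlonglongrightarrow> (\<Sum>n. u (0 + real n)) - (\<Sum>n. u (1 - e + real n))"
    by (intro tendsto_diff u_Beta_limit assms) auto
  hence "(\<lambda>N. I (d + real N) / Beta \<gamma> (d + real N)) \<longlonglongrightarrow> kap"
    using u_sums_diff by (simp add: I_def diff_divide_distrib)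
  moreover have "(\<lambda>N. Beta \<gamma> (d + real N) / X (d + real N)) \<longlonglongrightarrow> Gamma \<gamma>"
  proof -
    let ?f = "\<lambda>N. Gamma \<gamma> * (Gamma (d + 1 + b - e + real N) * Gamma (d + 1 + a - e + real N) / (Gamma (\<gamma> + d + real N) * Gamma (d + 1 - e + real N))
       * real N powr ((\<gamma> + d) + (d + 1 - e) - (d + 1 + b - e) - (d + 1 + a - e)))"
    have "?f \<longlonglongrightarrow> Gamma \<gamma> * 1"
      by (intro tendsto_mult tendsto_const Gamma_quotient_2_asymptotics) (use assms \<gamma> a b in auto)
    moreover have "\<forall>\<^sub>F N in sequentially. ?f N = Beta \<gamma> (d + real N) / X (d + real N)"
      using eventually_gt_at_top[of 0]
    proof eventually_elim
      case (elim N)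
      have "(\<gamma> + d) + (d + 1 - e) - (d + 1 + b - e) - (d + 1 + a - e) = 0" by (simp add: \<gamma>_def)
      moreover have "Gamma (d + real N) > 0" using assms by simp
      ultimately show ?case using elim by (simp add: Beta_def X_def algebra_simps)
    qed
    ultimately show ?thesis by (auto dest: Lim_transform_eventually)
  qed
  ultimately have "(\<lambda>N. I (d + real N) / Beta \<gamma> (d + real N) * (Beta \<gamma> (d + real N) / X (d + real N))) \<longlonglongrightarrow> kap * Gamma \<gamma>"
    by (rule tendsto_mult)
  moreover have "I (d + real N) / Beta \<gamma> (d + real N) * (Beta \<gamma> (d + real N) / X (d + real N)) = I d / X d" for N
  proof -
    have "Beta \<gamma> (d + real N) > 0"
      using assms \<gamma> by (auto simp: Beta_def intro!: divide_pos_pos mult_pos_pos Gamma_real_pos add_pos_pos add_pos_nonneg)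
    thus ?thesis using const[of N] by simp
  qed
  ultimately have "I d / X d = kap * Gamma \<gamma>" by (simp add: LIMSEQ_const_iff)
  hence "I d = kap * Gamma \<gamma> * X d" using X0[OF assms] by (simp add: field_simps)
  thus ?thesis by (simp only: X_def)
qed

text \<open>For m = 0 Gauss's theorem sums the third series to the Saalschuetz value. The induction
  step subtracts the cases \<open>d\<close> and \<open>d + 1\<close>, by Beta(x+1, y) = Beta(x, y) -
  Beta(x, y+1), which acts on all three series alike; hence \<open>d\<close> is arbitrary in the
  induction.\<close>

lemma three_term_3F2:
  assumes "d > 0"
  shows "\<exists>p q r. (\<lambda>n. u (real n) * Beta (\<gamma> + real m) (d + real n)) sums p \<and>
    (\<lambda>n. u (1 - e + real n) * Beta (\<gamma> + real m) (d + (1 - e) + real n)) sums q \<and>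
    (\<lambda>k. hyp2_term a b \<gamma> k * Beta (\<gamma> + real m + real k) d) sums r \<and> p - q = kap * r"
  using assms
proof (induction m arbitrary: d)
  case 0
  have c: "\<gamma> + d > a + b" using 0 \<gamma> e by (simp add: \<gamma>_def)
  have "(\<lambda>k. Beta \<gamma> d * hyp2_term a b (\<gamma> + d) k) sums (Beta \<gamma> d * (Gamma (\<gamma> + d) * Gamma (\<gamma> + d - a - b) / (Gamma (\<gamma> + d - a) * Gamma (\<gamma> + d - b))))"
    by (intro sums_mult Gauss_hypergeometric a b c)
  moreover have "Beta \<gamma> d * hyp2_term a b (\<gamma> + d) k = hyp2_term a b \<gamma> k * Beta (\<gamma> + real k) d" for k
    by (rule Beta_hyp2_term[OF a b \<gamma>(1) 0])
  moreover have "Beta \<gamma> d * (Gamma (\<gamma> + d) * Gamma (\<gamma> + d - a - b) / (Gamma (\<gamma> + d - a) * Gamma (\<gamma> + d - b)))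
      = Gamma \<gamma> * (Gamma d * Gamma (d + 1 - e) / (Gamma (d + 1 + b - e) * Gamma (d + 1 + a - e)))"
  proof -
    have eq: "\<gamma> + d - a - b = d + 1 - e" "\<gamma> + d - a = d + 1 + b - e" "\<gamma> + d - b = d + 1 + a - e"
      by (simp_all add: \<gamma>_def)
    have "Gamma (\<gamma> + d) > 0" using \<gamma> 0 by simp
    thus ?thesis unfolding eq by (simp add: Beta_def algebra_simps)
  qed
  ultimately have "(\<lambda>k. hyp2_term a b \<gamma> k * Beta (\<gamma> + real 0 + real k) d) sums
      (Gamma \<gamma> * (Gamma d * Gamma (d + 1 - e) / (Gamma (d + 1 + b - e) * Gamma (d + 1 + a - e))))" by simp
  moreover have "(\<lambda>n. u (real n) * Beta (\<gamma> + real 0) (d + real n)) sums (\<Sum>n. u (real n) * Beta \<gamma> (d + real n))"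
    "(\<lambda>n. u (1 - e + real n) * Beta (\<gamma> + real 0) (d + (1 - e) + real n)) sums (\<Sum>n. u (1 - e + real n) * Beta \<gamma> (d + (1 - e) + real n))"
    using summable_u_Beta[OF 0 \<gamma>(1), THEN summable_sums] by simp_all
  moreover note nonterminating_Saalschuetz[OF 0, unfolded I_def]
  ultimately show ?case by (fastforce simp: mult.assoc)
next
  case (Suc m)
  obtain p q r where 1: "(\<lambda>n. u (real n) * Beta (\<gamma> + real m) (d + real n)) sums p"
    "(\<lambda>n. u (1 - e + real n) * Beta (\<gamma> + real m) (d + (1 - e) + real n)) sums q"
    "(\<lambda>k. hyp2_term a b \<gamma> k * Beta (\<gamma> + real m + real k) d) sums r" "p - q = kap * r"
    using Suc.IH[OF Suc.prems] by blast
  obtain p' q' r' where 2: "(\<lambda>n. u (real n) * Beta (\<gamma> + real m) (d + 1 + real n)) sums p'"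
    "(\<lambda>n. u (1 - e + real n) * Beta (\<gamma> + real m) (d + 1 + (1 - e) + real n)) sums q'"
    "(\<lambda>k. hyp2_term a b \<gamma> k * Beta (\<gamma> + real m + real k) (d + 1)) sums r'" "p' - q' = kap * r'"
    using Suc.IH[of "d + 1"] Suc.prems by fastforce
  have B: "Beta (x + 1) y = Beta x y - Beta x (y + 1)" if "x > 0" "y > 0" for x y :: real
    using Beta_plus1_plus1[of x y] that by (force simp: nonpos_Ints_def)
  have g: "\<gamma> + real (Suc m) = \<gamma> + real m + 1" by simp
  have "(\<lambda>n. u (real n) * Beta (\<gamma> + real (Suc m)) (d + real n)) sums (p - p')"
  proof -
    have "u (real n) * Beta (\<gamma> + real (Suc m)) (d + real n) =
      u (real n) * Beta (\<gamma> + real m) (d + real n) - u (real n) * Beta (\<gamma> + real m) (d + 1 + real n)" for n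
      using B[of "\<gamma> + real m" "d + real n"] Suc.prems \<gamma> unfolding g by (simp add: add_ac right_diff_distrib)
    thus ?thesis using sums_diff[OF 1(1) 2(1)] by simp
  qed
  moreover have "(\<lambda>n. u (1 - e + real n) * Beta (\<gamma> + real (Suc m)) (d + (1 - e) + real n)) sums (q - q')"
  proof -
    have h: "d + 1 + (1 - e) + real n = d + (1 - e) + real n + 1" for n by simp
    have B': "Beta (\<gamma> + real m + 1) (d + (1 - e) + real n) =
        Beta (\<gamma> + real m) (d + (1 - e) + real n) - Beta (\<gamma> + real m) (d + (1 - e) + real n + 1)" for n
      by (rule B) (use Suc.prems \<gamma> in auto)
    have "u (1 - e + real n) * Beta (\<gamma> + real (Suc m)) (d + (1 - e) + real n) =
      u (1 - e + real n) * Beta (\<gamma> + real m) (d + (1 - e) + real n) - u (1 - e + real n) * Beta (\<gamma> + real m) (d + 1 + (1 - e) + real n)" for n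
      unfolding g h B' by (rule right_diff_distrib)
    thus ?thesis using sums_diff[OF 1(2) 2(2)] by simp
  qed
  moreover have "(\<lambda>k. hyp2_term a b \<gamma> k * Beta (\<gamma> + real (Suc m) + real k) d) sums (r - r')"
  proof -
    have h: "\<gamma> + real (Suc m) + real k = \<gamma> + real m + real k + 1" for k by simp
    have B': "Beta (\<gamma> + real m + real k + 1) d = Beta (\<gamma> + real m + real k) d - Beta (\<gamma> + real m + real k) (d + 1)" for k
      by (rule B) (use Suc.prems \<gamma> in auto)
    have "hyp2_term a b \<gamma> k * Beta (\<gamma> + real (Suc m) + real k) d =
      hyp2_term a b \<gamma> k * Beta (\<gamma> + real m + real k) d - hyp2_term a b \<gamma> k * Beta (\<gamma> + real m + real k) (d + 1)" for k
      unfolding h B' by (rule right_diff_distrib)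
    thus ?thesis using sums_diff[OF 1(3) 2(3)] by simp
  qed
  moreover have "(p - p') - (q - q') = kap * (r - r')" using 1(4) 2(4) by (simp add: algebra_simps)
  ultimately show ?case by blast
qed

end

section \<open>Interchange of summations\<close>

lemma sums_swap_nonneg:
  fixes t :: "nat \<Rightarrow> nat \<Rightarrow> real"
  assumes nonneg: "\<And>n m. t n m \<ge> 0" and row: "\<And>n. (\<lambda>m. t n m) sums U n"
    and U: "U sums s" and col: "\<And>m. (\<lambda>n. t n m) sums W m"
  shows "W sums s"
proof -
  define f where "f = (\<lambda>(n, m). t n m)"
  have row': "((\<lambda>m. f (n, m)) has_sum U n) UNIV" for n
    unfolding f_def by (simp add: sums_nonneg_imp_has_sum[OF row nonneg])
  have col': "((\<lambda>n. f (n, m)) has_sum W m) UNIV" for m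
    unfolding f_def by (simp add: sums_nonneg_imp_has_sum[OF col nonneg])
  have U0: "U n \<ge> 0" for n
    using row[of n] nonneg by (metis sums_le sums_zero)
  have U': "(U has_sum s) UNIV" by (rule sums_nonneg_imp_has_sum[OF U U0])
  have "f summable_on (UNIV \<times> UNIV)"
    by (rule summable_on_SigmaI[where f = f and g = U]) (use row' has_sum_imp_summable[OF U'] nonneg in \<open>auto simp: f_def\<close>)
  then obtain T where T: "(f has_sum T) (UNIV \<times> UNIV)" by (auto simp: summable_on_def)
  have "(U has_sum T) UNIV" by (rule has_sum_SigmaD[OF T]) (rule row')
  hence "T = s" using U' has_sum_unique by blast
  moreover have "((\<lambda>(x, y). f (y, x)) has_sum T) (UNIV \<times> UNIV)" using T by (subst (asm) has_sum_swap)
  hence "(W has_sum T) UNIV" by (rule has_sum_SigmaD) (use col' in auto)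
  ultimately show ?thesis by (auto intro: has_sum_imp_sums)
qed

lemma hyp2_term_nonneg: "a > 0 \<Longrightarrow> b > 0 \<Longrightarrow> c > 0 \<Longrightarrow> hyp2_term a b c k \<ge> 0"
  by (auto simp: hyp2_term_def intro!: divide_nonneg_nonneg mult_nonneg_nonneg pochhammer_nonneg)

lemma Beta_real_nonneg: "x > 0 \<Longrightarrow> y > 0 \<Longrightarrow> Beta x y \<ge> (0::real)"
  by (auto simp: Beta_def intro!: divide_nonneg_nonneg mult_nonneg_nonneg Gamma_real_nonneg)

definition Lterm :: "real \<Rightarrow> real \<Rightarrow> real \<Rightarrow> real \<Rightarrow> real \<Rightarrow> real \<Rightarrow> real \<Rightarrow> real \<Rightarrow> real" where
  "Lterm a b c d e f g s = Gamma (a + s) * Gamma (b + s) * Gamma (c + s) * Gamma (d + s)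
     / (Gamma (1 + s) * Gamma (e + s) * Gamma (f + s) * Gamma (g + s))"

lemma summable_Lterm:
  assumes pos: "a > 0" "b > 0" "c > 0" "d > 0" "e > 0" "f > 0" "g > 0" "\<sigma> \<ge> 0"
    and "e + f + g = 1 + a + b + c + d"
  shows "summable (\<lambda>n. Lterm a b c d e f g (\<sigma> + real n))"
proof (rule summable_if_asymptotic_powr)
  have "(\<lambda>n. (\<Prod>i<4. Gamma ([a + \<sigma>, b + \<sigma>, c + \<sigma>, d + \<sigma>] ! i + real n)) / (\<Prod>i<4. Gamma ([1 + \<sigma>, e + \<sigma>, f + \<sigma>, g + \<sigma>] ! i + real n))
     * real n powr ((\<Sum>i<4. [1 + \<sigma>, e + \<sigma>, f + \<sigma>, g + \<sigma>] ! i) - (\<Sum>i<4. [a + \<sigma>, b + \<sigma>, c + \<sigma>, d + \<sigma>] ! i))) \<longlonglongrightarrow> 1"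
  proof (rule Gamma_quotient_asymptotics_real)
    fix i :: nat assume i: "i < 4"
    show "[a + \<sigma>, b + \<sigma>, c + \<sigma>, d + \<sigma>] ! i > 0" "[1 + \<sigma>, e + \<sigma>, f + \<sigma>, g + \<sigma>] ! i > 0"
      by (rule less_4_cases[OF _ _ _ _ i]; use pos in simp)+
  qed
  moreover have "(\<Sum>i<4. [1 + \<sigma>, e + \<sigma>, f + \<sigma>, g + \<sigma>] ! i) - (\<Sum>i<4. [a + \<sigma>, b + \<sigma>, c + \<sigma>, d + \<sigma>] ! i) = 2"
    using assms(9) by (simp add: sum_lessThan_4)
  ultimately show "(\<lambda>n. Lterm a b c d e f g (\<sigma> + real n) * real n powr 2) \<longlonglongrightarrow> 1"
    by (simp add: Lterm_def prod_lessThan_4 add_ac)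
qed auto

context hyp3
begin

text \<open>Gauss's theorem with lower parameter \<open>\<gamma> + c + s\<close> has excess
  \<open>d + s\<close>. Thus the summation over m creates the upper parameter d and the lower
  parameters \<open>\<alpha> + d\<close> and \<open>\<beta> + d\<close>.\<close>

lemma Lterm_sums:
  assumes pos: "\<alpha> > 0" "\<beta> > 0" "c > 0" "d > 0" "\<alpha> + \<beta> = \<gamma> + c - d" and s: "s \<ge> 0"
  shows "(\<lambda>m. hyp2_term \<alpha> \<beta> \<gamma> m * (u s * Beta (\<gamma> + real m) (c + s))) sums (Gamma \<gamma> * Lterm a b c d e (\<alpha> + d) (\<beta> + d) s)"
proof -
  have C: "\<gamma> + (c + s) > \<alpha> + \<beta>" using pos s by simp
  have "(\<lambda>m. u s * (Beta \<gamma> (c + s) * hyp2_term \<alpha> \<beta> (\<gamma> + (c + s)) m)) sums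
    (u s * (Beta \<gamma> (c + s) * (Gamma (\<gamma> + (c + s)) * Gamma (\<gamma> + (c + s) - \<alpha> - \<beta>) / (Gamma (\<gamma> + (c + s) - \<alpha>) * Gamma (\<gamma> + (c + s) - \<beta>)))))"
    by (intro sums_mult Gauss_hypergeometric pos C)
  moreover have "u s * (Beta \<gamma> (c + s) * hyp2_term \<alpha> \<beta> (\<gamma> + (c + s)) m) = hyp2_term \<alpha> \<beta> \<gamma> m * (u s * Beta (\<gamma> + real m) (c + s))" for m
    using Beta_hyp2_term[of \<alpha> \<beta> \<gamma> "c + s" m] pos \<gamma> s by simp
  moreover have "u s * (Beta \<gamma> (c + s) * (Gamma (\<gamma> + (c + s)) * Gamma (\<gamma> + (c + s) - \<alpha> - \<beta>) / (Gamma (\<gamma> + (c + s) - \<alpha>) * Gamma (\<gamma> + (c + s) - \<beta>))))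
     = Gamma \<gamma> * Lterm a b c d e (\<alpha> + d) (\<beta> + d) s"
  proof -
    have eq: "\<gamma> + (c + s) - \<alpha> - \<beta> = d + s" "\<gamma> + (c + s) - \<alpha> = \<beta> + d + s" "\<gamma> + (c + s) - \<beta> = \<alpha> + d + s"
      using pos by simp_all
    have "Gamma (\<gamma> + (c + s)) > 0" using \<gamma> pos s by simp
    thus ?thesis unfolding eq Beta_def u_def Lterm_def by (simp add: mult_ac)
  qed
  ultimately show ?thesis by simp
qed

text \<open>Summation over m first produces the two series of \<open>Lterm\<close>; summation over n
  first lets \<open>three_term_3F2\<close> contract their difference to
  \<open>kap * \<rho> m\<close>. As \<open>\<rho> m\<close> is itself a series over k, a double
  series with a kernel symmetric in m and k results.\<close>

lemma Lterm_double_sum: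
  assumes pos: "\<alpha> > 0" "\<beta> > 0" "c > 0" "d > 0" "\<alpha> + \<beta> = \<gamma> + c - d"
  shows "\<exists>\<rho>. (\<forall>m. (\<lambda>k. hyp2_term a b \<gamma> k * Beta (\<gamma> + real m + real k) c) sums \<rho> m) \<and>
    (\<lambda>m. hyp2_term \<alpha> \<beta> \<gamma> m * (kap * \<rho> m)) sums
      (Gamma \<gamma> * ((\<Sum>n. Lterm a b c d e (\<alpha> + d) (\<beta> + d) (real n)) - (\<Sum>n. Lterm a b c d e (\<alpha> + d) (\<beta> + d) (1 - e + real n))))"
proof -
  define p q \<rho> where "p = (\<lambda>m. \<Sum>n. u (real n) * Beta (\<gamma> + real m) (c + real n))"
    and "q = (\<lambda>m. \<Sum>n. u (1 - e + real n) * Beta (\<gamma> + real m) (c + (1 - e) + real n))"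
    and "\<rho> = (\<lambda>m. \<Sum>k. hyp2_term a b \<gamma> k * Beta (\<gamma> + real m + real k) c)"
  have pq: "(\<lambda>n. u (real n) * Beta (\<gamma> + real m) (c + real n)) sums p m"
    "(\<lambda>n. u (1 - e + real n) * Beta (\<gamma> + real m) (c + (1 - e) + real n)) sums q m"
    "(\<lambda>k. hyp2_term a b \<gamma> k * Beta (\<gamma> + real m + real k) c) sums \<rho> m"
    "p m - q m = kap * \<rho> m" for m
    using three_term_3F2[OF pos(3), of m] unfolding p_def q_def \<rho>_def sums_iff by auto
  let ?L = "Lterm a b c d e (\<alpha> + d) (\<beta> + d)"
  have summ: "summable (\<lambda>n. ?L (\<sigma> + real n))" if "\<sigma> \<ge> 0" for \<sigma>
    by (rule summable_Lterm) (use a b pos \<gamma> that in \<open>auto simp: \<gamma>_def\<close>)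
  have "(\<lambda>m. hyp2_term \<alpha> \<beta> \<gamma> m * p m) sums (Gamma \<gamma> * (\<Sum>n. ?L (real n)))"
  proof (rule sums_swap_nonneg)
    show "0 \<le> hyp2_term \<alpha> \<beta> \<gamma> m * (u (real n) * Beta (\<gamma> + real m) (c + real n))" for n m
      using pos \<gamma> u_pos[of "real n"] by (intro mult_nonneg_nonneg hyp2_term_nonneg Beta_real_nonneg) auto
    show "(\<lambda>m. hyp2_term \<alpha> \<beta> \<gamma> m * (u (real n) * Beta (\<gamma> + real m) (c + real n))) sums (Gamma \<gamma> * ?L (real n))" for n
      by (rule Lterm_sums) (use pos in auto)
    show "(\<lambda>n. Gamma \<gamma> * ?L (real n)) sums (Gamma \<gamma> * (\<Sum>n. ?L (real n)))"
      using summ[of 0] by (intro sums_mult summable_sums) auto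
    show "(\<lambda>n. hyp2_term \<alpha> \<beta> \<gamma> m * (u (real n) * Beta (\<gamma> + real m) (c + real n))) sums (hyp2_term \<alpha> \<beta> \<gamma> m * p m)" for m
      by (intro sums_mult pq)
  qed
  moreover have "(\<lambda>m. hyp2_term \<alpha> \<beta> \<gamma> m * q m) sums (Gamma \<gamma> * (\<Sum>n. ?L (1 - e + real n)))"
  proof (rule sums_swap_nonneg)
    show "0 \<le> hyp2_term \<alpha> \<beta> \<gamma> m * (u (1 - e + real n) * Beta (\<gamma> + real m) (c + (1 - e) + real n))" for n m
      using pos \<gamma> u_pos[of "1 - e + real n"] by (intro mult_nonneg_nonneg hyp2_term_nonneg Beta_real_nonneg) auto
    show "(\<lambda>m. hyp2_term \<alpha> \<beta> \<gamma> m * (u (1 - e + real n) * Beta (\<gamma> + real m) (c + (1 - e) + real n))) sums (Gamma \<gamma> * ?L (1 - e + real n))" for n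
    proof -
      have "1 - e + real n \<ge> 0" using e by auto
      from Lterm_sums[OF pos this] show ?thesis by (simp add: add.assoc)
    qed
    show "(\<lambda>n. Gamma \<gamma> * ?L (1 - e + real n)) sums (Gamma \<gamma> * (\<Sum>n. ?L (1 - e + real n)))"
      using summ[of "1 - e"] e by (intro sums_mult summable_sums) auto
    show "(\<lambda>n. hyp2_term \<alpha> \<beta> \<gamma> m * (u (1 - e + real n) * Beta (\<gamma> + real m) (c + (1 - e) + real n))) sums (hyp2_term \<alpha> \<beta> \<gamma> m * q m)" for m
      by (intro sums_mult pq)
  qed
  ultimately have "(\<lambda>m. hyp2_term \<alpha> \<beta> \<gamma> m * p m - hyp2_term \<alpha> \<beta> \<gamma> m * q m) sums
     (Gamma \<gamma> * (\<Sum>n. ?L (real n)) - Gamma \<gamma> * (\<Sum>n. ?L (1 - e + real n)))" by (rule sums_diff)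
  hence "(\<lambda>m. hyp2_term \<alpha> \<beta> \<gamma> m * (kap * \<rho> m)) sums (Gamma \<gamma> * ((\<Sum>n. ?L (real n)) - (\<Sum>n. ?L (1 - e + real n))))"
    by (simp add: pq(4)[symmetric] right_diff_distrib)
  thus ?thesis using pq(3) by blast
qed

end

definition Lreal :: "real \<Rightarrow> real \<Rightarrow> real \<Rightarrow> real \<Rightarrow> real \<Rightarrow> real \<Rightarrow> real \<Rightarrow> real" where
  "Lreal a b c d e f g = (\<Sum>n. Lterm a b c d e f g (real n)) - (\<Sum>n. Lterm a b c d e f g (1 - e + real n))"

text \<open>Both sides are the same double series, summed in different orders.\<close>

lemma Lreal_transformation:
  assumes ab: "a > 0" "b > 0" "e < 1" "a + b < e" and cd: "c > 0" "c < d" and fg: "f > d" "g > d"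
    and sum: "e + f + g = 1 + a + b + c + d"
  shows "hyp3.kap (f - d) (g - d) (1 + c - d) * Lreal a b c d e f g =
    hyp3.kap a b e * Lreal (f - d) (g - d) c (1 + c - e) (1 + c - d) (1 + a + c - e) (1 + b + c - e)"
proof -
  let ?L' = "Lreal (f - d) (g - d) c (1 + c - e) (1 + c - d) (1 + a + c - e) (1 + b + c - e)"
  interpret h: hyp3 a b e by standard (use ab in auto)
  interpret h': hyp3 "f - d" "g - d" "1 + c - d" by standard (use ab cd fg sum in auto)
  \<comment> \<open>By the balance condition both parameter sets have the same
    \<open>\<gamma>\<close>. They also share \<open>c\<close>, hence the Beta kernel, and only the
    roles of k and m differ.\<close>
  have \<gamma>: "h'.\<gamma> = h.\<gamma>" unfolding h.\<gamma>_def h'.\<gamma>_def using sum by simp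
  have 1: "f - d + (g - d) = h.\<gamma> + c - d" unfolding h.\<gamma>_def using sum by simp
  have 2: "a + b = h'.\<gamma> + c - (1 + c - e)" unfolding \<gamma> h.\<gamma>_def by simp
  have "d > 0" "1 + c - e > 0" using cd ab by auto
  obtain \<rho> where \<rho>: "\<And>m. (\<lambda>k. hyp2_term a b h.\<gamma> k * Beta (h.\<gamma> + real m + real k) c) sums \<rho> m"
    "(\<lambda>m. hyp2_term (f - d) (g - d) h.\<gamma> m * (h.kap * \<rho> m)) sums (Gamma h.\<gamma> * Lreal a b c d e f g)"
    using h.Lterm_double_sum[OF _ _ cd(1) \<open>d > 0\<close> 1] fg by (auto simp: Lreal_def)
  obtain \<rho>' where \<rho>': "\<And>k. (\<lambda>m. hyp2_term (f - d) (g - d) h.\<gamma> m * Beta (h.\<gamma> + real k + real m) c) sums \<rho>' k"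
    "(\<lambda>k. hyp2_term a b h.\<gamma> k * (h'.kap * \<rho>' k)) sums
      (Gamma h.\<gamma> * ?L')"
    using h'.Lterm_double_sum[OF ab(1,2) cd(1) \<open>1 + c - e > 0\<close> 2] unfolding \<gamma> by (auto simp: Lreal_def algebra_simps)
  have kap0: "h.kap > 0" "h'.kap > 0"
  proof -
    have *: "hyp3.kap x y z > 0" if "hyp3 x y z" for x y z
    proof -
      interpret hyp3 x y z by fact
      have "sin (pi * z) > 0" using e a b by (intro sin_gt_zero) auto
      thus ?thesis unfolding kap_def using a b e \<gamma>
        by (intro divide_pos_pos mult_pos_pos Gamma_real_pos) auto
    qed
    show "h.kap > 0" "h'.kap > 0" by (rule *, unfold_locales)+
  qed
  have A: "(\<lambda>m. hyp2_term (f - d) (g - d) h.\<gamma> m * \<rho> m) sums (Gamma h.\<gamma> * Lreal a b c d e f g / h.kap)"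
    using sums_divide[OF \<rho>(2), of h.kap] kap0 by simp
  have B: "(\<lambda>k. hyp2_term a b h.\<gamma> k * \<rho>' k) sums
     (Gamma h.\<gamma> * ?L' / h'.kap)"
    using sums_divide[OF \<rho>'(2), of h'.kap] kap0 by simp
  have "(\<lambda>k. hyp2_term a b h.\<gamma> k * \<rho>' k) sums (Gamma h.\<gamma> * Lreal a b c d e f g / h.kap)"
  proof (rule sums_swap_nonneg[OF _ _ A])
    show "0 \<le> hyp2_term (f - d) (g - d) h.\<gamma> m * (hyp2_term a b h.\<gamma> k * Beta (h.\<gamma> + real m + real k) c)" for m k
      using ab fg cd h.\<gamma> by (intro mult_nonneg_nonneg hyp2_term_nonneg Beta_real_nonneg) auto
    show "(\<lambda>k. hyp2_term (f - d) (g - d) h.\<gamma> m * (hyp2_term a b h.\<gamma> k * Beta (h.\<gamma> + real m + real k) c)) sums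
        (hyp2_term (f - d) (g - d) h.\<gamma> m * \<rho> m)" for m
      by (intro sums_mult \<rho>)
    show "(\<lambda>m. hyp2_term (f - d) (g - d) h.\<gamma> m * (hyp2_term a b h.\<gamma> k * Beta (h.\<gamma> + real m + real k) c)) sums
        (hyp2_term a b h.\<gamma> k * \<rho>' k)" for k
      using sums_mult[OF \<rho>'(1)[of k], of "hyp2_term a b h.\<gamma> k"] by (simp add: mult_ac add_ac)
  qed
  from sums_unique2[OF this B]
  have "Gamma h.\<gamma> * Lreal a b c d e f g * h'.kap =
    Gamma h.\<gamma> * ?L' * h.kap"
    using kap0 by (metis frac_eq_eq less_irrefl)
  thus ?thesis using h.\<gamma> by (simp add: Gamma_real_nonzero mult_ac)
qed

text \<open>The Gamma factors give both series the same denominator, the product of Gamma at a, b,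
  c, d and at 1+a-e, ..., 1+d-e. So this is \<open>Lreal\<close> over that product for suitable real
  parameters, and entire on the balanced hyperplane.\<close>

definition Lnum :: "complex \<Rightarrow> complex \<Rightarrow> complex \<Rightarrow> complex \<Rightarrow> complex \<Rightarrow> complex \<Rightarrow> complex \<Rightarrow> complex" where
  "Lnum a b c d e f g =
     Freg a b c d e f g * (rGamma (1 + a - e) * rGamma (1 + b - e) * rGamma (1 + c - e) * rGamma (1 + d - e))
   - Freg (1 + a - e) (1 + b - e) (1 + c - e) (1 + d - e) (2 - e) (1 + f - e) (1 + g - e)
       * (rGamma a * rGamma b * rGamma c * rGamma d)"

lemma Freg_of_real:
  assumes "a > 0" "b > 0" "c > 0" "d > 0" "e > 0" "f > 0" "g > 0" "e + f + g = 1 + a + b + c + d"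
  shows "Freg (of_real a) (of_real b) (of_real c) (of_real d) (of_real e) (of_real f) (of_real g) =
    of_real ((\<Sum>n. Lterm a b c d e f g (real n)) / (Gamma a * Gamma b * Gamma c * Gamma d))"
proof -
  have "Freg_term (of_real a) (of_real b) (of_real c) (of_real d) (of_real e) (of_real f) (of_real g) n =
     of_real (Lterm a b c d e f g (real n) / (Gamma a * Gamma b * Gamma c * Gamma d))" for n
  proof -
    have r: "rGamma (complex_of_real x + of_nat n) = of_real (rGamma (x + real n))" for x
      using rGamma_complex_of_real[of "x + real n"] by simp
    have r1: "rGamma (1 + of_nat n) = complex_of_real (rGamma (1 + real n))"
      using r[of 1] by simp
    have p: "pochhammer (complex_of_real x) n = of_real (Gamma (x + real n) / Gamma x)" if "x > 0" for x
      using that by (simp add: pochhammer_of_real pochhammer_Gamma_real)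
    show ?thesis
      using assms(1-4) unfolding Freg_term_def r r1 p[OF assms(1)] p[OF assms(2)] p[OF assms(3)] p[OF assms(4)]
      by (simp add: Lterm_def rGamma_inverse_Gamma field_simps)
  qed
  hence "Freg (of_real a) (of_real b) (of_real c) (of_real d) (of_real e) (of_real f) (of_real g) =
    (\<Sum>n. of_real (Lterm a b c d e f g (real n) / (Gamma a * Gamma b * Gamma c * Gamma d)))"
    by (simp only: Freg_def)
  also have s: "summable (\<lambda>n. Lterm a b c d e f g (real n))"
    using summable_Lterm[of a b c d e f g 0] assms by simp
  have "(\<Sum>n. complex_of_real (Lterm a b c d e f g (real n) / (Gamma a * Gamma b * Gamma c * Gamma d))) =
    of_real (\<Sum>n. Lterm a b c d e f g (real n) / (Gamma a * Gamma b * Gamma c * Gamma d))"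
    by (rule suminf_of_real[symmetric, OF summable_divide[OF s]])
  also have "(\<Sum>n. Lterm a b c d e f g (real n) / (Gamma a * Gamma b * Gamma c * Gamma d)) =
    (\<Sum>n. Lterm a b c d e f g (real n)) / (Gamma a * Gamma b * Gamma c * Gamma d)"
    by (rule suminf_divide[OF s])
  finally show ?thesis .
qed

lemma Lnum_of_real:
  assumes "a > 0" "b > 0" "c > 0" "d > 0" "0 < e" "e < 1" "f > 0" "g > 0" "e + f + g = 1 + a + b + c + d"
  shows "Lnum (of_real a) (of_real b) (of_real c) (of_real d) (of_real e) (of_real f) (of_real g) =
    of_real (Lreal a b c d e f g / (Gamma a * Gamma b * Gamma c * Gamma d *
      (Gamma (1 + a - e) * Gamma (1 + b - e) * Gamma (1 + c - e) * Gamma (1 + d - e))))"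
proof -
  let ?G' = "(Gamma (1 + a - e) * Gamma (1 + b - e) * Gamma (1 + c - e) * Gamma (1 + d - e))"
  have 1: "Lterm (1 + a - e) (1 + b - e) (1 + c - e) (1 + d - e) (2 - e) (1 + f - e) (1 + g - e) (real n)
      = Lterm a b c d e f g (1 - e + real n)" for n
    by (simp add: Lterm_def algebra_simps)
  have 2: "rGamma (1 + complex_of_real x - of_real e) = of_real (inverse (Gamma (1 + x - e)))"
    "rGamma (complex_of_real x) = of_real (inverse (Gamma x))" for x
    using rGamma_complex_of_real[of "1 + x - e"] rGamma_complex_of_real[of x] by (simp_all add: rGamma_inverse_Gamma)
  have "Freg (of_real (1 + a - e)) (of_real (1 + b - e)) (of_real (1 + c - e)) (of_real (1 + d - e)) (of_real (2 - e)) (of_real (1 + f - e)) (of_real (1 + g - e)) =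
    of_real ((\<Sum>n. Lterm a b c d e f g (1 - e + real n)) / ?G')"
    using assms by (subst Freg_of_real) (auto simp: 1)
  hence 3: "Freg (1 + of_real a - of_real e) (1 + of_real b - of_real e) (1 + of_real c - of_real e) (1 + of_real d - of_real e) (2 - of_real e) (1 + of_real f - of_real e) (1 + of_real g - of_real e) =
    of_real ((\<Sum>n. Lterm a b c d e f g (1 - e + real n)) / ?G')"
    by simp
  have pos: "Gamma a > 0" "Gamma b > 0" "Gamma c > 0" "Gamma d > 0" "Gamma (1 + a - e) > 0" "Gamma (1 + b - e) > 0" "Gamma (1 + c - e) > 0" "Gamma (1 + d - e) > 0"
    using assms by auto
  show ?thesis
    unfolding Lnum_def 3 Freg_of_real[OF assms(1-5,7-9)] 2 Lreal_def
    using pos by (simp only: of_real_mult[symmetric] of_real_diff[symmetric] of_real_eq_iff)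
      (simp add: divide_inverse mult_ac right_diff_distrib)
qed

section \<open>Two-term relations\<close>

lemma holomorphic_Lnum:
  assumes hol: "a holomorphic_on UNIV" "b holomorphic_on UNIV" "c holomorphic_on UNIV" "d holomorphic_on UNIV"
    "e holomorphic_on UNIV" "f holomorphic_on UNIV" "g holomorphic_on UNIV"
    and sum: "\<And>z. e z + f z + g z = 1 + a z + b z + c z + d z"
  shows "(\<lambda>z. Lnum (a z) (b z) (c z) (d z) (e z) (f z) (g z)) holomorphic_on UNIV"
proof -
  have s: "2 - e z + (1 + f z - e z) + (1 + g z - e z) = 1 + a z - e z + (1 + b z - e z) + (1 + c z - e z) + (1 + d z - e z) + 1"
    "e z + f z + g z = a z + b z + c z + d z + 1" for z
    using sum[of z] by algebra+
  show ?thesis unfolding Lnum_def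
    by (intro holomorphic_intros holomorphic_Freg hol s)
qed

abbreviation sn :: "complex \<Rightarrow> complex" where "sn z \<equiv> sin (of_real pi * z)"

text \<open>The Gamma factors of the two constants \<open>kap\<close> cancel against the
  denominators of \<open>Lnum\<close>, so that only their sines remain.\<close>

lemma Lnum_transformation:
  assumes "e + f + g = 1 + a + b + c + d"
  shows "sn (1 + c - d) * Lnum a b c d e f g =
    sn e * Lnum (f - d) (g - d) c (1 + c - e) (1 + c - d) (1 + a + c - e) (1 + b + c - e)"
proof -
  \<comment> \<open>Eliminating g makes the other six parameters free coordinates of the hyperplane.
    At the centre \<open>p0\<close> chosen below, g = 3/4, and the strict inequalities of
    \<open>Lreal_transformation\<close> survive changes of 1/50 in each coordinate.\<close>
  define g' where "g' = (\<lambda>p::nat \<Rightarrow> complex. 1 + p 0 + p 1 + p 2 + p 3 - p 4 - p 5)"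
  define \<Phi> where "\<Phi> = (\<lambda>p::nat \<Rightarrow> complex.
    sn (1 + p 2 - p 3) * Lnum (p 0) (p 1) (p 2) (p 3) (p 4) (p 5) (g' p) -
    sin (of_real pi * p 4) * Lnum (p 5 - p 3) (g' p - p 3) (p 2) (1 + p 2 - p 4) (1 + p 2 - p 3) (1 + p 0 + p 2 - p 4) (1 + p 1 + p 2 - p 4))"
  define p0 where "p0 = (\<lambda>i. [1/10, 1/10, 3/10, 1/2, 1/2, 3/4] ! i :: real)"
  define w where "w = (\<lambda>i. [a, b, c, d, e, f] ! i)"
  have "\<Phi> w = 0"
  proof (rule zero_if_zero_on_real_box[where \<Phi> = \<Phi> and p = p0 and n = 6 and \<epsilon> = "1/50"])
    show "(\<lambda>z. \<Phi> (\<lambda>i. u i + z * v i)) holomorphic_on UNIV" for u v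
      unfolding \<Phi>_def g'_def
      by (intro holomorphic_on_diff holomorphic_on_mult holomorphic_Lnum holomorphic_intros)
        (auto simp: algebra_simps)
    show "(1/50::real) > 0" by simp
    fix x assume x: "\<forall>i<6. \<bar>x i - p0 i\<bar> < 1/50"
    have x': "\<bar>x 0 - 1/10\<bar> < 1/50" "\<bar>x 1 - 1/10\<bar> < 1/50" "\<bar>x 2 - 3/10\<bar> < 1/50" "\<bar>x 3 - 1/2\<bar> < 1/50"
      "\<bar>x 4 - 1/2\<bar> < 1/50" "\<bar>x 5 - 3/4\<bar> < 1/50"
      using x[rule_format, of 0] x[rule_format, of 1] x[rule_format, of 2] x[rule_format, of 3] x[rule_format, of 4] x[rule_format, of 5]
      by (simp_all add: p0_def)
    define a b c d e f g where "a = x 0" and "b = x 1" and "c = x 2" and "d = x 3" and "e = x 4" and "f = x 5"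
      and "g = 1 + a + b + c + d - e - f"
    note x'' = x'[folded a_def b_def c_def d_def e_def f_def, unfolded abs_less_iff]
    have c1: "a > 0" "b > 0" "0 < e" "e < 1" "a + b < e" "c > 0" "c < d" "f > d" "g > d" "e + f + g = 1 + a + b + c + d"
      using x'' unfolding g_def by linarith+
    have 1: "Lnum (of_real a) (of_real b) (of_real c) (of_real d) (of_real e) (of_real f) (of_real g) =
      of_real (Lreal a b c d e f g / (Gamma a * Gamma b * Gamma c * Gamma d *
        (Gamma (1 + a - e) * Gamma (1 + b - e) * Gamma (1 + c - e) * Gamma (1 + d - e))))"
      by (rule Lnum_of_real) (use c1 in auto)
    have 2: "Lnum (of_real (f - d)) (of_real (g - d)) (of_real c) (of_real (1 + c - e)) (of_real (1 + c - d)) (of_real (1 + a + c - e)) (of_real (1 + b + c - e)) =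
      of_real (Lreal (f - d) (g - d) c (1 + c - e) (1 + c - d) (1 + a + c - e) (1 + b + c - e) /
        (Gamma (f - d) * Gamma (g - d) * Gamma c * Gamma (1 + c - e) *
        (Gamma (1 + (f - d) - (1 + c - d)) * Gamma (1 + (g - d) - (1 + c - d)) * Gamma (1 + c - (1 + c - d)) * Gamma (1 + (1 + c - e) - (1 + c - d)))))"
      by (rule Lnum_of_real) (use c1 x'' in auto)
    interpret h: hyp3 a b e by standard (use c1 in auto)
    interpret h': hyp3 "f - d" "g - d" "1 + c - d" by standard (use c1 in auto)
    have \<gamma>: "h'.\<gamma> = h.\<gamma>" unfolding h.\<gamma>_def h'.\<gamma>_def using c1 by simp
    have L: "h'.kap * Lreal a b c d e f g = h.kap * Lreal (f - d) (g - d) c (1 + c - e) (1 + c - d) (1 + a + c - e) (1 + b + c - e)"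
      by (rule Lreal_transformation) (use c1 in auto)
    \<comment> \<open>\<open>G1\<close> and \<open>G2\<close> are the Gamma factors in the
      numerators of the two \<open>kap\<close>; \<open>G3\<close>, from the denominators of
      \<open>Lnum\<close>, and \<open>G4\<close>, from those of \<open>kap\<close>, are common to
      both sides.\<close>
    define G1 G2 G3 G4 where "G1 = Gamma a * Gamma b * Gamma (1 + a - e) * Gamma (1 + b - e)"
      and "G2 = Gamma (f - d) * Gamma (g - d) * Gamma (1 + (f - d) - (1 + c - d)) * Gamma (1 + (g - d) - (1 + c - d))"
      and "G3 = Gamma c * Gamma d * Gamma (1 + c - e) * Gamma (1 + d - e)"
      and "G4 = pi * Gamma h.\<gamma>"
    have G0: "G1 > 0" "G2 > 0" "G3 > 0" "G4 > 0"
      unfolding G1_def G2_def G3_def G4_def using c1 x'' h.\<gamma> by (auto intro!: mult_pos_pos Gamma_real_pos)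
    have k: "h.kap = G1 * sin (pi * e) / G4" "h'.kap = G2 * sin (pi * (1 + c - d)) / G4"
      unfolding h.kap_def h'.kap_def \<gamma> G1_def G2_def G4_def by (simp_all add: mult_ac)
    have "sin (pi * (1 + c - d)) * (Lreal a b c d e f g / (G1 * G3)) =
      sin (pi * e) * (Lreal (f - d) (g - d) c (1 + c - e) (1 + c - d) (1 + a + c - e) (1 + b + c - e) / (G2 * G3))"
      using L G0 unfolding k by (simp add: field_simps)
    moreover have "Gamma a * Gamma b * Gamma c * Gamma d *
        (Gamma (1 + a - e) * Gamma (1 + b - e) * Gamma (1 + c - e) * Gamma (1 + d - e)) = G1 * G3"
      unfolding G1_def G3_def by (simp add: mult_ac)
    moreover have "Gamma (f - d) * Gamma (g - d) * Gamma c * Gamma (1 + c - e) *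
        (Gamma (1 + (f - d) - (1 + c - d)) * Gamma (1 + (g - d) - (1 + c - d)) * Gamma (1 + c - (1 + c - d)) * Gamma (1 + (1 + c - e) - (1 + c - d))) = G2 * G3"
      unfolding G2_def G3_def by (simp add: algebra_simps)
    ultimately have "complex_of_real (sin (pi * (1 + c - d))) * Lnum (of_real a) (of_real b) (of_real c) (of_real d) (of_real e) (of_real f) (of_real g) =
      complex_of_real (sin (pi * e)) * Lnum (of_real (f - d)) (of_real (g - d)) (of_real c) (of_real (1 + c - e)) (of_real (1 + c - d)) (of_real (1 + a + c - e)) (of_real (1 + b + c - e))"
      unfolding 1 2 of_real_mult[symmetric] of_real_eq_iff by simp
    moreover have "g' (\<lambda>i. of_real (x i)) = of_real g"
      by (simp add: g'_def g_def a_def b_def c_def d_def e_def f_def)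
    ultimately show "\<Phi> (\<lambda>i. of_real (x i)) = 0"
      by (simp add: \<Phi>_def a_def b_def c_def d_def e_def f_def flip: sin_of_real)
  qed
  moreover have "g' w = g" using assms by (simp add: g'_def w_def) algebra
  ultimately show ?thesis by (simp add: \<Phi>_def w_def)
qed

lemma Lnum_swap_lower: "Lnum a b c d e f g = Lnum a b c d e g f"
  by (simp add: Lnum_def Freg_def Freg_term_def mult_ac)

lemma Lnum_cycle_upper: "Lnum a b c d e f g = Lnum b c d a e f g"
  by (simp add: Lnum_def Freg_def Freg_term_def mult_ac)

lemma Freg_swap: "Freg a b c d e f g = Freg a b c d f e g"
  by (simp add: Freg_def Freg_term_def mult_ac)

lemma Lnum_flip:
  "Lnum (1 + a - e) (1 + b - e) (1 + c - e) (1 + d - e) (2 - e) (1 + f - e) (1 + g - e) = - Lnum a b c d e f g"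
  by (simp add: Lnum_def)

text \<open>Two applications of \<open>Lnum_transformation\<close>, each followed by
  \<open>Lnum_flip\<close>. Both involve a sine of a - b up to sign, one on each side, and the
  assumption \<open>ab\<close> cancels it.\<close>

lemma Lnum_dual:
  assumes sum: "e + f + g = 1 + a + b + c + d" and ab: "sn (a - b) \<noteq> 0"
  shows "sn (f - e) * Lnum a b c d g e f =
    sn g * Lnum (e - a) (e - b) (e - c) (e - d) (1 + e - f) (1 + e - g) e"
proof -
    have shift: "sn (1 + x - y) = - sn (x - y)" "sn (x - y) = - sn (y - x)" for x y
  proof -
    have "of_real pi * (1 + x - y) = of_real pi * (x - y) + of_real pi" "of_real pi * (x - y) = - (of_real pi * (y - x))"
      by (simp_all add: algebra_simps)
    note eqs = this
    show "sn (1 + x - y) = - sn (x - y)"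
      unfolding eqs(1) by (simp add: sin_add sin_of_real cos_of_real)
    show "sn (x - y) = - sn (y - x)"
      unfolding eqs(2) by (rule sin_minus)
  qed
  have "sn (1 + b - a) * Lnum d c b a g f e = sn g * Lnum (f - a) (e - a) b (1 + b - g) (1 + b - a) (1 + d + b - g) (1 + c + b - g)"
    by (rule Lnum_transformation) (use sum in algebra)
  moreover have "Lnum (f - a) (e - a) b (1 + b - g) (1 + b - a) (1 + d + b - g) (1 + c + b - g) =
     - Lnum (f - b) (e - b) a (1 + a - g) (1 + a - b) (1 + d + a - g) (1 + c + a - g)"
    using Lnum_flip[of "f - a" "1 + b - a" "e - a" b "1 + b - g" "1 + d + b - g" "1 + c + b - g"]
    by (simp add: algebra_simps)
  moreover have "Lnum (f - b) (e - b) a (1 + a - g) (1 + a - b) (1 + d + a - g) (1 + c + a - g) =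
     Lnum a (1 + a - g) (f - b) (e - b) (1 + a - b) (1 + d + a - g) (1 + c + a - g)"
    using Lnum_cycle_upper by metis
  moreover have "sn (1 + (f - b) - (e - b)) * Lnum a (1 + a - g) (f - b) (e - b) (1 + a - b) (1 + d + a - g) (1 + c + a - g) =
     sn (1 + a - b) * Lnum (1 + d + a - g - (e - b)) (1 + c + a - g - (e - b)) (f - b) (1 + (f - b) - (1 + a - b)) (1 + (f - b) - (e - b))
       (1 + a + (f - b) - (1 + a - b)) (1 + (1 + a - g) + (f - b) - (1 + a - b))"
    by (rule Lnum_transformation) (use sum in algebra)
  moreover have "Lnum (1 + d + a - g - (e - b)) (1 + c + a - g - (e - b)) (f - b) (1 + (f - b) - (1 + a - b)) (1 + (f - b) - (e - b))
       (1 + a + (f - b) - (1 + a - b)) (1 + (1 + a - g) + (f - b) - (1 + a - b)) = Lnum (f - c) (f - d) (f - b) (f - a) (1 + f - e) f (1 + f - g)"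
  proof -
    have "1 + d + a - g - (e - b) = f - c" "1 + c + a - g - (e - b) = f - d" using sum by algebra+
    thus ?thesis by (simp add: add_diff_eq)
  qed
  moreover have "Lnum (f - c) (f - d) (f - b) (f - a) (1 + f - e) f (1 + f - g) = - Lnum (e - c) (e - d) (e - b) (e - a) (1 + e - f) e (1 + e - g)"
    using Lnum_flip[of "f - c" "1 + f - e" "f - d" "f - b" "f - a" f "1 + f - g"]
    by (simp add: algebra_simps)
  moreover have "Lnum (e - c) (e - d) (e - b) (e - a) (1 + e - f) e (1 + e - g) = Lnum (e - a) (e - b) (e - c) (e - d) (1 + e - f) (1 + e - g) e"
    by (simp add: Lnum_def Freg_def Freg_term_def mult_ac)
  moreover have "Lnum d c b a g f e = Lnum a b c d g e f"
    by (simp add: Lnum_def Freg_def Freg_term_def mult_ac)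
  moreover have "sn (1 + (f - b) - (e - b)) = - sn (f - e)" "sn (1 + b - a) = sn (a - b)" "sn (1 + a - b) = - sn (a - b)"
    using shift(1)[of f e] shift(1)[of b a] shift(1)[of a b] shift(2)[of b a] by (simp_all add: add_diff_eq)
  ultimately have "sn (a - b) * (sn (f - e) * Lnum a b c d g e f) =
    sn (a - b) * (sn g * Lnum (e - a) (e - b) (e - c) (e - d) (1 + e - f) (1 + e - g) e)"
    by algebra
  thus ?thesis using ab by simp
qed

section \<open>The bilateral series\<close>

text \<open>Reciprocal Gammas on both sides keep every term entire. By reflection
  \<open>rGamma (1 - \<alpha> k - s)\<close> is Gamma at \<open>\<alpha> k + s\<close> times a sine,
  so consecutive terms have the hypergeometric ratio, the four signs cancelling.\<close>

definition rterm :: "(nat \<Rightarrow> complex) \<Rightarrow> (nat \<Rightarrow> complex) \<Rightarrow> complex \<Rightarrow> complex" where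
  "rterm \<alpha> \<beta> s = (\<Prod>k<4. rGamma (1 - \<alpha> k - s) * rGamma (\<beta> k + s))"

definition half_sum :: "(nat \<Rightarrow> complex) \<Rightarrow> (nat \<Rightarrow> complex) \<Rightarrow> complex \<Rightarrow> complex" where
  "half_sum \<alpha> \<beta> \<sigma> = (\<Sum>n. rterm \<alpha> \<beta> (\<sigma> + of_nat n))"

text \<open>The second half contains the terms at \<sigma> - 1, \<sigma> - 2, ...: by
  \<open>rterm_reflect\<close> summation towards minus infinity is a \<open>half_sum\<close> with
  reflected parameters, whose excess is again 2.\<close>

definition bilateral :: "(nat \<Rightarrow> complex) \<Rightarrow> (nat \<Rightarrow> complex) \<Rightarrow> complex \<Rightarrow> complex" where
  "bilateral \<alpha> \<beta> \<sigma> = half_sum \<alpha> \<beta> \<sigma> + half_sum (\<lambda>k. 1 - \<beta> k) (\<lambda>k. 1 - \<alpha> k) (1 - \<sigma>)"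

lemma rterm_reflect: "rterm (\<lambda>k. 1 - \<beta> k) (\<lambda>k. 1 - \<alpha> k) (- s) = rterm \<alpha> \<beta> s"
  unfolding rterm_def by (intro prod.cong refl) (simp add: mult.commute)

lemma rterm_plus1: "rterm \<alpha> \<beta> (s + 1) * (\<Prod>k<4. \<beta> k + s) = rterm \<alpha> \<beta> s * (\<Prod>k<4. \<alpha> k + s)"
proof -
  have "rGamma (1 - \<alpha> k - (s + 1)) * rGamma (\<beta> k + (s + 1)) * (\<beta> k + s) =
      - (rGamma (1 - \<alpha> k - s) * rGamma (\<beta> k + s) * (\<alpha> k + s))" for k
  proof -
    have f1: "(- \<alpha> k - s) * rGamma (1 - \<alpha> k - s) = rGamma (- \<alpha> k - s)"
      using rGamma_plus1[of "- \<alpha> k - s"] by (simp add: algebra_simps)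
    have f2: "(\<beta> k + s) * rGamma (\<beta> k + (s + 1)) = rGamma (\<beta> k + s)"
      using rGamma_plus1[of "\<beta> k + s"] by (simp add: add_ac)
    have f3: "1 - \<alpha> k - (s + 1) = - \<alpha> k - s" by simp
    show ?thesis unfolding f3 f1[symmetric] f2[symmetric] by (simp add: algebra_simps)
  qed
  hence "(\<Prod>k<4. rGamma (1 - \<alpha> k - (s + 1)) * rGamma (\<beta> k + (s + 1)) * (\<beta> k + s)) =
      (\<Prod>k<4. - (rGamma (1 - \<alpha> k - s) * rGamma (\<beta> k + s) * (\<alpha> k + s)))" by simp
  also have "\<dots> = (\<Prod>k<4. rGamma (1 - \<alpha> k - s) * rGamma (\<beta> k + s) * (\<alpha> k + s))"
    by (simp add: prod_lessThan_4)
  finally show ?thesis by (simp add: rterm_def prod.distrib)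
qed

lemma
  assumes "(\<Sum>k<4. \<beta> k) = (\<Sum>k<4. \<alpha> k) + 2"
  shows summable_half_sum: "summable (\<lambda>n. norm (rterm \<alpha> \<beta> (\<sigma> + of_nat n)))"
    and holomorphic_half_sum: "half_sum \<alpha> \<beta> holomorphic_on UNIV"
proof -
  have 1: "continuous_on UNIV (\<lambda>z. \<alpha> k + z) \<and> continuous_on UNIV (\<lambda>z. \<beta> k + z)" for k
    by (intro conjI continuous_intros)
  have 2: "(\<Sum>k<4. \<beta> k + z) = (\<Sum>k<4. \<alpha> k + z) + 2" for z
    using assms by (simp add: sum.distrib)
  have 3: "rterm \<alpha> \<beta> (z + of_nat (Suc n)) * (\<Prod>k<4. \<beta> k + z + of_nat n) =
      rterm \<alpha> \<beta> (z + of_nat n) * (\<Prod>k<4. \<alpha> k + z + of_nat n)" for n z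
    using rterm_plus1[of \<alpha> \<beta> "z + of_nat n"] by (simp add: add_ac)
  have 4: "(\<lambda>z. rterm \<alpha> \<beta> (z + of_nat n)) holomorphic_on UNIV" for n
    unfolding rterm_def by (intro holomorphic_intros)
  show "summable (\<lambda>n. norm (rterm \<alpha> \<beta> (\<sigma> + of_nat n)))"
    by (rule saalschuetz_series_holomorphic(1)[OF 1 2 3 4])
  show "half_sum \<alpha> \<beta> holomorphic_on UNIV"
    unfolding half_sum_def by (rule saalschuetz_series_holomorphic(2)[OF 1 2 3 4])
qed

lemma half_sum_plus1:
  assumes "(\<Sum>k<4. \<beta> k) = (\<Sum>k<4. \<alpha> k) + 2"
  shows "half_sum \<alpha> \<beta> \<sigma> = rterm \<alpha> \<beta> \<sigma> + half_sum \<alpha> \<beta> (\<sigma> + 1)"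
  using suminf_split_head[OF summable_norm_cancel[OF summable_half_sum[OF assms, of \<sigma>]]]
  by (simp add: half_sum_def add_ac)

lemma sum_reflect:
  assumes "(\<Sum>k<4. \<beta> k) = (\<Sum>k<(4::nat). \<alpha> k) + (2::complex)"
  shows "(\<Sum>k<4. 1 - \<alpha> k) = (\<Sum>k<(4::nat). 1 - \<beta> k) + (2::complex)"
  using assms by (simp add: sum_subtractf)

text \<open>The term at \<sigma> leaves the first half and enters the second.\<close>

lemma bilateral_plus1:
  assumes "(\<Sum>k<4. \<beta> k) = (\<Sum>k<4. \<alpha> k) + 2"
  shows "bilateral \<alpha> \<beta> (\<sigma> + 1) = bilateral \<alpha> \<beta> \<sigma>"
  using half_sum_plus1[OF assms, of \<sigma>] half_sum_plus1[OF sum_reflect[OF assms], of "- \<sigma>"]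
  by (simp add: bilateral_def rterm_reflect)

lemma holomorphic_bilateral:
  assumes "(\<Sum>k<4. \<beta> k) = (\<Sum>k<4. \<alpha> k) + 2"
  shows "bilateral \<alpha> \<beta> holomorphic_on UNIV"
proof -
  have "(half_sum (\<lambda>k. 1 - \<beta> k) (\<lambda>k. 1 - \<alpha> k) \<circ> (\<lambda>z. 1 - z)) holomorphic_on UNIV"
    by (rule holomorphic_on_compose_gen[OF _ holomorphic_half_sum[OF sum_reflect[OF assms]]]) (auto intro!: holomorphic_intros)
  thus ?thesis unfolding bilateral_def[abs_def]
    by (intro holomorphic_on_add holomorphic_half_sum[OF assms]) (simp add: o_def)
qed

section \<open>Growth of the bilateral series\<close>

text \<open>A bound independent of s whose reciprocal is summable over k; it makes the estimates
  below uniform in the half plane.\<close>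

lemma norm_plus_nat_lower_bound:
  assumes "Re s \<ge> -2" "\<bar>Im s\<bar> \<ge> 1"
  shows "((real k)\<^sup>2 + 1) / 6 \<le> (norm (s + of_nat k))\<^sup>2"
proof -
  have im: "(Im s)\<^sup>2 \<ge> 1" using assms(2) by (metis abs_le_square_iff abs_one one_power2)
  have n: "(norm (s + of_nat k))\<^sup>2 = (Re s + real k)\<^sup>2 + (Im s)\<^sup>2" by (simp add: cmod_power2)
  show ?thesis
  proof (cases "k \<ge> 2")
    case True
    hence "(real k - 2)\<^sup>2 \<le> (Re s + real k)\<^sup>2" using assms(1) by (intro power_mono) auto
    moreover have "((real k)\<^sup>2 + 1) / 6 \<le> (real k - 2)\<^sup>2 + 1"
    proof -
      \<comment> \<open>The claim amounts to 5 k^2 - 24 k + 29 >= 0, and five times this is (5 k -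
        12)^2 + 1.\<close>
      have sq: "(5 * real k - 12)\<^sup>2 = 25 * (real k)\<^sup>2 - 120 * real k + 144" "(real k - 2)\<^sup>2 = (real k)\<^sup>2 - 4 * real k + 4"
        by (simp_all add: power2_eq_square algebra_simps)
      have "0 \<le> (5 * real k - 12)\<^sup>2" by simp
      hence "0 \<le> 25 * (real k)\<^sup>2 - 120 * real k + 144" unfolding sq .
      thus ?thesis unfolding sq by simp
    qed
    ultimately show ?thesis using im unfolding n by linarith
  next
    case False
    hence "k = 0 \<or> k = 1" by auto
    hence "((real k)\<^sup>2 + 1) / 6 \<le> 1" by auto
    thus ?thesis using im unfolding n using zero_le_power2[of "Re s + real k"] by linarith
  qed
qed

text \<open>For the quotient U, (s + n)^2 U(s + n) tends to 1 as n grows. Going back from n + 1 to n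
  costs a factor at most exp(12 C / (n^2 + 1)), and the product of these factors is bounded
  independently of s.\<close>

lemma Gamma_quotient_bound:
  fixes \<alpha> \<beta> :: "nat \<Rightarrow> real"
  assumes sum: "(\<Sum>k<4. \<beta> k) = (\<Sum>k<4. \<alpha> k) + 2"
  shows "\<exists>C Y. Y \<ge> 1 \<and> C > 0 \<and> (\<forall>s. Re s \<ge> -2 \<longrightarrow> \<bar>Im s\<bar> \<ge> Y \<longrightarrow>
     norm ((\<Prod>k<4. Gamma (of_real (\<alpha> k) + s)) / (\<Prod>k<4. Gamma (of_real (\<beta> k) + s))) \<le> C / (norm s)\<^sup>2)"
proof -
  define M where "M = (\<Sum>k<4. \<bar>\<alpha> k\<bar> + \<bar>\<beta> k\<bar>)"
  have "M \<ge> 0" unfolding M_def by (intro sum_nonneg) auto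
  then obtain R C where R: "R \<ge> 1" "C > 0"
    and *: "\<And>s \<alpha> \<beta>. norm (s::complex) \<ge> R \<Longrightarrow> (\<forall>k<4. norm (\<alpha> k) \<le> M \<and> norm (\<beta> k) \<le> M) \<Longrightarrow>
      (\<Sum>k<4. \<beta> k) = (\<Sum>k<4. \<alpha> k) + 2 \<Longrightarrow>
      (\<forall>k<(4::nat). \<beta> k + s \<noteq> 0) \<and>
      norm ((\<Prod>k<4. \<alpha> k + s) / (\<Prod>k<4. \<beta> k + s) * ((s + 1) / s)\<^sup>2 - 1) \<le> C / (norm s)\<^sup>2"
    by (rule saalschuetz_ratio_approx) (rule that)
  have M: "\<bar>\<alpha> k\<bar> \<le> M" "\<bar>\<beta> k\<bar> \<le> M" if "k < 4" for k
    using member_le_sum[of k "{..<4}" "\<lambda>k. \<bar>\<alpha> k\<bar> + \<bar>\<beta> k\<bar>"] that by (auto simp: M_def)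
  \<comment> \<open>\<open>Y^2 >= 2 * C\<close> makes x = C / |s + n|^2 at most 1/2, the range in
    which (1 - x) exp(2x) >= 1 is derived.\<close>
  define Y where "Y = max R (sqrt (2 * C))"
  have Y: "Y \<ge> 1" "Y \<ge> R" using R by (auto simp: Y_def)
  have Y2: "Y\<^sup>2 \<ge> 2 * C"
  proof -
    have "(sqrt (2 * C))\<^sup>2 \<le> Y\<^sup>2" by (intro power_mono) (use R in \<open>auto simp: Y_def\<close>)
    thus ?thesis using R by simp
  qed
  define U where "U = (\<lambda>s::complex. (\<Prod>k<4. Gamma (of_real (\<alpha> k) + s)) / (\<Prod>k<4. Gamma (of_real (\<beta> k) + s)))"
  define B where "B = (\<Sum>k. 6 / ((real k)\<^sup>2 + 1))"
  have summ: "summable (\<lambda>k. 6 / ((real k)\<^sup>2 + 1))"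
  proof (rule summable_comparison_test)
    show "\<exists>N. \<forall>n\<ge>N. norm (6 / ((real n)\<^sup>2 + 1)) \<le> 6 * (1 / (real n)\<^sup>2)"
    proof (intro exI[of _ 1] allI impI)
      fix n :: nat assume "n \<ge> 1"
      hence "6 / ((real n)\<^sup>2 + 1) \<le> 6 / (real n)\<^sup>2" by (intro divide_left_mono mult_pos_pos add_pos_pos) auto
      thus "norm (6 / ((real n)\<^sup>2 + 1)) \<le> 6 * (1 / (real n)\<^sup>2)" by simp
    qed
    show "summable (\<lambda>n. 6 * (1 / (real n)\<^sup>2))"
      using inverse_power_summable[of 2, where 'a = real] by (intro summable_mult) (simp add: field_simps)
  qed
  have main: "norm (s\<^sup>2 * U s) \<le> exp (2 * C * B)" if s: "Re s \<ge> -2" "\<bar>Im s\<bar> \<ge> Y" for s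
  proof -
    have nz: "of_real x + s + of_nat n \<notin> \<int>\<^sub>\<le>\<^sub>0" for x n
    proof
      assume "of_real x + s + of_nat n \<in> \<int>\<^sub>\<le>\<^sub>0"
      hence "of_real x + s + of_nat n \<in> \<int>" using nonpos_Ints_subset_Ints by blast
      hence "Im (of_real x + s + of_nat n) = 0" by (simp add: complex_is_Int_iff)
      thus False using s Y by simp
    qed
    define v where "v = (\<lambda>n. (s + of_nat n)\<^sup>2 * U (s + of_nat n))"
    have normge: "norm (s + of_nat n) \<ge> Y" for n
      using abs_Im_le_cmod[of "s + of_nat n"] s by simp
    have step: "norm (v n) \<le> norm (v (Suc n)) * exp (2 * C * (6 / ((real n)\<^sup>2 + 1)))" for n
    proof -
      let ?s = "s + of_nat n"
      let ?q = "(\<Prod>k<4. of_real (\<alpha> k) + ?s) / (\<Prod>k<4. of_real (\<beta> k) + ?s) * ((?s + 1) / ?s)\<^sup>2"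
      define x where "x = C / (norm ?s)\<^sup>2"
      have q: "norm (?q - 1) \<le> x" and nz': "\<forall>k<4. of_real (\<beta> k) + ?s \<noteq> 0"
        using *[of ?s "\<lambda>k. of_real (\<alpha> k)" "\<lambda>k. of_real (\<beta> k)"] normge[of n] Y M sum
        by (auto simp: x_def simp flip: of_real_sum)
      have s0: "?s \<noteq> 0" using normge[of n] Y by auto
      have x: "0 \<le> x" "x \<le> 1/2"
      proof -
        have "Y\<^sup>2 \<le> (norm ?s)\<^sup>2" by (rule power_mono[OF normge]) (use Y in simp)
        hence "2 * C \<le> (norm ?s)\<^sup>2" using Y2 by linarith
        thus "x \<le> 1/2" using s0 by (simp add: x_def field_simps)
        show "0 \<le> x" using R by (simp add: x_def)
      qed
      have qn: "norm ?q \<ge> 1 - x" using q norm_triangle_ineq2[of 1 "1 - ?q"] by (simp add: norm_minus_commute)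
      have "Gamma (of_real y + ?s + 1) = (of_real y + ?s) * Gamma (of_real y + ?s)" for y
        using nz[of y n] by (intro Gamma_plus1) (simp add: add_ac)
      hence "U (?s + 1) = U ?s * ((\<Prod>k<4. of_real (\<alpha> k) + ?s) / (\<Prod>k<4. of_real (\<beta> k) + ?s))"
        by (simp add: U_def prod.distrib add.assoc[symmetric] mult_ac)
      moreover have "s + of_nat (Suc n) = ?s + 1" by simp
      ultimately have "v (Suc n) = (?s + 1)\<^sup>2 * (U ?s * ((\<Prod>k<4. of_real (\<alpha> k) + ?s) / (\<Prod>k<4. of_real (\<beta> k) + ?s)))"
        unfolding v_def by (simp only:)
      hence "v (Suc n) = v n * ?q"
        using s0 by (simp add: v_def power_divide)
      hence "norm (v (Suc n)) = norm (v n) * norm ?q" by (metis norm_mult)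
      hence "norm (v n) * (1 - x) \<le> norm (v (Suc n))"
        using mult_left_mono[OF qn, of "norm (v n)"] by (metis norm_ge_zero)
      hence "norm (v n) * ((1 - x) * exp (2 * x)) \<le> norm (v (Suc n)) * exp (2 * x)"
        by (simp add: mult.assoc[symmetric] mult_right_mono)
      moreover have "1 \<le> (1 - x) * exp (2 * x)"
      proof -
        have "(1 - x) * (1 + 2 * x) \<le> (1 - x) * exp (2 * x)"
          using x by (intro mult_left_mono exp_ge_add_one_self) auto
        moreover have "(1 - x) * (1 + 2 * x) = 1 + x * (1 - 2 * x)" by (simp add: algebra_simps)
        moreover have "x * (1 - 2 * x) \<ge> 0" using x by (intro mult_nonneg_nonneg) auto
        ultimately show ?thesis by linarith
      qed
      hence "norm (v n) * 1 \<le> norm (v n) * ((1 - x) * exp (2 * x))" by (intro mult_left_mono) auto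
      ultimately have "norm (v n) \<le> norm (v (Suc n)) * exp (2 * x)" by linarith
      also have "\<dots> \<le> norm (v (Suc n)) * exp (2 * C * (6 / ((real n)\<^sup>2 + 1)))"
      proof -
        have "((real n)\<^sup>2 + 1) / 6 \<le> (norm ?s)\<^sup>2"
          by (rule norm_plus_nat_lower_bound) (use s Y in auto)
        hence "C / (norm ?s)\<^sup>2 \<le> C / (((real n)\<^sup>2 + 1) / 6)"
          using R s0 by (intro divide_left_mono mult_pos_pos) (auto simp: add_nonneg_pos)
        hence "2 * x \<le> 2 * C * (6 / ((real n)\<^sup>2 + 1))" by (simp add: x_def)
        thus ?thesis by (intro mult_left_mono) auto
      qed
      finally show ?thesis .
    qed
    have "norm (v 0) \<le> norm (v n) * exp (2 * C * (\<Sum>k<n. 6 / ((real k)\<^sup>2 + 1)))" for n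
    proof (induction n)
      case (Suc n)
      have "norm (v n) * exp (2 * C * (\<Sum>k<n. 6 / ((real k)\<^sup>2 + 1))) \<le>
        norm (v (Suc n)) * exp (2 * C * (6 / ((real n)\<^sup>2 + 1))) * exp (2 * C * (\<Sum>k<n. 6 / ((real k)\<^sup>2 + 1)))"
        by (intro mult_right_mono step) auto
      also have "\<dots> = norm (v (Suc n)) * exp (2 * C * (\<Sum>k<Suc n. 6 / ((real k)\<^sup>2 + 1)))"
        by (simp add: distrib_left exp_add mult_ac)
      finally show ?case using Suc by linarith
    qed auto
    moreover have "norm (v n) * exp (2 * C * (\<Sum>k<n. 6 / ((real k)\<^sup>2 + 1))) \<le> norm (v n) * exp (2 * C * B)" for n
    proof -
      have "(\<Sum>k<n. 6 / ((real k)\<^sup>2 + 1)) \<le> B" unfolding B_def by (rule sum_le_suminf[OF summ]) auto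
      thus ?thesis using R by (intro mult_left_mono) auto
    qed
    ultimately have le: "norm (v 0) \<le> norm (v n) * exp (2 * C * B)" for n by (meson order_trans)
    let ?f = "\<lambda>n. (\<Prod>i<4. Gamma (of_real (\<alpha> i) + s + of_nat (Suc n))) / (\<Prod>i<4. Gamma (of_real (\<beta> i) + s + of_nat (Suc n)))
       * exp (((\<Sum>i<4. of_real (\<beta> i) + s) - (\<Sum>i<4. of_real (\<alpha> i) + s)) * of_real (ln (real n)))"
    have "?f \<longlonglongrightarrow> 1"
      by (rule Gamma_quotient_asymptotics) (use nz[of _ 0] in auto)
    moreover have "(\<lambda>n. ((s + 1) / of_nat n + 1)\<^sup>2) \<longlonglongrightarrow> (0 + 1)\<^sup>2"
      by (intro tendsto_intros tendsto_divide_0[OF tendsto_const] tendsto_of_nat)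
    ultimately have "(\<lambda>n. ?f n * ((s + 1) / of_nat n + 1)\<^sup>2) \<longlonglongrightarrow> 1 * (0 + 1)\<^sup>2"
      by (rule tendsto_mult)
    moreover have "\<forall>\<^sub>F n in sequentially. ?f n * ((s + 1) / of_nat n + 1)\<^sup>2 = v (Suc n)"
      using eventually_gt_at_top[of 0]
    proof eventually_elim
      case (elim n)
      have "(\<Sum>i<4. complex_of_real (\<beta> i) + s) - (\<Sum>i<4. of_real (\<alpha> i) + s) = of_real ((\<Sum>k<4. \<beta> k) - (\<Sum>k<4. \<alpha> k))"
        by (simp add: sum.distrib)
      hence e: "exp (((\<Sum>i<4. complex_of_real (\<beta> i) + s) - (\<Sum>i<4. of_real (\<alpha> i) + s)) * of_real (ln (real n))) = (of_nat n)\<^sup>2"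
        using sum elim by (simp add: exp_double exp_of_real)
      have "(complex_of_nat n)\<^sup>2 * ((s + 1) / of_nat n + 1)\<^sup>2 = (of_nat n * ((s + 1) / of_nat n + 1))\<^sup>2"
        by (rule power_mult_distrib[symmetric])
      also have "of_nat n * ((s + 1) / of_nat n + 1) = s + of_nat (Suc n)" using elim by (simp add: field_simps)
      finally have "(complex_of_nat n)\<^sup>2 * ((s + 1) / of_nat n + 1)\<^sup>2 = (s + of_nat (Suc n))\<^sup>2" .
      thus ?case unfolding e v_def U_def by (simp add: add.assoc mult_ac)
    qed
    ultimately have "(\<lambda>n. v (Suc n)) \<longlonglongrightarrow> 1" by (auto dest: Lim_transform_eventually)
    hence "(\<lambda>n. norm (v (Suc n)) * exp (2 * C * B)) \<longlonglongrightarrow> norm (1::complex) * exp (2 * C * B)"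
      by (intro tendsto_intros)
    hence "norm (v 0) \<le> norm (1::complex) * exp (2 * C * B)"
      by (rule LIMSEQ_le_const) (use le in auto)
    thus ?thesis by (simp add: v_def)
  qed
  show ?thesis
  proof (rule exI[of _ "exp (2 * C * B)"], rule exI[of _ Y], intro conjI allI impI)
    fix s assume s: "Re s \<ge> -2" "\<bar>Im s\<bar> \<ge> Y"
    have "s \<noteq> 0" using s Y by auto
    moreover have "norm (U s) * (norm s)\<^sup>2 \<le> exp (2 * C * B)" using main[OF s] by (simp add: norm_mult norm_power mult.commute)
    ultimately show "norm ((\<Prod>k<4. Gamma (of_real (\<alpha> k) + s)) / (\<Prod>k<4. Gamma (of_real (\<beta> k) + s))) \<le> exp (2 * C * B) / (norm s)\<^sup>2"
      unfolding U_def by (simp add: field_simps)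
  qed (use Y in auto)
qed

text \<open>The squared norms are (E + 1/E - 2 cos)/4 with E = exp(2 pi Im z). In the worst case X +
  2 <= 4 (X - 2) is needed for X = E + 1/E, that is X >= 10/3, which holds when E or 1/E is at least
  3.\<close>

lemma norm_sin_pi_le:
  fixes a b :: real and z :: complex
  assumes "\<bar>Im z\<bar> \<ge> 1"
  shows "norm (sn (of_real a + z)) \<le> 2 * norm (sn (z - of_real b))"
proof -
  define E where "E = exp (2 * (pi * Im z))"
  have E: "E > 0" by (simp add: E_def)
  have "E \<ge> 3 \<or> inverse E \<ge> 3"
  proof -
    have "3 \<le> exp (2 * (pi * t))" if "t \<ge> 1" for t
    proof -
      have "1 * 1 \<le> pi * t" using that pi_gt3 by (intro mult_mono) auto
      thus ?thesis using exp_ge_add_one_self[of "2 * (pi * t)"] by linarith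
    qed
    from this[of "Im z"] this[of "- Im z"] show ?thesis
      using assms by (auto simp: E_def exp_minus abs_if split: if_splits)
  qed
  hence E2: "E + inverse E \<ge> 10 / 3"
  proof
    assume "E \<ge> 3"
    have "E + inverse E - 10 / 3 = (E - 3) * (3 * E - 1) / (3 * E)" using E by (simp add: field_simps)
    also have "\<dots> \<ge> 0" using \<open>E \<ge> 3\<close> by (intro divide_nonneg_nonneg mult_nonneg_nonneg) auto
    finally show ?thesis by simp
  next
    assume E3: "inverse E \<ge> 3"
    define F where "F = inverse E"
    have F: "F \<ge> 3" "E = inverse F" using E3 by (simp_all add: F_def)
    have "F + inverse F - 10 / 3 = (F - 3) * (3 * F - 1) / (3 * F)" using F by (simp add: field_simps)
    also have "\<dots> \<ge> 0" using F by (intro divide_nonneg_nonneg mult_nonneg_nonneg) auto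
    finally show ?thesis using F by simp
  qed
  have lin: "n1 \<le> 4 * n2" if "n1 = (X - 2 * c1) / 4" "n2 = (X - 2 * c2) / 4" "- 1 \<le> c1" "c2 \<le> 1" "X \<ge> 10 / 3"
    for n1 n2 X c1 c2 :: real
    using that by simp
  have "(norm (sn (of_real a + z)))\<^sup>2 = (E + inverse E - 2 * cos (2 * (pi * (a + Re z)))) / 4"
    "(norm (sn (z - of_real b)))\<^sup>2 = (E + inverse E - 2 * cos (2 * (pi * (Re z - b)))) / 4"
    by (simp_all add: norm_sin_squared E_def)
  moreover have "- 1 \<le> cos (2 * (pi * (a + Re z)))" "cos (2 * (pi * (Re z - b))) \<le> 1" by simp_all
  ultimately have "(norm (sn (of_real a + z)))\<^sup>2 \<le> 4 * (norm (sn (z - of_real b)))\<^sup>2"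
    using E2 by (rule lin)
  also have "\<dots> = (2 * norm (sn (z - of_real b)))\<^sup>2" by (simp add: power_mult_distrib)
  finally show ?thesis by (rule power2_le_imp_le) simp
qed

text \<open>Reflection writes each term as four sines times a Gamma quotient of order |s|^(-2). The
  points \<open>\<tau>\<close> are arbitrary, so the bound can be stated with the very sines that
  will form the denominator of the integrand.\<close>

lemma half_sum_bound:
  fixes \<alpha> \<beta> \<tau> :: "nat \<Rightarrow> real"
  assumes sum: "(\<Sum>k<4. \<beta> k) = (\<Sum>k<4. \<alpha> k) + 2"
  shows "\<exists>C Y. Y \<ge> 1 \<and> C > 0 \<and> (\<forall>\<sigma>. Re \<sigma> \<ge> -2 \<longrightarrow> \<bar>Im \<sigma>\<bar> \<ge> Y \<longrightarrow>
     norm (half_sum (\<lambda>k. of_real (\<alpha> k)) (\<lambda>k. of_real (\<beta> k)) \<sigma>)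
       \<le> C * \<bar>Im \<sigma>\<bar> powr (-1/2) * (\<Prod>k<4. norm (sn (\<sigma> - of_real (\<tau> k)))))"
proof -
  let ?\<alpha> = "(\<lambda>k. of_real (\<alpha> k))"
  let ?\<beta> = "(\<lambda>k. of_real (\<beta> k))"
  obtain C Y where Y: "Y \<ge> 1" and C: "C > 0" and bnd: "\<And>s. Re s \<ge> -2 \<Longrightarrow> \<bar>Im s\<bar> \<ge> Y \<Longrightarrow>
     norm ((\<Prod>k<4. Gamma (of_real (\<alpha> k) + s)) / (\<Prod>k<4. Gamma (of_real (\<beta> k) + s))) \<le> C / (norm s)\<^sup>2"
    using Gamma_quotient_bound[OF sum] by blast
  define w where "w = (\<lambda>n. (((real n)\<^sup>2 + 1) / 6) powr (-3/4))"
  have w: "summable w"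
  proof (rule summable_comparison_test)
    show "summable (\<lambda>n. (1/6) powr (-3/4) * real n powr (-3/2))"
      by (intro summable_mult) (simp add: summable_real_powr_iff)
    show "\<exists>N. \<forall>n\<ge>N. norm (w n) \<le> (1/6) powr (-3/4) * real n powr (-3/2)"
    proof (intro exI[of _ 1] allI impI)
      fix n :: nat assume n: "n \<ge> 1"
      have "w n \<le> ((1/6) * (real n)\<^sup>2) powr (-3/4)"
        unfolding w_def using n by (intro powr_mono2') auto
      also have "\<dots> = (1/6) powr (-3/4) * ((real n)\<^sup>2) powr (-3/4)" by (rule powr_mult)
      also have "((real n)\<^sup>2) powr (-3/4) = real n powr (-3/2)"
        using n by (simp add: powr_powr flip: powr_numeral)
      finally show "norm (w n) \<le> (1/6) powr (-3/4) * real n powr (-3/2)" by (simp add: w_def)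
    qed
  qed
  define D where "D = (\<Sum>n. w n)"
  have D: "D \<ge> 0" unfolding D_def using w by (intro suminf_nonneg) (auto simp: w_def)
  define C' where "C' = (2 / pi) ^ 4 * C"
  have C': "C' > 0" using C by (simp add: C'_def)
  have main: "norm (half_sum ?\<alpha> ?\<beta> \<sigma>)
       \<le> C' * (D + 1) * \<bar>Im \<sigma>\<bar> powr (-1/2) * (\<Prod>k<4. norm (sn (\<sigma> - of_real (\<tau> k))))"
    if \<sigma>: "Re \<sigma> \<ge> -2" "\<bar>Im \<sigma>\<bar> \<ge> Y" for \<sigma>
  proof -
    define P where "P = (\<Prod>k<4. norm (sn (\<sigma> - of_real (\<tau> k))))"
    have P: "P \<ge> 0" unfolding P_def by (intro prod_nonneg) auto
    have termb: "norm (rterm ?\<alpha> ?\<beta> (\<sigma> + of_nat n)) \<le> C' * P * \<bar>Im \<sigma>\<bar> powr (-1/2) * w n" for n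
    proof -
      define s where "s = \<sigma> + of_nat n"
      have s: "Re s \<ge> -2" "\<bar>Im s\<bar> \<ge> Y" "Im s = Im \<sigma>" using \<sigma> by (simp_all add: s_def)
      have nint: "of_real x + s \<notin> \<int>" for x using s Y by (auto simp: complex_is_Int_iff)
      have fac: "rGamma (1 - of_real (\<alpha> k) - s) = sn (of_real (\<alpha> k) + s) / of_real pi * Gamma (of_real (\<alpha> k) + s)" for k
      proof -
        have "rGamma (of_real (\<alpha> k) + s) * rGamma (1 - (of_real (\<alpha> k) + s)) = sn (of_real (\<alpha> k) + s) / of_real pi"
          by (rule rGamma_reflection_complex)
        moreover have "rGamma (of_real (\<alpha> k) + s) \<noteq> 0" using nint[of "\<alpha> k"] nonpos_Ints_subset_Ints by (auto simp: rGamma_eq_zero_iff)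
        ultimately show ?thesis by (simp add: Gamma_def field_simps diff_diff_eq)
      qed
      have "rterm ?\<alpha> ?\<beta> s =
         (\<Prod>k<4. sn (of_real (\<alpha> k) + s) / of_real pi) * ((\<Prod>k<4. Gamma (of_real (\<alpha> k) + s)) / (\<Prod>k<4. Gamma (of_real (\<beta> k) + s)))"
        unfolding rterm_def fac prod_lessThan_4 by (simp add: rGamma_inverse_Gamma divide_inverse mult_ac)
      hence "norm (rterm ?\<alpha> ?\<beta> s) =
         (\<Prod>k<4. norm (sn (of_real (\<alpha> k) + s)) / pi) * norm ((\<Prod>k<4. Gamma (of_real (\<alpha> k) + s)) / (\<Prod>k<4. Gamma (of_real (\<beta> k) + s)))"
        by (simp only: norm_mult norm_divide prod_norm[symmetric] norm_of_real) simp
      \<comment> \<open>The comparison of sines allows any real shift; taking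
        \<open>\<tau> k + n\<close> removes n, since s - n = \<sigma>.\<close>
      also have "\<dots> \<le> (\<Prod>k<4. 2 * norm (sn (s - of_real (\<tau> k + real n))) / pi) * (C / (norm s)\<^sup>2)"
      proof (intro mult_mono prod_mono conjI divide_right_mono norm_sin_pi_le bnd s prod_nonneg)
        show "1 \<le> \<bar>Im s\<bar>" using s Y by auto
      qed (use C in auto)
      also have "(\<Prod>k<4. 2 * norm (sn (s - of_real (\<tau> k + real n))) / pi) = (2 / pi) ^ 4 * P"
        by (simp add: P_def s_def prod_lessThan_4 power4_eq_xxxx)
      also have "(2 / pi) ^ 4 * P * (C / (norm s)\<^sup>2) \<le> (2 / pi) ^ 4 * P * (C * (\<bar>Im \<sigma>\<bar> powr (-1/2) * w n))"
      proof (rule mult_left_mono)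
        define q where "q = (norm s)\<^sup>2"
        have q1: "((real n)\<^sup>2 + 1) / 6 \<le> q"
          unfolding q_def s_def by (rule norm_plus_nat_lower_bound) (use \<sigma> Y in auto)
        have "\<bar>Im s\<bar>\<^sup>2 \<le> (norm s)\<^sup>2" by (intro power_mono abs_Im_le_cmod) auto
        hence q2: "(Im \<sigma>)\<^sup>2 \<le> q" using s by (simp add: q_def)
        have q0: "q > 0" using q1 by (rule less_le_trans[rotated]) (simp add: add_nonneg_pos)
        \<comment> \<open>Splits |s|^(-2) into |s|^(-3/2), which is summable over n, and |s|^(-1/2),
          which yields the decay in Im \<sigma>.\<close>
        have "1 / q = q powr (-3/4) * q powr (-1/4)" using q0 by (simp add: powr_minus_divide flip: powr_add)
        also have "\<dots> \<le> w n * ((Im \<sigma>)\<^sup>2) powr (-1/4)"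
        proof (rule mult_mono)
          show "q powr (-3/4) \<le> w n"
            unfolding w_def using q1 by (intro powr_mono2') (auto simp: add_nonneg_pos)
          show "q powr (-1/4) \<le> ((Im \<sigma>)\<^sup>2) powr (-1/4)"
            using q2 \<sigma> Y by (intro powr_mono2') auto
        qed (auto simp: w_def)
        also have "((Im \<sigma>)\<^sup>2) powr (-1/4) = \<bar>Im \<sigma>\<bar> powr (-1/2)"
        proof -
          have sq: "(Im \<sigma>)\<^sup>2 = \<bar>Im \<sigma>\<bar> powr 2" using \<sigma> Y by (simp add: powr_numeral)
          show ?thesis unfolding sq powr_powr by simp
        qed
        finally have "1 / q \<le> \<bar>Im \<sigma>\<bar> powr (-1/2) * w n"
          by (simp add: mult.commute)
        hence "C * (1 / q) \<le> C * (\<bar>Im \<sigma>\<bar> powr (-1/2) * w n)" using C by (intro mult_left_mono) auto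
        thus "C / (norm s)\<^sup>2 \<le> C * (\<bar>Im \<sigma>\<bar> powr (-1/2) * w n)" by (simp add: q_def)
      qed (use P in auto)
      finally show ?thesis by (simp only: s_def C'_def mult_ac)
    qed
    have "norm (half_sum ?\<alpha> ?\<beta> \<sigma>) \<le> (\<Sum>n. C' * P * \<bar>Im \<sigma>\<bar> powr (-1/2) * w n)"
      unfolding half_sum_def by (rule norm_suminf_le[OF termb]) (rule summable_mult[OF w])
    also have "\<dots> = C' * P * \<bar>Im \<sigma>\<bar> powr (-1/2) * D" unfolding D_def by (rule suminf_mult[OF w])
    also have "\<dots> \<le> C' * P * \<bar>Im \<sigma>\<bar> powr (-1/2) * (D + 1)" using C' P by (intro mult_left_mono) auto
    finally show ?thesis by (simp add: P_def mult_ac)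
  qed
  show ?thesis
    by (rule exI[of _ "C' * (D + 1)"], rule exI[of _ Y]) (use Y C' D main in auto)
qed

lemma sin_pi_eq_0_iff: "sn z = 0 \<longleftrightarrow> z \<in> \<int>" for z :: complex
proof -
  have "sn z = 0 \<longleftrightarrow> (\<exists>n::int. of_real pi * z = of_real (real_of_int n * pi))"
    by (rule sin_eq_0)
  also have "\<dots> \<longleftrightarrow> (\<exists>n::int. z = of_int n)"
    by (simp add: mult.commute[of "complex_of_real pi"])
  finally show ?thesis by (auto simp: Ints_def)
qed

lemma sin_pi_plus1: "sn (z + 1 - w) = - sn (z - w)" for z w :: complex
proof -
  have "of_real pi * (z + 1 - w) = of_real pi * (z - w) + of_real pi" by (simp add: algebra_simps)
  thus ?thesis by (simp add: sin_add sin_of_real cos_of_real)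
qed

text \<open>The strip from -2 to 3 is invariant under z -> 1 - z, so both halves have arguments with
  real part at least -2.\<close>

lemma bilateral_bound:
  fixes \<alpha> \<beta> \<tau> :: "nat \<Rightarrow> real"
  assumes sum: "(\<Sum>k<4. \<beta> k) = (\<Sum>k<4. \<alpha> k) + 2"
  shows "\<exists>C Y. Y \<ge> 1 \<and> C > 0 \<and> (\<forall>z. Re z \<ge> -2 \<longrightarrow> Re z \<le> 3 \<longrightarrow> \<bar>Im z\<bar> \<ge> Y \<longrightarrow>
     norm (bilateral (\<lambda>k. of_real (\<alpha> k)) (\<lambda>k. of_real (\<beta> k)) z / (\<Prod>k<4. sn (z - of_real (\<tau> k))))
       \<le> C * \<bar>Im z\<bar> powr (-1/2))"
proof -
  let ?\<alpha> = "(\<lambda>k. of_real (\<alpha> k))"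
  let ?\<beta> = "(\<lambda>k. of_real (\<beta> k))"
  let ?P = "\<lambda>z. \<Prod>k<4. norm (sn (z - of_real (\<tau> k)))"
  obtain C1 Y1 where 1: "Y1 \<ge> 1" "C1 > 0" "\<And>z. Re z \<ge> -2 \<Longrightarrow> \<bar>Im z\<bar> \<ge> Y1 \<Longrightarrow>
     norm (half_sum ?\<alpha> ?\<beta> z) \<le> C1 * \<bar>Im z\<bar> powr (-1/2) * ?P z"
    using half_sum_bound[OF sum, of \<tau>] by blast
  have sum': "(\<Sum>k<4. 1 - \<alpha> k) = (\<Sum>k<4. 1 - \<beta> k) + 2" using sum by (simp add: sum_subtractf)
  obtain C2 Y2 where 2: "Y2 \<ge> 1" "C2 > 0" "\<And>z. Re z \<ge> -2 \<Longrightarrow> \<bar>Im z\<bar> \<ge> Y2 \<Longrightarrow>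
     norm (half_sum (\<lambda>k. of_real (1 - \<beta> k)) (\<lambda>k. of_real (1 - \<alpha> k)) z) \<le> C2 * \<bar>Im z\<bar> powr (-1/2) *
       (\<Prod>k<4. norm (sn (z - of_real (1 - \<tau> k))))"
    using half_sum_bound[OF sum', of "\<lambda>k. 1 - \<tau> k"] by blast
  show ?thesis
  proof (rule exI[of _ "C1 + C2"], rule exI[of _ "max Y1 Y2"], intro conjI allI impI)
    fix z assume z: "Re z \<ge> -2" "Re z \<le> 3" "\<bar>Im z\<bar> \<ge> max Y1 Y2"
    have "norm (sn (1 - z - of_real (1 - \<tau> k))) = norm (sn (z - of_real (\<tau> k)))" for k
    proof -
      have "of_real pi * (1 - z - of_real (1 - \<tau> k)) = - (of_real pi * (z - of_real (\<tau> k)))" by (simp add: algebra_simps)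
      thus ?thesis by (simp only: sin_minus norm_minus_cancel)
    qed
    moreover have "(\<lambda>k. complex_of_real (1 - \<beta> k)) = (\<lambda>k. 1 - of_real (\<beta> k))" "(\<lambda>k. complex_of_real (1 - \<alpha> k)) = (\<lambda>k. 1 - of_real (\<alpha> k))"
      by auto
    ultimately have h2: "norm (half_sum (\<lambda>k. 1 - of_real (\<beta> k)) (\<lambda>k. 1 - of_real (\<alpha> k)) (1 - z)) \<le> C2 * \<bar>Im z\<bar> powr (-1/2) * ?P z"
      using 2(3)[of "1 - z"] z by simp
    have h1: "norm (half_sum ?\<alpha> ?\<beta> z) \<le> C1 * \<bar>Im z\<bar> powr (-1/2) * ?P z"
      using 1(3)[of z] z by simp
    have "norm (bilateral ?\<alpha> ?\<beta> z) \<le> C1 * \<bar>Im z\<bar> powr (-1/2) * ?P z + C2 * \<bar>Im z\<bar> powr (-1/2) * ?P z"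
      unfolding bilateral_def by (rule norm_triangle_le[OF add_mono[OF h1 h2]])
    hence le: "norm (bilateral ?\<alpha> ?\<beta> z) \<le> (C1 + C2) * \<bar>Im z\<bar> powr (-1/2) * ?P z"
      by (simp add: algebra_simps)
    have "sn (z - of_real (\<tau> k)) \<noteq> 0" for k
      unfolding sin_pi_eq_0_iff using z 1(1) by (auto simp: complex_is_Int_iff)
    hence "?P z > 0" by (intro prod_pos) auto
    thus "norm (bilateral ?\<alpha> ?\<beta> z / (\<Prod>k<4. sn (z - of_real (\<tau> k))))
       \<le> (C1 + C2) * \<bar>Im z\<bar> powr (-1/2)"
      using le by (simp add: norm_divide prod_norm[symmetric] pos_divide_le_eq)
  qed (use 1 2 in auto)
qed

text \<open>The integrand is 1-periodic, so in the residue theorem on the rectangle over one period the vertical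
  sides cancel, while the horizontal ones vanish in the limit.\<close>

lemma bilateral_four_term:
  fixes \<alpha> \<beta> \<tau> :: "nat \<Rightarrow> real"
  assumes sum: "(\<Sum>k<4. \<beta> k) = (\<Sum>k<4. \<alpha> k) + 2"
    and inj: "inj_on \<tau> {..<4}" and \<tau>: "\<And>k. k < 4 \<Longrightarrow> x0 < \<tau> k \<and> \<tau> k < x0 + 1" and x0: "-2 \<le> x0" "x0 \<le> 2"
  shows "(\<Sum>i<4. bilateral (\<lambda>k. of_real (\<alpha> k)) (\<lambda>k. of_real (\<beta> k)) (of_real (\<tau> i)) /
    (\<Prod>j\<in>{..<4} - {i}. sn (of_real (\<tau> i) - of_real (\<tau> j)))) = 0"
proof -
  define F where "F = bilateral (\<lambda>k. of_real (\<alpha> k)) (\<lambda>k. of_real (\<beta> k))"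
  have csum: "(\<Sum>k<4. complex_of_real (\<beta> k)) = (\<Sum>k<4. of_real (\<alpha> k)) + 2"
    using sum by (simp flip: of_real_sum)
  have holF: "F holomorphic_on X" for X
    unfolding F_def by (rule holomorphic_on_subset[OF holomorphic_bilateral[OF csum]]) auto
  have perF: "F (z + 1) = F z" for z unfolding F_def by (rule bilateral_plus1[OF csum])
  define P where "P = (\<lambda>z. \<Prod>k<4. sn (z - complex_of_real (\<tau> k)))"
  define \<Psi> where "\<Psi> = (\<lambda>z. F z / P z)"
  have per: "\<Psi> (z + 1) = \<Psi> z" for z
    by (simp add: \<Psi>_def P_def perF prod_lessThan_4 sin_pi_plus1)
  \<comment> \<open>Distance of the \<open>\<tau> k\<close> from the ends of the interval. The strip
    widened by \<open>\<eta>\<close> contains the closed rectangles but no translate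
    \<open>\<tau> k + m\<close> with m nonzero.\<close>
  define \<eta> where "\<eta> = Min ((\<lambda>k. min (\<tau> k - x0) (x0 + 1 - \<tau> k)) ` {..<4})"
  have \<eta>: "\<eta> > 0" "\<And>k. k < 4 \<Longrightarrow> x0 + \<eta> \<le> \<tau> k \<and> \<tau> k \<le> x0 + 1 - \<eta>"
  proof -
    have "0 \<in> {..<4::nat}" by simp
    hence "(\<lambda>k. min (\<tau> k - x0) (x0 + 1 - \<tau> k)) ` {..<4} \<noteq> {}" by blast
    thus "\<eta> > 0" unfolding \<eta>_def using \<tau> by (subst Min_gr_iff) auto
    fix k :: nat assume "k < 4"
    hence "\<eta> \<le> min (\<tau> k - x0) (x0 + 1 - \<tau> k)" unfolding \<eta>_def by (intro Min_le) auto
    thus "x0 + \<eta> \<le> \<tau> k \<and> \<tau> k \<le> x0 + 1 - \<eta>" by auto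
  qed
  define pts where "pts = complex_of_real ` \<tau> ` {..<4}"
  define S where "S = {z. Re z > x0 - \<eta>} \<inter> {z. Re z < x0 + 1 + \<eta>}"
  have S: "open S" "connected S" unfolding S_def
    by (auto intro!: open_Int open_halfspace_Re_gt open_halfspace_Re_lt convex_connected convex_Int convex_halfspace_Re_gt convex_halfspace_Re_lt)
  have Pnz: "P z \<noteq> 0" if "z \<in> S - pts" for z
  proof
    assume "P z = 0"
    then obtain k where k: "k < 4" "sn (z - complex_of_real (\<tau> k)) = 0" unfolding P_def by auto
    hence "z - of_real (\<tau> k) \<in> \<int>" by (simp only: sin_pi_eq_0_iff)
    then obtain m :: int where m: "z - of_real (\<tau> k) = of_int m" by (auto simp: Ints_def)
    hence z: "z = of_real (\<tau> k) + of_int m" by (simp add: algebra_simps)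
    hence "Re z = \<tau> k + of_int m" by simp
    hence "real_of_int m < 1" "real_of_int m > -1" using that \<eta>(2)[OF k(1)] by (auto simp: S_def)
    hence "m = 0" by linarith
    thus False using z that k by (auto simp: pts_def)
  qed
  have hol: "\<Psi> holomorphic_on S - pts"
    unfolding \<Psi>_def using Pnz by (intro holomorphic_on_divide holF) (auto simp: P_def intro!: holomorphic_intros)
  define c where "c = (\<lambda>i. F (of_real (\<tau> i)) / (of_real pi * (\<Prod>j\<in>{..<4} - {i}. sn (of_real (\<tau> i) - of_real (\<tau> j)))))"
  have res: "residue \<Psi> (of_real (\<tau> i)) = c i" if i: "i < 4" for i
  proof (rule residue_simple')
    let ?z = "complex_of_real (\<tau> i)"
    show "open (S - (pts - {?z}))" using S by (intro open_Diff finite_imp_closed) (auto simp: pts_def)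
    show "?z \<in> S - (pts - {?z})" using \<eta>(1) \<eta>(2)[OF i] by (auto simp: S_def)
    show "\<Psi> holomorphic_on S - (pts - {?z}) - {?z}" by (rule holomorphic_on_subset[OF hol]) auto
    have Pi: "P w = sn (w - ?z) * (\<Prod>j\<in>{..<4} - {i}. sn (w - of_real (\<tau> j)))" for w
      unfolding P_def using i by (subst prod.remove[of _ i]) auto
    \<comment> \<open>Distinct points of an open interval of length 1 do not differ by an integer,
      so the other three sines do not vanish.\<close>
    have nz: "(\<Prod>j\<in>{..<4} - {i}. sn (?z - of_real (\<tau> j))) \<noteq> 0"
    proof
      assume "(\<Prod>j\<in>{..<4} - {i}. sn (?z - of_real (\<tau> j))) = 0"
      then obtain j where j: "j < 4" "j \<noteq> i" "sn (?z - of_real (\<tau> j)) = 0" by auto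
      hence "?z - of_real (\<tau> j) \<in> \<int>" by (simp only: sin_pi_eq_0_iff)
      then obtain m :: int where m: "?z - of_real (\<tau> j) = of_int m" by (auto simp: Ints_def)
      hence "Re (?z - of_real (\<tau> j)) = Re (of_int m)" by (simp only:)
      hence m': "\<tau> i - \<tau> j = of_int m" by simp
      hence "real_of_int m < 1" "real_of_int m > -1" using \<tau>[OF i] \<tau>[OF j(1)] by auto
      hence "m = 0" by linarith
      hence "\<tau> i = \<tau> j" using m' by simp
      thus False using inj_onD[OF inj] i j by auto
    qed
    have "((\<lambda>w. sn (w - ?z)) has_field_derivative of_real pi) (at ?z)"
      by (auto intro!: derivative_eq_intros)
    hence "((\<lambda>w. sn (w - ?z) / (w - ?z)) \<longlongrightarrow> of_real pi) (at ?z)"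
      by (simp add: has_field_derivative_iff)
    hence l1: "((\<lambda>w. inverse (sn (w - ?z) / (w - ?z))) \<longlongrightarrow> inverse (of_real pi)) (at ?z)"
      by (rule tendsto_inverse) auto
    have "isCont (\<lambda>w. F w / (\<Prod>j\<in>{..<4} - {i}. sn (w - of_real (\<tau> j)))) ?z"
    proof (intro continuous_intros nz)
      show "isCont F ?z" using holomorphic_on_imp_continuous_on[OF holF[of UNIV]] by (simp add: continuous_on_eq_continuous_at)
    qed
    hence l2: "((\<lambda>w. F w / (\<Prod>j\<in>{..<4} - {i}. sn (w - of_real (\<tau> j)))) \<longlongrightarrow>
        F ?z / (\<Prod>j\<in>{..<4} - {i}. sn (?z - of_real (\<tau> j)))) (at ?z)"
      by (simp add: isCont_def)
    have "((\<lambda>w. inverse (sn (w - ?z) / (w - ?z)) * (F w / (\<Prod>j\<in>{..<4} - {i}. sn (w - of_real (\<tau> j))))) \<longlongrightarrow>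
        inverse (of_real pi) * (F ?z / (\<Prod>j\<in>{..<4} - {i}. sn (?z - of_real (\<tau> j))))) (at ?z)"
      by (rule tendsto_mult[OF l1 l2])
    moreover have "inverse (sn (w - ?z) / (w - ?z)) * (F w / (\<Prod>j\<in>{..<4} - {i}. sn (w - of_real (\<tau> j)))) = \<Psi> w * (w - ?z)" for w
      by (simp add: \<Psi>_def Pi divide_inverse mult_ac)
    moreover have "inverse (of_real pi) * (F ?z / (\<Prod>j\<in>{..<4} - {i}. sn (?z - of_real (\<tau> j)))) = c i"
      by (simp add: c_def divide_inverse mult_ac)
    ultimately show "((\<lambda>w. \<Psi> w * (w - ?z)) \<longlongrightarrow> c i) (at ?z)" by simp
  qed
  obtain C Y where Y: "Y \<ge> 1" "C > 0" and bnd: "\<And>z. Re z \<ge> -2 \<Longrightarrow> Re z \<le> 3 \<Longrightarrow> \<bar>Im z\<bar> \<ge> Y \<Longrightarrow> norm (\<Psi> z) \<le> C * \<bar>Im z\<bar> powr (-1/2)"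
    using bilateral_bound[OF sum, of \<tau>] unfolding \<Psi>_def F_def P_def by blast
  have key: "norm (2 * pi * \<i> * (\<Sum>i<4. c i)) \<le> 2 * C * y powr (-1/2)" if y: "y \<ge> Y" for y
  proof -
    define a1 a2 a3 a4 where "a1 = Complex x0 (-y)" and "a2 = Complex (x0 + 1) (-y)" and "a3 = Complex (x0 + 1) y" and "a4 = Complex x0 y"
    have y0: "y > 0" using y Y by linarith
    have rect: "rectpath a1 a3 = linepath a1 a2 +++ linepath a2 a3 +++ linepath a3 a4 +++ linepath a4 a1"
      by (simp add: rectpath_def Let_def a1_def a2_def a3_def a4_def)
    have sub: "cbox a1 a3 \<subseteq> S" using \<eta>(1) by (auto simp: in_cbox_complex_iff a1_def a3_def S_def)
    have ptsbox: "pts \<subseteq> box a1 a3" using \<tau> y0 by (auto simp: in_box_complex_iff a1_def a3_def pts_def)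
    have img: "path_image (rectpath a1 a3) \<subseteq> S - pts"
      using path_image_rectpath_subset_cbox[of a1 a3] path_image_rectpath_inter_box[of a1 a3] sub ptsbox y0
      by (fastforce simp: a1_def a3_def)
    have "contour_integral (rectpath a1 a3) \<Psi> = 2 * pi * \<i> * (\<Sum>p\<in>pts. winding_number (rectpath a1 a3) p * residue \<Psi> p)"
    proof (rule Residue_theorem[OF S _ hol _ _ img])
      show "\<forall>z. z \<notin> S \<longrightarrow> winding_number (rectpath a1 a3) z = 0"
        using sub y0 by (auto intro!: winding_number_rectpath_outside simp: a1_def a3_def)
    qed (auto simp: pts_def)
    also have "(\<Sum>p\<in>pts. winding_number (rectpath a1 a3) p * residue \<Psi> p) = (\<Sum>p\<in>pts. residue \<Psi> p)"
      using ptsbox by (intro sum.cong) (auto simp: winding_number_rectpath)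
    also have "\<dots> = (\<Sum>i<4. residue \<Psi> (of_real (\<tau> i)))"
      unfolding pts_def image_image using inj by (subst sum.reindex) (auto simp: inj_on_def)
    also have "\<dots> = (\<Sum>i<4. c i)" using res by (intro sum.cong) auto
    finally have I: "contour_integral (rectpath a1 a3) \<Psi> = 2 * pi * \<i> * (\<Sum>i<4. c i)" .
    have "\<Psi> contour_integrable_on (rectpath a1 a3)"
      by (rule contour_integrable_holomorphic_simple[OF hol _ _ img]) (use S in \<open>auto simp: pts_def intro!: open_Diff finite_imp_closed\<close>)
    hence int: "\<Psi> contour_integrable_on linepath a1 a2" "\<Psi> contour_integrable_on linepath a2 a3"
      "\<Psi> contour_integrable_on linepath a3 a4" "\<Psi> contour_integrable_on linepath a4 a1"
      unfolding rect by simp_all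
    have "contour_integral (rectpath a1 a3) \<Psi> = contour_integral (linepath a1 a2) \<Psi> + (contour_integral (linepath a2 a3) \<Psi>
        + (contour_integral (linepath a3 a4) \<Psi> + contour_integral (linepath a4 a1) \<Psi>))"
      unfolding rect using int by simp
    moreover have "contour_integral (linepath a2 a3) \<Psi> = - contour_integral (linepath a4 a1) \<Psi>"
    proof -
      have "linepath a2 a3 = (+) 1 \<circ> linepath a1 a4"
        by (auto simp: fun_eq_iff linepath_def a1_def a2_def a3_def a4_def complex_eq_iff algebra_simps)
      hence "contour_integral (linepath a2 a3) \<Psi> = contour_integral (linepath a1 a4) (\<lambda>z. \<Psi> (z + 1))"
        by (simp only: contour_integral_translate)
      also have "\<dots> = contour_integral (linepath a1 a4) \<Psi>" by (simp only: per)
      also have "\<dots> = - contour_integral (linepath a4 a1) \<Psi>"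
        using contour_integral_reversepath[of "linepath a4 a1" \<Psi>] by simp
      finally show ?thesis .
    qed
    ultimately have eq: "contour_integral (rectpath a1 a3) \<Psi> = contour_integral (linepath a1 a2) \<Psi> + contour_integral (linepath a3 a4) \<Psi>"
      by simp
    have B: "norm (contour_integral (linepath p q) \<Psi>) \<le> C * y powr (-1/2) * norm (q - p)"
      if "\<Psi> contour_integrable_on linepath p q" "\<And>z. z \<in> closed_segment p q \<Longrightarrow> Re z \<ge> x0 \<and> Re z \<le> x0 + 1 \<and> \<bar>Im z\<bar> = y" for p q
    proof (rule contour_integral_bound_linepath[OF that(1)])
      fix z assume "z \<in> closed_segment p q"
      from that(2)[OF this] show "norm (\<Psi> z) \<le> C * y powr (-1/2)" using bnd[of z] x0 y by auto
    qed (use Y in auto)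
    have "norm (contour_integral (linepath a1 a2) \<Psi>) \<le> C * y powr (-1/2) * norm (a2 - a1)"
      by (rule B[OF int(1)]) (use y0 in \<open>auto simp: a1_def a2_def closed_segment_same_Im closed_segment_eq_real_ivl\<close>)
    moreover have "norm (contour_integral (linepath a3 a4) \<Psi>) \<le> C * y powr (-1/2) * norm (a4 - a3)"
      by (rule B[OF int(3)]) (use y0 in \<open>auto simp: a3_def a4_def closed_segment_same_Im closed_segment_eq_real_ivl\<close>)
    moreover have "norm (a2 - a1) = 1" "norm (a4 - a3) = 1"
      by (simp_all add: a1_def a2_def a3_def a4_def cmod_def)
    ultimately have "norm (contour_integral (rectpath a1 a3) \<Psi>) \<le> C * y powr (-1/2) + C * y powr (-1/2)"
      unfolding eq by (intro norm_triangle_le add_mono) simp_all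
    thus ?thesis unfolding I by simp
  qed
  have "((\<lambda>y. 2 * C * y powr (-1/2)) \<longlongrightarrow> 2 * C * 0) at_top"
    by (intro tendsto_mult tendsto_const tendsto_neg_powr) (auto intro: filterlim_ident)
  hence "norm (2 * pi * \<i> * (\<Sum>i<4. c i)) \<le> 2 * C * 0"
    by (rule tendsto_lowerbound) (use key in \<open>auto simp: eventually_at_top_linorder\<close>)
  hence "(\<Sum>i<4. c i) = 0" by simp
  moreover have "(\<Sum>i<4. c i) = (\<Sum>i<4. F (of_real (\<tau> i)) / (\<Prod>j\<in>{..<4} - {i}. sn (of_real (\<tau> i) - of_real (\<tau> j)))) / of_real pi"
    by (simp add: c_def sum_divide_distrib mult.commute)
  ultimately show ?thesis by (simp add: F_def)
qed

section \<open>The three-term relation\<close>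

lemma trig_1:
  fixes b c d f g :: complex
  shows "sin (f - g) * (sin b * sin c * sin d - sin (b + c + d - f - g) * sin f * sin g) =
    sin (f - b) * sin (f - c) * sin (f - d) * sin g - sin (g - b) * sin (g - c) * sin (g - d) * sin f"
proof -
  have "(cos f)\<^sup>2 = 1 - (sin f)\<^sup>2" "(cos g)\<^sup>2 = 1 - (sin g)\<^sup>2" by (simp_all add: cos_squared_eq)
  thus ?thesis unfolding sin_add sin_diff cos_add cos_diff by algebra
qed
lemma trig_2_aux:
  fixes b c d f g :: complex
  shows "sin b * sin (g - c) * sin (g - d) - sin (c + d - f - g) * sin g * sin (f - b) =
    sin b * sin c * sin d - sin (b + c + d - f - g) * sin f * sin g"
proof -
  have "(cos f)\<^sup>2 = 1 - (sin f)\<^sup>2" "(cos g)\<^sup>2 = 1 - (sin g)\<^sup>2" by (simp_all add: cos_squared_eq)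
  thus ?thesis unfolding sin_add sin_diff cos_add cos_diff by algebra
qed

text \<open>Every argument is a combination of differences from \<open>a\<close>, so translation by
  \<open>a\<close> reduces the claim to \<open>trig_2_aux\<close>.\<close>

lemma trig_2:
  fixes a b c d f g :: complex
  shows "sin (b - a) * sin (g - c) * sin (g - d) - sin (c + d - f - g) * sin (g - a) * sin (f - b) =
    sin (b - a) * sin (c - a) * sin (d - a) - sin (b + c + d - a - f - g) * sin (f - a) * sin (g - a)"
proof -
  have "b + c + d - a - f - g = (b - a) + (c - a) + (d - a) - (f - a) - (g - a)"
    "g - c = (g - a) - (c - a)" "g - d = (g - a) - (d - a)" "f - b = (f - a) - (b - a)"
    "c + d - f - g = (c - a) + (d - a) - (f - a) - (g - a)" by simp_all
  thus ?thesis using trig_2_aux[of "b - a" "g - a" "c - a" "d - a" "f - a"] by (simp only:)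
qed

lemma sn_plus1: "sn (1 + z) = - sn z"
  using sin_pi_plus1[of z 0] by (simp add: add.commute)

lemma sn_minus: "sn (- z) = - sn z" "sn (x - y) = - sn (y - x)"
proof -
  show "sn (- z) = - sn z" for z by simp
  from this[of "y - x"] show "sn (x - y) = - sn (y - x)" by simp
qed

lemma sn_nonzero:
  assumes "z \<in> \<real>" "- 1 < Re z" "Re z < 1" "Re z \<noteq> 0"
  shows "sn z \<noteq> 0"
proof
  assume "sn z = 0"
  then obtain n :: int where n: "z = of_int n" unfolding sin_pi_eq_0_iff by (auto simp: Ints_def)
  hence "- 1 < real_of_int n" "real_of_int n < 1" using assms by simp_all
  hence "n = 0" by linarith
  thus False using assms n by simp
qed

text \<open>On the hyperplane e - a = 1 + (b + c + d - f - g). The identity matches the coefficients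
  of the value at 0 once the value at -a has been eliminated.\<close>

lemma sn_trig_1:
  assumes "e + f + g = 1 + a + b + c + d"
  shows "sn (f - g) * (sn (e - a) * sn f * sn g + sn b * sn c * sn d) =
    sn (f - b) * sn (f - c) * sn (f - d) * sn g - sn (g - b) * sn (g - c) * sn (g - d) * sn f"
proof -
  have "e - a = 1 + (b + c + d - f - g)" using assms by algebra
  hence "sn (e - a) = - sn (b + c + d - f - g)" by (simp only: sn_plus1)
  thus ?thesis
    using trig_1[of "of_real pi * f" "of_real pi * g" "of_real pi * b" "of_real pi * c" "of_real pi * d"]
    by (simp add: algebra_simps)
qed

text \<open>Origin of the bracket in \<open>B5\<close>: the summands on the left are the sine
  factors contributed by \<open>K_p0\<close> and \<open>K_n4\<close>.\<close>

lemma sn_trig_2: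
  assumes "e + f + g = 1 + a + b + c + d"
  shows "sn (e - a - b) * sn (g - a) * sn (f - b) + sn (b - a) * sn (g - c) * sn (g - d) =
    sn (b - a) * sn (c - a) * sn (d - a) + sn (e - 2 * a) * sn (f - a) * sn (g - a)"
proof -
  have "e - a - b = 1 + (c + d - f - g)" "e - 2 * a = 1 + (b + c + d - a - f - g)" using assms by algebra+
  hence "sn (e - a - b) = - sn (c + d - f - g)" "sn (e - 2 * a) = - sn (b + c + d - a - f - g)" by (simp_all only: sn_plus1)
  thus ?thesis
    using trig_2[of "of_real pi * b" "of_real pi * a" "of_real pi * g" "of_real pi * c" "of_real pi * d" "of_real pi * f"]
    by (simp add: algebra_simps)
qed

section \<open>Values of the bilateral series\<close>

definition bilateral4 :: "complex \<Rightarrow> complex \<Rightarrow> complex \<Rightarrow> complex \<Rightarrow> complex \<Rightarrow> complex \<Rightarrow> complex \<Rightarrow> complex \<Rightarrow> complex" where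
  "bilateral4 a b c d e f g = bilateral (\<lambda>k. [a, b, c, d] ! k) (\<lambda>k. [1, e, f, g] ! k)"

lemma bilateral_shift: "bilateral \<alpha> \<beta> (\<sigma> + s) = bilateral (\<lambda>k. \<alpha> k + s) (\<lambda>k. \<beta> k + s) \<sigma>"
  unfolding bilateral_def half_sum_def rterm_def by (simp add: algebra_simps)

lemma bilateral_reflect: "bilateral (\<lambda>k. 1 - \<beta> k) (\<lambda>k. 1 - \<alpha> k) (1 - \<sigma>) = bilateral \<alpha> \<beta> \<sigma>"
  by (simp add: bilateral_def add.commute)

lemma rGamma_diff_nat: "rGamma (1 - a - of_nat n) = (-1) ^ n * pochhammer a n * rGamma (1 - a)" for a :: complex
proof (induction n)
  case (Suc n)
  have "rGamma (1 - a - of_nat (Suc n)) = (- a - of_nat n) * rGamma (1 - a - of_nat n)"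
    using rGamma_plus1[of "- a - of_nat n"] by (simp add: algebra_simps)
  thus ?case using Suc by (simp add: pochhammer_Suc algebra_simps)
qed auto

text \<open>The lower parameter 1 gives a factor that vanishes at every negative index, so the
  series becomes one-sided at 0. The signs (-1)^n of the four upper factors cancel.\<close>

lemma bilateral4_0:
  "bilateral4 a b c d e f g 0 = rGamma (1 - a) * rGamma (1 - b) * rGamma (1 - c) * rGamma (1 - d) * Freg a b c d e f g"
  if "e + f + g = 1 + a + b + c + d"
proof -
  let ?G = "rGamma (1 - a) * rGamma (1 - b) * rGamma (1 - c) * rGamma (1 - d)"
  have 1: "rterm (\<lambda>k. [a, b, c, d] ! k) (\<lambda>k. [1, e, f, g] ! k) (of_nat n) = ?G * Freg_term a b c d e f g n" for n
  proof -
    have "(-1) ^ n * (-1) ^ n = (1::complex)" by (simp flip: power_mult_distrib)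
    hence "((-1) ^ n * (-1) ^ n) * ((-1) ^ n * (-1) ^ n) = (1::complex)" by simp
    moreover have "rterm (\<lambda>k. [a, b, c, d] ! k) (\<lambda>k. [1, e, f, g] ! k) (of_nat n) =
      (((-1) ^ n * (-1) ^ n) * ((-1) ^ n * (-1) ^ n)) * (?G * Freg_term a b c d e f g n)"
      by (simp add: rterm_def prod_lessThan_4 rGamma_diff_nat Freg_term_def mult_ac)
    ultimately show ?thesis by (simp only: mult_1_left)
  qed
  have "rterm (\<lambda>k. 1 - [1, e, f, g] ! k) (\<lambda>k. 1 - [a, b, c, d] ! k) (1 + of_nat n) = 0" for n
    by (simp add: rterm_def prod_lessThan_4 rGamma_eq_zero_iff)
  hence 2: "half_sum (\<lambda>k. 1 - [1, e, f, g] ! k) (\<lambda>k. 1 - [a, b, c, d] ! k) 1 = 0" by (simp add: half_sum_def)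
  have "summable (Freg_term a b c d e f g)"
    by (rule summable_norm_cancel[OF summable_Freg]) (simp add: that)
  hence "half_sum (\<lambda>k. [a, b, c, d] ! k) (\<lambda>k. [1, e, f, g] ! k) 0 = ?G * Freg a b c d e f g"
    by (simp add: half_sum_def 1 Freg_def suminf_mult)
  thus ?thesis by (simp add: bilateral4_def bilateral_def 2)
qed

text \<open>Periodicity moves -f to 1 - f, and the shift by 1 - f turns the lower parameter f into
  1.\<close>

lemma bilateral4_lower:
  assumes "e + f + g = 1 + a + b + c + d"
  shows "bilateral4 a b c d e f g (- f) = bilateral4 (1 + a - f) (1 + b - f) (1 + c - f) (1 + d - f) (2 - f) (1 + e - f) (1 + g - f) 0"
proof -
  have "(\<Sum>k<4. [1, e, f, g] ! k) = (\<Sum>k<4. [a, b, c, d] ! k) + 2" using assms by (simp add: sum_lessThan_4) algebra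
  from bilateral_plus1[OF this, of "- f"]
  have "bilateral4 a b c d e f g (- f) = bilateral (\<lambda>k. [a, b, c, d] ! k) (\<lambda>k. [1, e, f, g] ! k) (0 + (1 - f))"
    by (simp add: bilateral4_def)
  also have "\<dots> = bilateral4 (1 + a - f) (1 + b - f) (1 + c - f) (1 + d - f) (2 - f) (1 + e - f) (1 + g - f) 0"
    unfolding bilateral_shift bilateral4_def bilateral_def half_sum_def rterm_def prod_lessThan_4 by (simp add: algebra_simps)
  finally show ?thesis .
qed

text \<open>Read in the opposite direction the series has the lower parameter 1 - a; periodicity and
  the shift by a turn it into 1, which gives the second series of \<open>K\<close>.\<close>

lemma bilateral4_upper:
  assumes "e + f + g = 1 + a + b + c + d"
  shows "bilateral4 a b c d e f g (- a) = bilateral4 a (1 + a - e) (1 + a - f) (1 + a - g) (1 + a - b) (1 + a - c) (1 + a - d) 0"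
proof -
  have "(\<Sum>k<4. 1 - [a, b, c, d] ! k) = (\<Sum>k<4. 1 - [1, e, f, g] ! k) + 2" using assms by (simp add: sum_lessThan_4) algebra
  from bilateral_plus1[OF this, of a]
  have "bilateral4 a b c d e f g (- a) = bilateral (\<lambda>k. 1 - [1, e, f, g] ! k) (\<lambda>k. 1 - [a, b, c, d] ! k) (0 + a)"
    using bilateral_reflect[of "\<lambda>k. [1, e, f, g] ! k" "\<lambda>k. [a, b, c, d] ! k" "- a"] by (simp add: bilateral4_def add.commute)
  also have "\<dots> = bilateral4 a (1 + a - e) (1 + a - f) (1 + a - g) (1 + a - b) (1 + a - c) (1 + a - d) 0"
    unfolding bilateral_shift bilateral4_def bilateral_def half_sum_def rterm_def prod_lessThan_4 by (simp add: algebra_simps)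
  finally show ?thesis .
qed

lemma bilateral4_swap: "bilateral4 a b c d e f g = bilateral4 a b c d e g f"
  unfolding bilateral4_def bilateral_def[abs_def] half_sum_def rterm_def prod_lessThan_4 by (simp add: mult_ac)

lemma bilateral4_four_term:
  fixes a b c d e f g :: real
  assumes sum: "e + f + g = 1 + a + b + c + d" and a: "0 < a" "a < f" "a < g" and f: "f < 1" "g < 1" "f \<noteq> g"
  defines "X \<equiv> bilateral4 (of_real a) (of_real b) (of_real c) (of_real d) (of_real e) (of_real f) (of_real g)"
  shows "X 0 / (sn (of_real f) * sn (of_real g) * sn (of_real a))
    + X (- of_real f) / (sn (- of_real f) * sn (of_real g - of_real f) * sn (of_real a - of_real f))
    + X (- of_real g) / (sn (- of_real g) * sn (of_real f - of_real g) * sn (of_real a - of_real g))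
    + X (- of_real a) / (sn (- of_real a) * sn (of_real f - of_real a) * sn (of_real g - of_real a)) = 0"
proof -
  define \<tau> where "\<tau> = (\<lambda>k::nat. [0, - f, - g, - a] ! k)"
  \<comment> \<open>Midpoint of -1 and the smaller of -f and -g; the unit interval starting there
    contains 0, -f, -g and -a.\<close>
  define x0 where "x0 = (-1 + min (- f) (- g)) / 2"
  define \<alpha> \<beta> where "\<alpha> = (\<lambda>k. [a, b, c, d] ! k)" and "\<beta> = (\<lambda>k. [1, e, f, g] ! k)"
  have x0: "x0 < - f" "x0 < - g" "x0 < - a" "x0 > - 1"
    using a f by (auto simp: x0_def min_def field_simps)
  have "(\<Sum>i<4. bilateral (\<lambda>k. of_real (\<alpha> k)) (\<lambda>k. of_real (\<beta> k)) (of_real (\<tau> i)) /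
    (\<Prod>j\<in>{..<4} - {i}. sn (of_real (\<tau> i) - of_real (\<tau> j)))) = 0"
  proof (rule bilateral_four_term[where ?x0.0 = x0])
    show "(\<Sum>k<4. \<beta> k) = (\<Sum>k<4. \<alpha> k) + 2" using sum by (simp add: \<alpha>_def \<beta>_def sum_lessThan_4)
    have "{..<4::nat} = {0, 1, 2, 3}" by auto
    thus "inj_on \<tau> {..<4}" using a f by (simp add: \<tau>_def)
    show "x0 < \<tau> k \<and> \<tau> k < x0 + 1" if "k < 4" for k
      by (rule less_4_cases[OF _ _ _ _ that]) (use a f x0 in \<open>auto simp: \<tau>_def\<close>)
    show "-2 \<le> x0" "x0 \<le> 2" using a f x0 by auto
  qed
  moreover have "bilateral (\<lambda>k. of_real (\<alpha> k)) (\<lambda>k. of_real (\<beta> k)) = X"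
    unfolding X_def bilateral4_def bilateral_def[abs_def] half_sum_def rterm_def prod_lessThan_4 by (simp add: \<alpha>_def \<beta>_def)
  moreover have "{..<4} - {0::nat} = {1, 2, 3}" "{..<4} - {1::nat} = {0, 2, 3}" "{..<4} - {2::nat} = {0, 1, 3}"
    "{..<4} - {3::nat} = {0, 1, 2}" by auto
  ultimately show ?thesis by (simp add: sum_lessThan_4 \<tau>_def mult.assoc)
qed

section \<open>Expressing K through two numerators\<close>

text \<open>\<open>K\<close> times its sine, with the reciprocal Gammas of the lower parameters
  absorbed into \<open>Freg\<close>; unlike \<open>K\<close> it is entire on the balanced
  hyperplane.\<close>

definition Kreg :: "complex \<Rightarrow> complex \<Rightarrow> complex \<Rightarrow> complex \<Rightarrow> complex \<Rightarrow> complex \<Rightarrow> complex \<Rightarrow> complex" where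
  "Kreg a b c d e f g = Freg a b c d e f g * (rGamma a * rGamma (1 + a - e) * rGamma (1 + a - f) * rGamma (1 + a - g))
     + Freg a (1 + a - e) (1 + a - f) (1 + a - g) (1 + a - b) (1 + a - c) (1 + a - d) * (rGamma a * rGamma b * rGamma c * rGamma d)"

text \<open>The variables stand for sines, \<open>sfg\<close> for that of f - g and so on. The
  four-term relation is solved for \<open>Xa\<close>; then \<open>trig\<close> distributes the
  coefficient of \<open>X0\<close> over two brackets, which are the two \<open>Lnum\<close> up to
  Gamma factors.\<close>

lemma four_term_solved:
  fixes sa sb sc sd sea sf sg sfg sfa sfb sfc sfd sga sgb sgc sgd X0 Xf Xg Xa :: complex
  assumes nz: "sa \<noteq> 0" "sf \<noteq> 0" "sg \<noteq> 0" "sfg \<noteq> 0" "sfa \<noteq> 0" "sga \<noteq> 0"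
    and four: "X0 / (sf * sg * sa) + Xf / (- sf * - sfg * - sfa) + Xg / (- sg * sfg * - sga) + Xa / (- sa * sfa * sga) = 0"
    and trig: "sfg * (sea * sf * sg + sb * sc * sd) = sfb * sfc * sfd * sg - sgb * sgc * sgd * sf"
  shows "(X0 * (sa * sea * sfa * sga) + Xa * (sa * sb * sc * sd)) * sfg =
    sa * (sga * ((X0 * (sfa * sfb * sfc * sfd) - Xf * (sa * sb * sc * sd)) / sf) - sfa * ((X0 * (sga * sgb * sgc * sgd) - Xg * (sa * sb * sc * sd)) / sg))"
proof -
  have "X0 / (sf * sg * sa) + Xf / (- sf * - sfg * - sfa) + Xg / (- sg * sfg * - sga) + Xa / (- sa * sfa * sga)
     = (X0 * sfa * sga * sfg - Xf * sa * sga * sg + Xg * sa * sfa * sf - Xa * sf * sg * sfg) / (sf * sg * sa * sfg * sfa * sga)"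
    using nz by (simp add: field_simps)
  hence "X0 * sfa * sga * sfg - Xf * sa * sga * sg + Xg * sa * sfa * sf - Xa * sf * sg * sfg = 0"
    using four nz by simp
  hence Xa: "Xa * sf * sg * sfg = X0 * sfa * sga * sfg - Xf * sa * sga * sg + Xg * sa * sfa * sf" by algebra
  have "(X0 * (sa * sea * sfa * sga) + Xa * (sa * sb * sc * sd)) * sfg * (sf * sg) =
    sa * (sga * sg * (X0 * (sfa * sfb * sfc * sfd) - Xf * (sa * sb * sc * sd)) - sfa * sf * (X0 * (sga * sgb * sgc * sgd) - Xg * (sa * sb * sc * sd)))"
    using Xa trig by algebra
  also have "\<dots> = sa * (sga * ((X0 * (sfa * sfb * sfc * sfd) - Xf * (sa * sb * sc * sd)) / sf) - sfa * ((X0 * (sga * sgb * sgc * sgd) - Xg * (sa * sb * sc * sd)) / sg)) * (sf * sg)"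
    using nz by (simp add: field_simps)
  finally show ?thesis using nz by simp
qed

text \<open>Restores the Gamma factors in the preceding identity. \<open>Aa\<close>,
  \<open>E\<close>, \<open>Fa\<close>, \<open>Ga\<close> stand for \<open>rGamma\<close> at 1-a,
  e-a, f-a, g-a and \<open>p\<close> for pi; with independent symbols the claim is purely
  rational.\<close>

lemma Kreg_elimination:
  fixes sa sb sc sd sea sf sg sfg sfa sfb sfc sfd sga sgb sgc sgd X0 Xf Xg Xa p :: complex
  assumes nz: "p \<noteq> 0" "sea \<noteq> 0" "sfg \<noteq> 0" "Aa \<noteq> 0" "Ab \<noteq> 0" "Ac \<noteq> 0" "Ad \<noteq> 0" "E \<noteq> 0"
      "Fa \<noteq> 0" "Fb \<noteq> 0" "Fc \<noteq> 0" "Fd \<noteq> 0" "Ga \<noteq> 0" "Gb \<noteq> 0" "Gc \<noteq> 0" "Gd \<noteq> 0"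
    and Lf: "Lf = X0 / (Aa * Ab * Ac * Ad) * (sfa / (p * Fa) * (sfb / (p * Fb)) * (sfc / (p * Fc)) * (sfd / (p * Fd)))
      - Xf / (Fa * Fb * Fc * Fd) * (sa / (p * Aa) * (sb / (p * Ab)) * (sc / (p * Ac)) * (sd / (p * Ad)))"
    and Lg: "Lg = X0 / (Aa * Ab * Ac * Ad) * (sga / (p * Ga) * (sgb / (p * Gb)) * (sgc / (p * Gc)) * (sgd / (p * Gd)))
      - Xg / (Ga * Gb * Gc * Gd) * (sa / (p * Aa) * (sb / (p * Ab)) * (sc / (p * Ac)) * (sd / (p * Ad)))"
    and solved: "(X0 * (sa * sea * sfa * sga) + Xa * (sa * sb * sc * sd)) * sfg =
      sa * (sga * ((X0 * (sfa * sfb * sfc * sfd) - Xf * (sa * sb * sc * sd)) / sf) - sfa * ((X0 * (sga * sgb * sgc * sgd) - Xg * (sa * sb * sc * sd)) / sg))"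
  shows "X0 / (Aa * Ab * Ac * Ad) * (sa / (p * Aa) * (sea / (p * E)) * (sfa / (p * Fa)) * (sga / (p * Ga)))
      + Xa / (Aa * E * Fa * Ga) * (sa / (p * Aa) * (sb / (p * Ab)) * (sc / (p * Ac)) * (sd / (p * Ad)))
    = p ^ 3 / (sea * sfg) * (sa / (p * Aa)) * (sea / (p * E)) *
      (sga / (p * Ga) * Fb * Fc * Fd * (Lf / sf) - sfa / (p * Fa) * Gb * Gc * Gd * (Lg / sg))"
proof -
  define AA FF GG where "AA = Aa * Ab * Ac * Ad" and "FF = Fa * Fb * Fc * Fd" and "GG = Ga * Gb * Gc * Gd"
  define Bf Bg where "Bf = X0 * (sfa * sfb * sfc * sfd) - Xf * (sa * sb * sc * sd)"
    and "Bg = X0 * (sga * sgb * sgc * sgd) - Xg * (sa * sb * sc * sd)"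
  have nz': "AA \<noteq> 0" "FF \<noteq> 0" "GG \<noteq> 0" using nz by (simp_all add: AA_def FF_def GG_def)
  have frac4: "x / u * (s1 / (p * y1) * (s2 / (p * y2)) * (s3 / (p * y3)) * (s4 / (p * y4))) =
      x * (s1 * s2 * s3 * s4) / (p ^ 4 * (u * (y1 * y2 * y3 * y4)))" for x u s1 s2 s3 s4 y1 y2 y3 y4
    by (simp add: power4_eq_xxxx mult_ac)
  have cancel: "t / (p * y) * z2 * z3 * z4 * (B / (p ^ 4 * (u * (z * z2 * z3 * z4))) / s) = t * (B / s) / (p ^ 5 * (u * z * y))"
    if "z2 \<noteq> 0" "z3 \<noteq> 0" "z4 \<noteq> 0" for t y z z2 z3 z4 B u s
  proof -
    have "t / (p * y) * z2 * z3 * z4 * (B / (p ^ 4 * (u * (z * z2 * z3 * z4))) / s) =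
      (z2 * z3 * z4) * (t * (B / s)) / ((z2 * z3 * z4) * (p ^ 5 * (u * z * y)))"
      by (simp add: power_numeral_reduce mult_ac)
    also have "\<dots> = t * (B / s) / (p ^ 5 * (u * z * y))"
      by (rule mult_divide_mult_cancel_left) (use that in simp)
    finally show ?thesis .
  qed
  have "Lf = Bf / (p ^ 4 * (AA * FF))"
    unfolding Lf frac4 Bf_def AA_def[symmetric] FF_def[symmetric] by (simp add: diff_divide_distrib mult.commute[of AA])
  hence 1: "sga / (p * Ga) * Fb * Fc * Fd * (Lf / sf) = sga * (Bf / sf) / (p ^ 5 * (AA * Fa * Ga))"
    unfolding FF_def by (simp only: cancel nz not_False_eq_True)
  have "Lg = Bg / (p ^ 4 * (AA * GG))"
    unfolding Lg frac4 Bg_def AA_def[symmetric] GG_def[symmetric] by (simp add: diff_divide_distrib mult.commute[of AA])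
  hence 2: "sfa / (p * Fa) * Gb * Gc * Gd * (Lg / sg) = sfa * (Bg / sg) / (p ^ 5 * (AA * Fa * Ga))"
    unfolding GG_def by (simp only: cancel nz not_False_eq_True) (simp only: mult_ac)
  define W where "W = sga * (Bf / sf) - sfa * (Bg / sg)"
  define Z where "Z = X0 * (sa * sea * sfa * sga) + Xa * (sa * sb * sc * sd)"
  define D where "D = Aa * E * Fa * Ga"
  have Z: "sa * W = Z * sfg" using solved by (simp add: W_def Z_def Bf_def Bg_def)
  have "p ^ 3 / (sea * sfg) * (sa / (p * Aa)) * (sea / (p * E)) * (W / (p ^ 5 * (AA * Fa * Ga))) =
     (p ^ 5 * sea) * (sa * W) / ((p ^ 5 * sea) * (sfg * (p ^ 4 * (AA * D))))"
  proof -
    have "p ^ 3 / (sea * sfg) * (sa / (p * Aa)) * (sea / (p * E)) * (W / (p ^ 5 * (AA * Fa * Ga))) =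
      p ^ 3 * sa * sea * W / (sea * sfg * (p * Aa) * (p * E) * (p ^ 5 * (AA * Fa * Ga)))"
      by (simp only: times_divide_times_eq)
    also have "\<dots> = (p * p) * (p ^ 3 * sa * sea * W) / ((p * p) * (sea * sfg * (p * Aa) * (p * E) * (p ^ 5 * (AA * Fa * Ga))))"
      by (rule mult_divide_mult_cancel_left[symmetric]) (use nz in simp)
    also have "\<dots> = (p ^ 5 * sea) * (sa * W) / ((p ^ 5 * sea) * (sfg * (p ^ 4 * (AA * D))))"
    proof -
      have "p ^ 3 = p * p * p" "p ^ 4 = p * p * p * p" "p ^ 5 = p * p * p * p * p" by (simp_all add: eval_nat_numeral)
      thus ?thesis unfolding D_def by (simp only: mult_ac)
    qed
    finally show ?thesis .
  qed
  also have "\<dots> = sa * W / (sfg * (p ^ 4 * (AA * D)))"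
    by (rule mult_divide_mult_cancel_left) (use nz in simp)
  also have "\<dots> = Z / (p ^ 4 * (AA * D))" unfolding Z using nz by simp
  also have "\<dots> = X0 / AA * (sa / (p * Aa) * (sea / (p * E)) * (sfa / (p * Fa)) * (sga / (p * Ga)))
      + Xa / D * (sa / (p * Aa) * (sb / (p * Ab)) * (sc / (p * Ac)) * (sd / (p * Ad)))"
    unfolding frac4 Z_def AA_def[symmetric] D_def[symmetric] by (simp add: add_divide_distrib mult.commute[of D])
  finally show ?thesis
    unfolding 1 2 diff_divide_distrib[symmetric] W_def[symmetric] AA_def[symmetric] D_def[symmetric] by (rule sym)
qed

text \<open>The ordering 0 < a, b, c, d < e < f, g < 1 keeps all divisors nonzero. It is preserved
  by the duality, which sends a to e - a and f to 1 + e - f, so the formula also serves the dual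
  family.\<close>

lemma Kreg_eq_Lnum:
  fixes a' b' c' d' e' f' g' :: real
  assumes pos: "0 < a'" "0 < b'" "0 < c'" "0 < d'" and lt: "a' < e'" "b' < e'" "c' < e'" "d' < e'"
    and fg: "e' < f'" "e' < g'" "f' < 1" "g' < 1" "f' \<noteq> g'" and sum: "e' + f' + g' = 1 + a' + b' + c' + d'"
    and c: "a = of_real a'" "b = of_real b'" "c = of_real c'" "d = of_real d'" "e = of_real e'" "f = of_real f'" "g = of_real g'"
  shows "Kreg a b c d e f g = of_real pi ^ 3 / (sn (e - a) * sn (f - g)) * rGamma a * rGamma (1 + a - e) *
    (rGamma (1 + a - g) * rGamma (f - b) * rGamma (f - c) * rGamma (f - d) * (Lnum a b c d f e g / sn f)
     - rGamma (1 + a - f) * rGamma (g - b) * rGamma (g - c) * rGamma (g - d) * (Lnum a b c d g e f / sn g))"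
proof -
  let ?AA = "(rGamma (1 - a) * rGamma (1 - b) * rGamma (1 - c) * rGamma (1 - d))"
  let ?SA = "(sn a / (of_real pi * rGamma (1 - a)) * (sn b / (of_real pi * rGamma (1 - b))) * (sn c / (of_real pi * rGamma (1 - c))) * (sn d / (of_real pi * rGamma (1 - d))))"
  have "complex_of_real (e' + f' + g') = of_real (1 + a' + b' + c' + d')" by (simp only: sum)
  hence csum: "e + f + g = 1 + a + b + c + d" by (simp add: c)
  have rnz: "rGamma z \<noteq> 0" if z: "z \<in> \<real>" "Re z > 0" for z :: complex
  proof -
    have "z = of_real (Re z)" using z by (simp add: of_real_Re)
    hence "rGamma z = of_real (rGamma (Re z))" by (metis rGamma_complex_of_real)
    thus ?thesis using z by (simp add: rGamma_inverse_Gamma Gamma_real_nonzero)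
  qed
  have R: "rGamma (1 - z) = sn z / (of_real pi * rGamma z)" "rGamma z = sn z / (of_real pi * rGamma (1 - z))" if "rGamma z \<noteq> 0" "rGamma (1 - z) \<noteq> 0" for z
    using rGamma_reflection_complex[of z] that by (simp_all add: field_simps)
  have nz: "rGamma (1 - a) \<noteq> 0" "rGamma (1 - b) \<noteq> 0" "rGamma (1 - c) \<noteq> 0" "rGamma (1 - d) \<noteq> 0"
    "rGamma (e - a) \<noteq> 0"
    "rGamma (f - a) \<noteq> 0" "rGamma (f - b) \<noteq> 0" "rGamma (f - c) \<noteq> 0" "rGamma (f - d) \<noteq> 0"
    "rGamma (g - a) \<noteq> 0" "rGamma (g - b) \<noteq> 0" "rGamma (g - c) \<noteq> 0" "rGamma (g - d) \<noteq> 0"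
    by (rule rnz; use pos lt fg in \<open>simp add: c\<close>)+
  have nz': "rGamma a \<noteq> 0" "rGamma b \<noteq> 0" "rGamma c \<noteq> 0" "rGamma d \<noteq> 0" "rGamma (1 - (e - a)) \<noteq> 0"
    "rGamma (1 - (f - a)) \<noteq> 0" "rGamma (1 - (f - b)) \<noteq> 0" "rGamma (1 - (f - c)) \<noteq> 0" "rGamma (1 - (f - d)) \<noteq> 0"
    "rGamma (1 - (g - a)) \<noteq> 0" "rGamma (1 - (g - b)) \<noteq> 0" "rGamma (1 - (g - c)) \<noteq> 0" "rGamma (1 - (g - d)) \<noteq> 0"
    by (rule rnz; use pos lt fg in \<open>simp add: c\<close>)+
  have sn0: "sn a \<noteq> 0" "sn f \<noteq> 0" "sn g \<noteq> 0" "sn (f - g) \<noteq> 0" "sn (f - a) \<noteq> 0" "sn (g - a) \<noteq> 0" "sn (e - a) \<noteq> 0"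
    by (rule sn_nonzero; use pos lt fg in \<open>simp add: c\<close>)+
  note r = R(2)[OF nz'(1) nz(1)] R(2)[OF nz'(2) nz(2)] R(2)[OF nz'(3) nz(3)] R(2)[OF nz'(4) nz(4)]
  note re = R(1)[OF nz(5) nz'(5)] and rf = R(1)[OF nz(6) nz'(6)] R(1)[OF nz(7) nz'(7)] R(1)[OF nz(8) nz'(8)] R(1)[OF nz(9) nz'(9)]
    and rg = R(1)[OF nz(10) nz'(10)] R(1)[OF nz(11) nz'(11)] R(1)[OF nz(12) nz'(12)] R(1)[OF nz(13) nz'(13)]
  define X where "X = bilateral4 a b c d e f g"
  have X0: "Freg a b c d e f g = X 0 / ?AA"
    using bilateral4_0[OF csum] nz by (simp add: X_def)
  have Xf: "Freg (1 + a - f) (1 + b - f) (1 + c - f) (1 + d - f) (2 - f) (1 + e - f) (1 + g - f) =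
      X (- f) / (rGamma (f - a) * rGamma (f - b) * rGamma (f - c) * rGamma (f - d))"
  proof -
    have "2 - f + (1 + e - f) + (1 + g - f) = 1 + (1 + a - f) + (1 + b - f) + (1 + c - f) + (1 + d - f)"
      using csum by algebra
    from bilateral4_0[OF this] show ?thesis using nz by (simp add: X_def bilateral4_lower[OF csum])
  qed
  have Xg: "Freg (1 + a - g) (1 + b - g) (1 + c - g) (1 + d - g) (2 - g) (1 + e - g) (1 + f - g) =
      X (- g) / (rGamma (g - a) * rGamma (g - b) * rGamma (g - c) * rGamma (g - d))"
  proof -
    have s: "2 - g + (1 + e - g) + (1 + f - g) = 1 + (1 + a - g) + (1 + b - g) + (1 + c - g) + (1 + d - g)"
      "e + g + f = 1 + a + b + c + d"
      using csum by algebra+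
    show ?thesis using nz bilateral4_0[OF s(1)] by (simp add: X_def bilateral4_swap[of a b c d e f g] bilateral4_lower[OF s(2)])
  qed
  have Xa: "Freg a (1 + a - e) (1 + a - f) (1 + a - g) (1 + a - b) (1 + a - c) (1 + a - d) =
      X (- a) / (rGamma (1 - a) * rGamma (e - a) * rGamma (f - a) * rGamma (g - a))"
  proof -
    have "1 + a - b + (1 + a - c) + (1 + a - d) = 1 + a + (1 + a - e) + (1 + a - f) + (1 + a - g)"
      using csum by algebra
    from bilateral4_0[OF this] show ?thesis using nz by (simp add: X_def bilateral4_upper[OF csum])
  qed
  have four: "X 0 / (sn f * sn g * sn a) + X (- f) / (- sn f * - sn (f - g) * - sn (f - a))
    + X (- g) / (- sn g * sn (f - g) * - sn (g - a)) + X (- a) / (- sn a * sn (f - a) * sn (g - a)) = 0"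
    using bilateral4_four_term[of e' f' g' a' b' c' d'] sum pos lt fg
    unfolding X_def c[symmetric] sn_minus(1) sn_minus(2)[of g f] sn_minus(2)[of a] by simp
  note solved = four_term_solved[OF sn0(1-6) four sn_trig_1[OF csum]]
  have shift: "1 + x - y = 1 - (y - x)" for x y :: complex by simp
  have LL: "Lnum a b c d f e g = X 0 / ?AA *
      (sn (f - a) / (of_real pi * rGamma (f - a)) * (sn (f - b) / (of_real pi * rGamma (f - b))) * (sn (f - c) / (of_real pi * rGamma (f - c))) * (sn (f - d) / (of_real pi * rGamma (f - d))))
      - X (- f) / (rGamma (f - a) * rGamma (f - b) * rGamma (f - c) * rGamma (f - d)) *
      ?SA"
    unfolding Lnum_def Freg_swap[of a b c d f e g] X0 Xf
    unfolding shift[of a f] shift[of b f] shift[of c f] shift[of d f] rf r ..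
  have LL': "Lnum a b c d g e f = X 0 / ?AA *
      (sn (g - a) / (of_real pi * rGamma (g - a)) * (sn (g - b) / (of_real pi * rGamma (g - b))) * (sn (g - c) / (of_real pi * rGamma (g - c))) * (sn (g - d) / (of_real pi * rGamma (g - d))))
      - X (- g) / (rGamma (g - a) * rGamma (g - b) * rGamma (g - c) * rGamma (g - d)) *
      ?SA"
  proof -
    have "Freg a b c d g e f = Freg a b c d e f g" by (simp add: Freg_def Freg_term_def mult_ac)
    thus ?thesis
      unfolding Lnum_def X0 Xg
      unfolding shift[of a g] shift[of b g] shift[of c g] shift[of d g] rg r by (simp only: X0)
  qed
  have pi0: "complex_of_real pi \<noteq> 0" by simp
  note alg = Kreg_elimination[OF pi0 sn0(7,4) nz LL LL' solved]
  have "Kreg a b c d e f g = X 0 / ?AA *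
      (sn a / (of_real pi * rGamma (1 - a)) * (sn (e - a) / (of_real pi * rGamma (e - a))) * (sn (f - a) / (of_real pi * rGamma (f - a))) * (sn (g - a) / (of_real pi * rGamma (g - a))))
      + X (- a) / (rGamma (1 - a) * rGamma (e - a) * rGamma (f - a) * rGamma (g - a)) *
      ?SA"
    unfolding Kreg_def X0 Xa
    unfolding shift[of a e] shift[of a f] shift[of a g] re rf(1) rg(1) r ..
  also note alg
  finally show ?thesis
    unfolding shift[of a e] shift[of a f] shift[of a g] re[symmetric] rf(1)[symmetric] rg(1)[symmetric] r(1)[symmetric] .
qed

section \<open>Comparison of coefficients and continuation\<close>

text \<open>Coefficient of \<open>Lnum a b c d f e g\<close> in the relation. Reflection pairs the
  reciprocal Gammas so that a common factor \<open>Q\<close> and sines remain, which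
  \<open>sn_trig_2\<close> adds up.\<close>

lemma Lnum_coefficient:
  assumes sum: "e + f + g = 1 + a + b + c + d"
  shows "sn (e - a - b) * A (1 - a) (e - a) (f - a) (g - a) * A b (1 + b - e) (1 + b - f) (1 + b - g)
      * (rGamma a * rGamma (1 + a - e) * (rGamma (1 + a - g) * rGamma (f - b) * rGamma (f - c) * rGamma (f - d))) * sn b
    + sn (b - a) * A (1 + a - e) (1 + b - e) (g - c) (g - d) * A a b (f - c) (f - d)
      * (rGamma (e - a) * rGamma (1 - a) * (rGamma (f - a) * rGamma (1 + b - g) * rGamma (1 + c - g) * rGamma (1 + d - g))) * sn b
    = sn b * (sn (b - a) * sn (c - a) * sn (d - a) + sn (e - 2 * a) * sn (f - a) * sn (g - a)) / of_real pi ^ 4 * sn a * sn (e - a)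
      * (rGamma b * rGamma (1 + b - e) * (rGamma (1 + b - g) * rGamma (f - a) * rGamma (f - c) * rGamma (f - d)))"
proof -
  let ?t1 = "(rGamma a * rGamma (1 + a - e) * (rGamma (1 + a - g) * rGamma (f - b) * rGamma (f - c) * rGamma (f - d)))"
  let ?t2 = "(rGamma (e - a) * rGamma (1 - a) * (rGamma (f - a) * rGamma (1 + b - g) * rGamma (1 + c - g) * rGamma (1 + d - g)))"
  define Q where "Q = rGamma b * rGamma (1 + b - e) * (rGamma (1 + b - g) * rGamma (f - a) * rGamma (f - c) * rGamma (f - d))"
  have R: "rGamma (x - y) * rGamma (1 + y - x) = sn (x - y) / of_real pi" "rGamma x * rGamma (1 - x) = sn x / of_real pi" for x y :: complex
    using rGamma_reflection_complex[of "x - y"] rGamma_reflection_complex[of x] by (simp_all add: algebra_simps)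
  have "sn (e - a - b) * A (1 - a) (e - a) (f - a) (g - a) * A b (1 + b - e) (1 + b - f) (1 + b - g)
      * ?t1 * sn b
     = sn b * Q * sn (e - a - b) * ((rGamma a * rGamma (1 - a)) * (rGamma (e - a) * rGamma (1 + a - e))
        * (rGamma (g - a) * rGamma (1 + a - g)) * (rGamma (f - b) * rGamma (1 + b - f)))"
    unfolding A_def Q_def by (simp only: mult_ac)
  also have "\<dots> = sn b * Q * sn a * sn (e - a) * (sn (e - a - b) * sn (g - a) * sn (f - b)) / of_real pi ^ 4"
    unfolding R by (simp add: power4_eq_xxxx mult_ac)
  finally have 1: "sn (e - a - b) * A (1 - a) (e - a) (f - a) (g - a) * A b (1 + b - e) (1 + b - f) (1 + b - g)
      * ?t1 * sn b
     = sn b * Q * sn a * sn (e - a) * (sn (e - a - b) * sn (g - a) * sn (f - b)) / of_real pi ^ 4" .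
  have "sn (b - a) * A (1 + a - e) (1 + b - e) (g - c) (g - d) * A a b (f - c) (f - d)
      * ?t2 * sn b
     = sn b * Q * sn (b - a) * ((rGamma a * rGamma (1 - a)) * (rGamma (e - a) * rGamma (1 + a - e))
        * (rGamma (g - c) * rGamma (1 + c - g)) * (rGamma (g - d) * rGamma (1 + d - g)))"
    unfolding A_def Q_def by (simp only: mult_ac)
  also have "\<dots> = sn b * Q * sn a * sn (e - a) * (sn (b - a) * sn (g - c) * sn (g - d)) / of_real pi ^ 4"
    unfolding R by (simp add: power4_eq_xxxx mult_ac)
  finally have 2: "sn (b - a) * A (1 + a - e) (1 + b - e) (g - c) (g - d) * A a b (f - c) (f - d)
      * ?t2 * sn b
     = sn b * Q * sn a * sn (e - a) * (sn (b - a) * sn (g - c) * sn (g - d)) / of_real pi ^ 4" .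
  show ?thesis
    unfolding 1 2 Q_def[symmetric] sn_trig_2[OF sum, symmetric] by (simp add: add_divide_distrib algebra_simps)
qed

text \<open>The asserted relation multiplied by \<open>sn a * sn b * sn (e - a)\<close>, which
  clears the sine denominators of the three \<open>K\<close> and makes every term entire.\<close>

lemma Kreg_three_term_real:
  fixes a' b' c' d' e' f' g' :: real
  assumes pos: "0 < a'" "0 < b'" "0 < c'" "0 < d'" and lt: "a' < e'" "b' < e'" "c' < e'" "d' < e'" and ab: "a' \<noteq> b'"
    and fg: "e' < f'" "e' < g'" "f' < 1" "g' < 1" "f' \<noteq> g'" and sum: "e' + f' + g' = 1 + a' + b' + c' + d'"
    and c: "a = of_real a'" "b = of_real b'" "c = of_real c'" "d = of_real d'" "e = of_real e'" "f = of_real f'" "g = of_real g'"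
  shows "sn (e - a - b) * A (1 - a) (e - a) (f - a) (g - a) * A b (1 + b - e) (1 + b - f) (1 + b - g) * Kreg a b c d e f g * sn b * sn (e - a)
    + sn (b - a) * A (1 + a - e) (1 + b - e) (g - c) (g - d) * A a b (f - c) (f - d)
        * Kreg (e - a) (e - b) (e - c) (e - d) (1 + e - f) (1 + e - g) e * sn a * sn b
    - sn b * sn (e - b) * (sn (b - a) * sn (c - a) * sn (d - a) + sn (e - 2 * a) * sn (f - a) * sn (g - a)) / of_real pi ^ 4
        * Kreg b c d a e f g * sn a * sn (e - a) = 0"
proof -
  let ?K2 = "Kreg (e - a) (e - b) (e - c) (e - d) (1 + e - f) (1 + e - g) e"
  have "complex_of_real (e' + f' + g') = of_real (1 + a' + b' + c' + d')" by (simp only: sum)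
  hence csum: "e + f + g = 1 + a + b + c + d" by (simp add: c)
  have sn0: "sn a \<noteq> 0" "sn (e - a) \<noteq> 0" "sn (e - b) \<noteq> 0" "sn f \<noteq> 0" "sn g \<noteq> 0" "sn (f - g) \<noteq> 0" "sn (f - e) \<noteq> 0" "sn (g - e) \<noteq> 0" "sn (a - b) \<noteq> 0"
    by (rule sn_nonzero; use pos lt fg ab in \<open>simp add: c\<close>)+
  \<comment> \<open>With the sines divided out, \<open>Lnum_dual\<close> says that these quotients
    are carried to each other by the duality with no remaining factor.\<close>
  define Lf Lg where "Lf = Lnum a b c d f e g / sn f" and "Lg = Lnum a b c d g e f / sn g"
  define q where "q = of_real pi ^ 3 / sn (f - g)"
  have perm: "Lnum b c d a x y z = Lnum a b c d x y z" for x y z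
    by (rule Lnum_cycle_upper[symmetric])
  have K0: "Kreg a b c d e f g = q / sn (e - a) * (rGamma a * rGamma (1 + a - e)) *
     ((rGamma (1 + a - g) * rGamma (f - b) * rGamma (f - c) * rGamma (f - d)) * Lf
      - (rGamma (1 + a - f) * rGamma (g - b) * rGamma (g - c) * rGamma (g - d)) * Lg)"
    unfolding Kreg_eq_Lnum[OF pos lt fg sum c] Lf_def Lg_def q_def by (simp add: mult_ac)
  have sum1: "e' + f' + g' = 1 + b' + c' + d' + a'" using sum by simp
  have K1: "Kreg b c d a e f g = q / sn (e - b) * (rGamma b * rGamma (1 + b - e)) *
     ((rGamma (1 + b - g) * rGamma (f - a) * rGamma (f - c) * rGamma (f - d)) * Lf
      - (rGamma (1 + b - f) * rGamma (g - a) * rGamma (g - c) * rGamma (g - d)) * Lg)"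
    unfolding Kreg_eq_Lnum[OF pos(2-4,1) lt(2-4,1) fg sum1 c(2-4,1,5-7)] Lf_def Lg_def q_def perm by (simp add: mult_ac)
  \<comment> \<open>The duality interchanges the two quotients: the numerator at 1 + e - f belongs
    to \<open>Lg\<close>, that at 1 + e - g to \<open>Lf\<close>. The sign of the sine of g - f
    restores the order.\<close>
  have K2: "?K2 = q / sn a * (rGamma (e - a) * rGamma (1 - a)) *
     ((rGamma (f - a) * rGamma (1 + b - g) * rGamma (1 + c - g) * rGamma (1 + d - g)) * Lf
      - (rGamma (g - a) * rGamma (1 + b - f) * rGamma (1 + c - f) * rGamma (1 + d - f)) * Lg)"
  proof -
    have "?K2 = Kreg (e - a) (e - b) (e - c) (e - d) e (1 + e - f) (1 + e - g)"
      by (simp add: Kreg_def Freg_def Freg_term_def mult_ac)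
    also have "\<dots> = of_real pi ^ 3 / (sn (e - (e - a)) * sn (1 + e - f - (1 + e - g))) * rGamma (e - a) * rGamma (1 + (e - a) - e) *
      (rGamma (1 + (e - a) - (1 + e - g)) * rGamma (1 + e - f - (e - b)) * rGamma (1 + e - f - (e - c)) * rGamma (1 + e - f - (e - d))
         * (Lnum (e - a) (e - b) (e - c) (e - d) (1 + e - f) e (1 + e - g) / sn (1 + e - f))
       - rGamma (1 + (e - a) - (1 + e - f)) * rGamma (1 + e - g - (e - b)) * rGamma (1 + e - g - (e - c)) * rGamma (1 + e - g - (e - d))
         * (Lnum (e - a) (e - b) (e - c) (e - d) (1 + e - g) e (1 + e - f) / sn (1 + e - g)))"
      by (rule Kreg_eq_Lnum[where a' = "e' - a'" and b' = "e' - b'" and c' = "e' - c'" and d' = "e' - d'" and e' = e' and f' = "1 + e' - f'" and g' = "1 + e' - g'"])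
        (use pos lt fg sum in \<open>simp_all add: c\<close>)
    also have "Lnum (e - a) (e - b) (e - c) (e - d) (1 + e - f) e (1 + e - g) / sn (1 + e - f) = Lg"
    proof -
      have "sn (f - e) * Lnum a b c d g e f = sn g * Lnum (e - a) (e - b) (e - c) (e - d) (1 + e - f) (1 + e - g) e"
        by (rule Lnum_dual[OF csum sn0(9)])
      moreover have "sn (1 + e - f) = sn (f - e)"
        using sn_plus1[of "e - f"] sn_minus(2)[of e f] by (simp add: add_diff_eq)
      ultimately show ?thesis
        using sn0 unfolding Lg_def Lnum_swap_lower[of "e - a" "e - b" "e - c" "e - d" "1 + e - f" e] by (simp add: field_simps)
    qed
    also have "Lnum (e - a) (e - b) (e - c) (e - d) (1 + e - g) e (1 + e - f) / sn (1 + e - g) = Lf"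
    proof -
      have "e + g + f = 1 + a + b + c + d" using csum by algebra
      hence "sn (g - e) * Lnum a b c d f e g = sn f * Lnum (e - a) (e - b) (e - c) (e - d) (1 + e - g) (1 + e - f) e"
        by (rule Lnum_dual[OF _ sn0(9)])
      moreover have "sn (1 + e - g) = sn (g - e)"
        using sn_plus1[of "e - g"] sn_minus(2)[of e g] by (simp add: add_diff_eq)
      ultimately show ?thesis
        using sn0 unfolding Lf_def Lnum_swap_lower[of "e - a" "e - b" "e - c" "e - d" "1 + e - g" e] by (simp add: field_simps)
    qed
    also have "of_real pi ^ 3 / (sn (e - (e - a)) * sn (1 + e - f - (1 + e - g))) = - (q / sn a)"
      using sn_minus(2)[of g f] by (simp add: q_def mult.commute)
    finally show ?thesis by (simp add: algebra_simps)
  qed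
  define T where "T = (sn (b - a) * sn (c - a) * sn (d - a) + sn (e - 2 * a) * sn (f - a) * sn (g - a))"
  have csum': "e + g + f = 1 + a + b + c + d" using csum by algebra
  note C1 = Lnum_coefficient[OF csum, folded T_def] and C2 = Lnum_coefficient[OF csum']
  have T': "sn (b - a) * sn (c - a) * sn (d - a) + sn (e - 2 * a) * sn (g - a) * sn (f - a) = T"
    by (simp add: T_def mult_ac)
  define t1 t1' t2 t2' t3 t3' p1 p2 where
    "t1 = rGamma a * rGamma (1 + a - e) * (rGamma (1 + a - g) * rGamma (f - b) * rGamma (f - c) * rGamma (f - d))" and
    "t1' = rGamma a * rGamma (1 + a - e) * (rGamma (1 + a - f) * rGamma (g - b) * rGamma (g - c) * rGamma (g - d))" and
    "t2 = rGamma (e - a) * rGamma (1 - a) * (rGamma (f - a) * rGamma (1 + b - g) * rGamma (1 + c - g) * rGamma (1 + d - g))" and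
    "t2' = rGamma (e - a) * rGamma (1 - a) * (rGamma (g - a) * rGamma (1 + b - f) * rGamma (1 + c - f) * rGamma (1 + d - f))" and
    "t3 = rGamma b * rGamma (1 + b - e) * (rGamma (1 + b - g) * rGamma (f - a) * rGamma (f - c) * rGamma (f - d))" and
    "t3' = rGamma b * rGamma (1 + b - e) * (rGamma (1 + b - f) * rGamma (g - a) * rGamma (g - c) * rGamma (g - d))" and
    "p1 = sn (e - a - b) * A (1 - a) (e - a) (f - a) (g - a) * A b (1 + b - e) (1 + b - f) (1 + b - g)" and
    "p2 = sn (b - a) * A (1 + a - e) (1 + b - e) (g - c) (g - d) * A a b (f - c) (f - d)"
  \<comment> \<open>Both prefactors are symmetric in f and g, so \<open>Lnum_coefficient\<close>
    with f and g exchanged is the coefficient of \<open>Lg\<close>.\<close>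
  have swap: "sn (e - a - b) * A (1 - a) (e - a) (g - a) (f - a) * A b (1 + b - e) (1 + b - g) (1 + b - f) = p1"
    "sn (b - a) * A (1 + a - e) (1 + b - e) (f - c) (f - d) * A a b (g - c) (g - d) = p2"
    unfolding p1_def p2_def A_def by (simp_all only: mult_ac)
  have C1': "p1 * t1 * sn b + p2 * t2 * sn b = sn b * T / of_real pi ^ 4 * sn a * sn (e - a) * t3"
    using C1 unfolding t1_def t2_def t3_def p1_def p2_def .
  have C2': "p1 * t1' * sn b + p2 * t2' * sn b = sn b * T / of_real pi ^ 4 * sn a * sn (e - a) * t3'"
    using C2 unfolding swap T' t1'_def t2'_def t3'_def .
  have k0: "Kreg a b c d e f g * sn (e - a) = q * (t1 * Lf - t1' * Lg)"
    unfolding K0 t1_def t1'_def using sn0 by (simp add: algebra_simps)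
  have k1: "sn (e - b) * Kreg b c d a e f g = q * (t3 * Lf - t3' * Lg)"
    unfolding K1 t3_def t3'_def using sn0 by (simp add: algebra_simps)
  have k2: "?K2 * sn a = q * (t2 * Lf - t2' * Lg)"
    unfolding K2 t2_def t2'_def using sn0 by (simp add: algebra_simps)
  have "p1 * Kreg a b c d e f g * sn b * sn (e - a) + p2 * ?K2 * sn a * sn b
      - sn b * sn (e - b) * T / of_real pi ^ 4 * Kreg b c d a e f g * sn a * sn (e - a)
    = p1 * sn b * (Kreg a b c d e f g * sn (e - a)) + p2 * sn b * (?K2 * sn a)
      - sn b * T / of_real pi ^ 4 * sn a * sn (e - a) * (sn (e - b) * Kreg b c d a e f g)"
    by (simp add: mult_ac)
  also have "\<dots> = q * (Lf * ((p1 * t1 * sn b + p2 * t2 * sn b) - sn b * T / of_real pi ^ 4 * sn a * sn (e - a) * t3)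
      - Lg * ((p1 * t1' * sn b + p2 * t2' * sn b) - sn b * T / of_real pi ^ 4 * sn a * sn (e - a) * t3'))"
    unfolding k0 k1 k2 by (simp add: algebra_simps diff_divide_distrib)
  also have "\<dots> = 0" unfolding C1' C2' by simp
  finally show ?thesis unfolding p1_def p2_def T_def .
qed

lemma holomorphic_Kreg:
  assumes hol: "a holomorphic_on UNIV" "b holomorphic_on UNIV" "c holomorphic_on UNIV" "d holomorphic_on UNIV"
    "e holomorphic_on UNIV" "f holomorphic_on UNIV" "g holomorphic_on UNIV"
    and sum: "\<And>z. e z + f z + g z = 1 + a z + b z + c z + d z"
  shows "(\<lambda>z. Kreg (a z) (b z) (c z) (d z) (e z) (f z) (g z)) holomorphic_on UNIV"
proof -
  have s: "1 + a z - b z + (1 + a z - c z) + (1 + a z - d z) = a z + (1 + a z - e z) + (1 + a z - f z) + (1 + a z - g z) + 1"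
    "e z + f z + g z = a z + b z + c z + d z + 1" for z
    using sum[of z] by algebra+
  show ?thesis unfolding Kreg_def
    by (intro holomorphic_intros holomorphic_Freg hol s)
qed

lemma Kreg_three_term:
  assumes "e + f + g = 1 + a + b + c + d"
  shows "sn (e - a - b) * A (1 - a) (e - a) (f - a) (g - a) * A b (1 + b - e) (1 + b - f) (1 + b - g) * Kreg a b c d e f g * sn b * sn (e - a)
    + sn (b - a) * A (1 + a - e) (1 + b - e) (g - c) (g - d) * A a b (f - c) (f - d)
        * Kreg (e - a) (e - b) (e - c) (e - d) (1 + e - f) (1 + e - g) e * sn a * sn b
    - sn b * sn (e - b) * (sn (b - a) * sn (c - a) * sn (d - a) + sn (e - 2 * a) * sn (f - a) * sn (g - a)) / of_real pi ^ 4
        * Kreg b c d a e f g * sn a * sn (e - a) = 0"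
proof -
  define G where "G = (\<lambda>p::nat \<Rightarrow> complex. 1 + p 0 + p 1 + p 2 + p 3 - p 4 - p 5)"
  define \<Phi> where "\<Phi> = (\<lambda>p::nat \<Rightarrow> complex.
    sn (p 4 - p 0 - p 1) * A (1 - p 0) (p 4 - p 0) (p 5 - p 0) (G p - p 0) * A (p 1) (1 + p 1 - p 4) (1 + p 1 - p 5) (1 + p 1 - G p)
      * Kreg (p 0) (p 1) (p 2) (p 3) (p 4) (p 5) (G p) * sn (p 1) * sn (p 4 - p 0)
    + sn (p 1 - p 0) * A (1 + p 0 - p 4) (1 + p 1 - p 4) (G p - p 2) (G p - p 3) * A (p 0) (p 1) (p 5 - p 2) (p 5 - p 3)
        * Kreg (p 4 - p 0) (p 4 - p 1) (p 4 - p 2) (p 4 - p 3) (1 + p 4 - p 5) (1 + p 4 - G p) (p 4) * sn (p 0) * sn (p 1)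
    - sn (p 1) * sn (p 4 - p 1) * (sn (p 1 - p 0) * sn (p 2 - p 0) * sn (p 3 - p 0) + sn (p 4 - 2 * p 0) * sn (p 5 - p 0) * sn (G p - p 0)) / of_real pi ^ 4
        * Kreg (p 1) (p 2) (p 3) (p 0) (p 4) (p 5) (G p) * sn (p 0) * sn (p 4 - p 0))"
  \<comment> \<open>Here g = 4/5. The box changes g - f = 1/10 by less than 7/100, so f and g stay
    distinct; a and b differ for the division by sn (a - b) in \<open>Lnum_dual\<close>.\<close>
  define p0 where "p0 = (\<lambda>i. [1/5, 7/20, 3/20, 3/10, 1/2, 7/10] ! i :: real)"
  define w where "w = (\<lambda>i. [a, b, c, d, e, f] ! i)"
  have "\<Phi> w = 0"
  proof (rule zero_if_zero_on_real_box[where \<Phi> = \<Phi> and p = p0 and n = 6 and \<epsilon> = "1/100"])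
    show "(\<lambda>z. \<Phi> (\<lambda>i. u i + z * v i)) holomorphic_on UNIV" for u v
      unfolding \<Phi>_def G_def A_def
      by (intro holomorphic_on_diff holomorphic_on_add holomorphic_on_mult holomorphic_on_divide holomorphic_Kreg holomorphic_intros)
        (auto simp: algebra_simps)
    show "(1/100::real) > 0" by simp
    fix x assume x: "\<forall>i<6. \<bar>x i - p0 i\<bar> < 1/100"
    have x': "\<bar>x 0 - 1/5\<bar> < 1/100" "\<bar>x 1 - 7/20\<bar> < 1/100" "\<bar>x 2 - 3/20\<bar> < 1/100" "\<bar>x 3 - 3/10\<bar> < 1/100"
      "\<bar>x 4 - 1/2\<bar> < 1/100" "\<bar>x 5 - 7/10\<bar> < 1/100"
      using x[rule_format, of 0] x[rule_format, of 1] x[rule_format, of 2] x[rule_format, of 3] x[rule_format, of 4] x[rule_format, of 5]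
      by (simp_all add: p0_def)
    define a' b' c' d' e' f' g' where "a' = x 0" and "b' = x 1" and "c' = x 2" and "d' = x 3" and "e' = x 4" and "f' = x 5"
      and "g' = 1 + a' + b' + c' + d' - e' - f'"
    note x'' = x'[folded a'_def b'_def c'_def d'_def e'_def f'_def, unfolded abs_less_iff]
    have G: "G (\<lambda>i. of_real (x i)) = of_real g'"
      by (simp add: G_def g'_def a'_def b'_def c'_def d'_def e'_def f'_def)
    have 1: "0 < a'" "0 < b'" "0 < c'" "0 < d'" "a' < e'" "b' < e'" "c' < e'" "d' < e'" "e' < f'" "f' < 1"
      using x'' by linarith+
    have 2: "a' \<noteq> b'" "e' < g'" "g' < 1" "f' \<noteq> g'" "e' + f' + g' = 1 + a' + b' + c' + d'"
      using x'' unfolding g'_def by linarith+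
    show "\<Phi> (\<lambda>i. of_real (x i)) = 0"
      unfolding \<Phi>_def G
      by (rule Kreg_three_term_real[of a' b' c' d' e' f' g'])
        (use 1 2 in \<open>simp_all add: a'_def b'_def c'_def d'_def e'_def f'_def\<close>)
  qed
  moreover have "G w = g" using assms by (simp add: G_def w_def) algebra
  ultimately show ?thesis by (simp add: \<Phi>_def w_def)
qed

lemma K_eq_Kreg:
  assumes "e + f + g = 1 + a + b + c + d" and "K_defined a b c d e f g"
  shows "K a b c d e f g = Kreg a b c d e f g / sn a" "sn a \<noteq> 0"
proof -
  have s: "e + f + g = a + b + c + d + 1"
    "1 + a - b + (1 + a - c) + (1 + a - d) = a + (1 + a - e) + (1 + a - f) + (1 + a - g) + 1"
    using assms(1) by algebra+
  note d = assms(2)[unfolded K_defined_def]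
  show "sn a \<noteq> 0" using d by blast
  have "Freg a b c d e f g = F43 a b c d e f g * (rGamma e * rGamma f * rGamma g)"
    "Freg a (1 + a - e) (1 + a - f) (1 + a - g) (1 + a - b) (1 + a - c) (1 + a - d) =
     F43 a (1 + a - e) (1 + a - f) (1 + a - g) (1 + a - b) (1 + a - c) (1 + a - d) * (rGamma (1 + a - b) * rGamma (1 + a - c) * rGamma (1 + a - d))"
    using d by (auto intro!: Freg_conv_F43 s)
  thus "K a b c d e f g = Kreg a b c d e f g / sn a"
    unfolding K_def Kreg_def by (simp add: add_divide_distrib mult_ac)
qed

theorem proposition6p9:
  fixes a b c d e f g :: complex and x :: complex7
  assumes x: "x = (a, b, c, d, e, f, g)" and "x \<in> V"
    and "K_defined a b c d e f g"
    and "K_defined b c d a e f g"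
    and "K_defined (e - a) (e - b) (e - c) (e - d) (1 + e - f) (1 + e - g) e"
  shows "S [e - a - b] * A (1 - a) (e - a) (f - a) (g - a)
            * A b (1 + b - e) (1 + b - f) (1 + b - g) * K_p0 x
       + S [b - a] * A (1 + a - e) (1 + b - e) (g - c) (g - d)
            * A a b (f - c) (f - d) * K_n4 x
       - B5 x * K_p1 x = 0"
proof -
  have sum: "e + f + g = 1 + a + b + c + d" using assms(1,2) unfolding V_def by (simp add: algebra_simps)
  have sum1: "e + f + g = 1 + b + c + d + a"
    and sum2: "1 + e - f + (1 + e - g) + e = 1 + (e - a) + (e - b) + (e - c) + (e - d)" using sum by algebra+
  note K0 = K_eq_Kreg[OF sum assms(3)] and K1 = K_eq_Kreg[OF sum1 assms(4)] and K2 = K_eq_Kreg[OF sum2 assms(5)]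
  let ?P = "sn (e - a - b) * A (1 - a) (e - a) (f - a) (g - a) * A b (1 + b - e) (1 + b - f) (1 + b - g)"
  let ?Q = "sn (b - a) * A (1 + a - e) (1 + b - e) (g - c) (g - d) * A a b (f - c) (f - d)"
  let ?B = "sn b * sn (e - b) * (sn (b - a) * sn (c - a) * sn (d - a) + sn (e - 2 * a) * sn (f - a) * sn (g - a)) / of_real pi ^ 4"
  \<comment> \<open>Division by the three sines is legitimate because definedness of each
    \<open>K\<close> includes that its own sine does not vanish.\<close>
  have "?P * K a b c d e f g + ?Q * K (e - a) (e - b) (e - c) (e - d) (1 + e - f) (1 + e - g) e - ?B * K b c d a e f g =
    (?P * Kreg a b c d e f g * sn b * sn (e - a) + ?Q * Kreg (e - a) (e - b) (e - c) (e - d) (1 + e - f) (1 + e - g) e * sn a * sn b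
      - ?B * Kreg b c d a e f g * sn a * sn (e - a)) / (sn a * sn b * sn (e - a))"
    unfolding K0(1) K1(1) K2(1) using K0(2) K1(2) K2(2) by (simp add: diff_divide_distrib add_divide_distrib)
  also have "\<dots> = 0" unfolding Kreg_three_term[OF sum] by simp
  finally show ?thesis unfolding x by (simp add: S_def)
qed

end
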